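(* Let $P$ and $P'$ be projective spaces of the same finite dimension $n\ge 2$, and let ${\mathfrak F}$ and ${\mathfrak F}'$ be the sets of maximal flags of $P$ and $P'$, respectively. Let $f:{\mathfrak F}\to{\mathfrak F}'$ be any mapping sending apartments to apartments (i.e. for every apartment ${\mathfrak A}\subset{\mathfrak F}$ the image $f({\mathfrak A})$ is an apartment in ${\mathfrak F}'$). Then $f$ is the injection induced by a strong embedding of $P$ to $P'$ or of $P$ to the dual space $P'^{*}$. In particular, any surjection of ${\mathfrak F}$ to ${\mathfrak F}'$ transferring apartments to apartments is induced by a collineation of $P$ to $P'$ or of $P$ to $P'^{*}$.
   Context: A projective space is a set $P$ of points with a family of proper subsets called lines satisfying the Veblen–Young axioms: any two distinct points $p,q$ lie on a unique line $pq$; a line meeting two sides of a triangle in points other than their common vertex meets the third side; every line has at least three points. A subspace is a set $S\subset P$ containing the line $pq$ for all distinct $p,q\in S$ (so $\emptyset$ and points are subspaces); $\overline{X}$ is the smallest subspace containing $X$, called the subspace spanned by $X$. A subspace is $k$-dimensional if $k+1$ is the smallest number of points spanning it. A set $X\subset P$ is independent if $\overline{X}$ is not spanned by a proper subset of $X$; a base for $P$ is an independent set spanning $P$ (it has $n+1$ points if $\dim P=n$). Maximal flags: for $\dim P=n$, a maximal flag is a chain $p\in S_1\subset\dots\subset S_{n-2}\subset p^*$ of $n$ proper nonempty subspaces, one of each dimension $0,1,\dots,n-1$ (for $n=2$, an incident point–line pair). For a base $B$ of $P$, the apartment of ${\mathfrak F}$ associated with $B$ is the set of all maximal flags all of whose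 components are spanned by points of $B$ (i.e. by subsets of $B$). Apartments of ${\mathfrak F}'$ are defined in the same way using $P'$. Dual space: $P^*$ is the set of all $(n-1)$-dimensional subspaces of $P$; its lines are the sets of all $(n-1)$-dimensional subspaces containing a given $(n-2)$-dimensional subspace. It is an $n$-dimensional projective space; its $k$-dimensional subspaces are exactly the sets of all $(n-1)$-dimensional subspaces of $P$ containing a given $(n-k-1)$-dimensional subspace of $P$. This gives a one-to-one inclusion-reversing correspondence between subspaces of $P^*$ and of $P$, under which the maximal flags of $P^*$ are identified with the maximal flags of $P$. Embeddings: an injection $s:P\to Q$ between projective spaces is an embedding if it maps each line of $P$ into a line of $Q$ and maps each triple of non-collinear points to non-collinear points. It is strong if it sends independent subsets to independent subsets. A collineation is a bijection of points mapping the family of lines of $P$ onto the family of lines of $Q$. Induced mappings: if $s:P\to P'$ is a strong embedding then $\dim\overline{s(S)}=\dim S$ for each subspace $S$, and $s$ induces the mapping ${\mathfrak F}\to{\mathfrak F}'$ sending each maximal flag $(p,S_1,\dots,S_{n-2},p^* )$ to $(s(p),\overline{s(S_1)},\dots,\overline{s(S_{n-2})},\overline{s(p^* )})$. If $s:P\to P'^*$ is a strong embedding, the mapping induced by $s$ is defined in the same way with values in the maximal flags of $P'^*$, which are identified with the maximal flags of $P'$ by the one-to-one inclusion-reversing correspondence that sends each $k$-dimensional subspace of $P'^*$, being the set of all $(n-1)$-dimensional subspaces of $P'$ containing a certain $(n-k-1)$-dimensional subspace $U$ of $P'$, to this subspace $U$. *)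

theory Defs
  imports Main "HOL.Hull"
begin

record 'a geometry =
  points :: "'a set"
  lines :: "'a set set"

definition line_through :: "'a geometry \<Rightarrow> 'a \<Rightarrow> 'a \<Rightarrow> 'a set" where
  "line_through G p q = (THE l. l \<in> lines G \<and> p \<in> l \<and> q \<in> l)"

definition collinear3 :: "'a geometry \<Rightarrow> 'a \<Rightarrow> 'a \<Rightarrow> 'a \<Rightarrow> bool" where
  "collinear3 G a b c \<longleftrightarrow> (\<exists>l\<in>lines G. a \<in> l \<and> b \<in> l \<and> c \<in> l)"

text \<open>In \<open>veblen\<close>, the line \<open>l\<close> meets the sides \<open>ab\<close> and \<open>ac\<close> of the triangle \<open>abc\<close>
  in \<open>x\<close> and \<open>y\<close>, both different from the common vertex \<open>a\<close>.
  In \<open>thick\<close>, the three points are listed so that infinite lines are covered as well.\<close>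

locale projective_space =
  fixes G :: "'a geometry"
  assumes line_proper: "\<And>l. l \<in> lines G \<Longrightarrow> l \<subset> points G"
    and unique_line: "\<And>p q. p \<in> points G \<Longrightarrow> q \<in> points G \<Longrightarrow> p \<noteq> q \<Longrightarrow>
      \<exists>!l. l \<in> lines G \<and> p \<in> l \<and> q \<in> l"
    and veblen: "\<And>a b c l x y. \<lbrakk>a \<in> points G; b \<in> points G; c \<in> points G;
        \<not> collinear3 G a b c; l \<in> lines G;
        x \<in> l; x \<in> line_through G a b; x \<noteq> a;
        y \<in> l; y \<in> line_through G a c; y \<noteq> a\<rbrakk> \<Longrightarrow>
      l \<inter> line_through G b c \<noteq> {}"
    and thick: "\<And>l. l \<in> lines G \<Longrightarrow>
      \<exists>p q r. p \<in> l \<and> q \<in> l \<and> r \<in> l \<and> p \<noteq> q \<and> p \<noteq> r \<and> q \<noteq> r"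

definition is_subspace :: "'a geometry \<Rightarrow> 'a set \<Rightarrow> bool" where
  "is_subspace G S \<longleftrightarrow> S \<subseteq> points G \<and>
     (\<forall>p\<in>S. \<forall>q\<in>S. p \<noteq> q \<longrightarrow> line_through G p q \<subseteq> S)"

definition spanned :: "'a geometry \<Rightarrow> 'a set \<Rightarrow> 'a set" where
  "spanned G X = is_subspace G hull X"

text \<open>The empty subspace has no dimension in this sense (it would be \<open>-1\<close>).\<close>

definition has_dim :: "'a geometry \<Rightarrow> 'a set \<Rightarrow> nat \<Rightarrow> bool" where
  "has_dim G S k \<longleftrightarrow> is_subspace G S \<and>
     (\<exists>X\<subseteq>points G. finite X \<and> card X = k + 1 \<and> spanned G X = S) \<and>
     (\<forall>X\<subseteq>points G. finite X \<and> spanned G X = S \<longrightarrow> k + 1 \<le> card X)"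

definition independent :: "'a geometry \<Rightarrow> 'a set \<Rightarrow> bool" where
  "independent G X \<longleftrightarrow> X \<subseteq> points G \<and> (\<forall>Y. Y \<subset> X \<longrightarrow> spanned G Y \<noteq> spanned G X)"

definition is_base :: "'a geometry \<Rightarrow> 'a set \<Rightarrow> bool" where
  "is_base G B \<longleftrightarrow> independent G B \<and> spanned G B = points G"

text \<open>A maximal flag \<open>(p, S\<^sub>1, \<dots>, S\<^bsub>n-2\<^esub>, p\<^sup>*)\<close> is the list of its components,
  its entry number \<open>k\<close> being of dimension \<open>k\<close>; the point \<open>p\<close> is entered as the
  0-dimensional subspace \<open>{p}\<close>.\<close>

definition maximal_flags :: "nat \<Rightarrow> 'a geometry \<Rightarrow> 'a set list set" where
  "maximal_flags n G = {F. length F = n \<and> (\<forall>k<n. has_dim G (F ! k) k) \<and> sorted_wrt (\<subset>) F}"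

definition apartment_of :: "nat \<Rightarrow> 'a geometry \<Rightarrow> 'a set \<Rightarrow> 'a set list set" where
  "apartment_of n G B = {F \<in> maximal_flags n G. \<forall>S\<in>set F. \<exists>Y\<subseteq>B. spanned G Y = S}"

definition is_apartment :: "nat \<Rightarrow> 'a geometry \<Rightarrow> 'a set list set \<Rightarrow> bool" where
  "is_apartment n G A \<longleftrightarrow> (\<exists>B. is_base G B \<and> A = apartment_of n G B)"

definition hyperplanes_containing :: "nat \<Rightarrow> 'a geometry \<Rightarrow> 'a set \<Rightarrow> 'a set set" where
  "hyperplanes_containing n G U = {H. has_dim G H (n - 1) \<and> U \<subseteq> H}"

text \<open>The dual of an \<open>n\<close>-dimensional projective space, for \<open>n \<ge> 2\<close>.\<close>

definition dual_space :: "nat \<Rightarrow> 'a geometry \<Rightarrow> 'a set geometry" where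
  "dual_space n G =
     \<lparr>points = {H. has_dim G H (n - 1)},
      lines = {hyperplanes_containing n G U | U. has_dim G U (n - 2)}\<rparr>"

text \<open>The inclusion-reversing correspondence, taking a subspace of the dual space to the
  subspace of the original space that determines it.\<close>

definition dual_corr :: "nat \<Rightarrow> 'a geometry \<Rightarrow> 'a set set \<Rightarrow> 'a set" where
  "dual_corr n G T = (THE U. is_subspace G U \<and> T = hyperplanes_containing n G U)"

definition embedding :: "'a geometry \<Rightarrow> 'b geometry \<Rightarrow> ('a \<Rightarrow> 'b) \<Rightarrow> bool" where
  "embedding G H s \<longleftrightarrow> s ` points G \<subseteq> points H \<and> inj_on s (points G) \<and>
     (\<forall>l\<in>lines G. \<exists>m\<in>lines H. s ` l \<subseteq> m) \<and>
     (\<forall>a\<in>points G. \<forall>b\<in>points G. \<forall>c\<in>points G.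
        \<not> collinear3 G a b c \<longrightarrow> \<not> collinear3 H (s a) (s b) (s c))"

definition strong_embedding :: "'a geometry \<Rightarrow> 'b geometry \<Rightarrow> ('a \<Rightarrow> 'b) \<Rightarrow> bool" where
  "strong_embedding G H s \<longleftrightarrow> embedding G H s \<and>
     (\<forall>X. independent G X \<longrightarrow> independent H (s ` X))"

definition collineation :: "'a geometry \<Rightarrow> 'b geometry \<Rightarrow> ('a \<Rightarrow> 'b) \<Rightarrow> bool" where
  "collineation G H s \<longleftrightarrow> bij_betw s (points G) (points H) \<and> (\<lambda>l. s ` l) ` lines G = lines H"

definition induced :: "'b geometry \<Rightarrow> ('a \<Rightarrow> 'b) \<Rightarrow> 'a set list \<Rightarrow> 'b set list" where
  "induced H s F = map (\<lambda>S. spanned H (s ` S)) F"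

text \<open>For \<open>s\<close> with values in the dual of \<open>H\<close>; the correspondence reverses inclusions, so
  the components are listed in the opposite order.\<close>

definition dual_induced ::
    "nat \<Rightarrow> 'b geometry \<Rightarrow> ('a \<Rightarrow> 'b set) \<Rightarrow> 'a set list \<Rightarrow> 'b set list" where
  "dual_induced n H s F = rev (map (dual_corr n H) (induced (dual_space n H) s F))"

end

theory Submission
  imports Defs "HOL-Combinatorics.Permutations"
begin

text \<open>The flags of the apartment of a base \<open>B\<close> are the linear orders on \<open>B\<close>, and every two
  flags lie in a common apartment, so counting makes \<open>f\<close> injective. Injectivity makes \<open>f\<close>
  compatible with intersections of two apartments. The largest proper intersections of an apartment
  with others are its roots \<open>{F. a precedes b in F}\<close>; hence \<open>f\<close> carries roots of an apartment to
  roots of its image, that is, oriented edges \<open>ab\<close> of the complete graph on \<open>B\<close> to oriented edges.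
  Three roots have empty intersection only for a directed triangle, so this edge map comes from a
  bijection of the bases, up to reversing all edges. Whether the orders are reversed is
  the same for all apartments, because a set of flags differing only in the first component goes to
  flags differing only in the first or only in the last. If orders are kept, the first component
  of \<open>f F\<close> depends only on that of \<open>F\<close>, which gives the embedding. Otherwise compose \<open>f\<close> with
  the duality of \<open>P'\<close>.\<close>

section \<open>Subspaces and independence\<close>

text \<open>The hypothesis concerns whole apartments only; neither incidence nor injectivity is
  given, and \<open>P\<close> may be infinite. Finiteness enters through a single apartment with its
  \<open>(n+1)!\<close> flags. That two flags share an apartment is a Jordan-Hoelder argument: a
  permutation matches their layers, and one point for each matched pair of layers gives a base
  adapted to both. Roots are maximal because subspaces spanned by parts of a base intersect in a
  subspace spanned by a part of it: if the common flags of two apartments separated all ordered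
  pairs of points of one base, each of these points would be spanned by the other base. The image of
  a root is at first only contained in a root; equality follows because opposite roots partition an
  apartment. The condition \<open>n \<ge> 2\<close> supplies the third vertex of a triangle and
  keeps the first and the last component of a flag distinct. Composing with the duality avoids a
  second version of the embedding argument, at the price of showing that the dual is an
  \<open>n\<close>-dimensional projective space.\<close>

context projective_space
begin

lemma line_subset: "l \<in> lines G \<Longrightarrow> l \<subseteq> points G"
  using line_proper by blast

lemma line_through_props:
  assumes "p \<in> points G" "q \<in> points G" "p \<noteq> q"
  shows "line_through G p q \<in> lines G \<and> p \<in> line_through G p q \<and> q \<in> line_through G p q"
  using theI'[OF unique_line[OF assms]] unfolding line_through_def by auto

lemma line_through_eq:
  assumes "l \<in> lines G" "p \<in> l" "q \<in> l" "p \<noteq> q"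
  shows "line_through G p q = l"
proof -
  have "p \<in> points G" "q \<in> points G" using assms line_subset by auto
  from unique_line[OF this assms(4)] line_through_props[OF this assms(4)] assms
  show ?thesis by auto
qed

lemma line_through_points:
  "p \<in> points G \<Longrightarrow> q \<in> points G \<Longrightarrow> p \<noteq> q \<Longrightarrow> line_through G p q \<subseteq> points G"
  using line_subset line_through_props by blast

lemma line_through_eq':
  assumes "p \<in> points G" "q \<in> points G" "p \<noteq> q"
    and "u \<in> line_through G p q" "v \<in> line_through G p q" "u \<noteq> v"
  shows "line_through G u v = line_through G p q"
  using line_through_eq line_through_props assms by blast

lemma subspaceD: "is_subspace G S \<Longrightarrow> p \<in> S \<Longrightarrow> q \<in> S \<Longrightarrow> p \<noteq> q \<Longrightarrow> line_through G p q \<subseteq> S"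
  unfolding is_subspace_def by blast

lemma subspace_points: "is_subspace G S \<Longrightarrow> S \<subseteq> points G"
  unfolding is_subspace_def by blast

lemma is_subspace_points: "is_subspace G (points G)"
  unfolding is_subspace_def using line_through_points by blast

lemma is_subspace_Int:
  "is_subspace G S \<Longrightarrow> is_subspace G T \<Longrightarrow> is_subspace G (S \<inter> T)"
  unfolding is_subspace_def by blast

lemma is_subspace_spanned:
  assumes "X \<subseteq> points G"
  shows "is_subspace G (spanned G X)"
proof -
  have "spanned G X \<subseteq> points G"
    unfolding spanned_def using is_subspace_points assms by (rule hull_minimal[rotated])
  moreover have "line_through G p q \<subseteq> spanned G X"
    if "p \<in> spanned G X" "q \<in> spanned G X" "p \<noteq> q" for p q
    using that unfolding spanned_def hull_def by (blast dest: subspaceD)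
  ultimately show ?thesis unfolding is_subspace_def by blast
qed

lemma spanned_subset: "X \<subseteq> spanned G X"
  unfolding spanned_def by (rule hull_subset)

lemma spanned_mono: "X \<subseteq> Y \<Longrightarrow> spanned G X \<subseteq> spanned G Y"
  unfolding spanned_def by (rule hull_mono)

lemma spanned_minimal: "X \<subseteq> S \<Longrightarrow> is_subspace G S \<Longrightarrow> spanned G X \<subseteq> S"
  unfolding spanned_def by (rule hull_minimal)

lemma spanned_subspace: "is_subspace G S \<Longrightarrow> spanned G S = S"
  unfolding spanned_def by (rule hull_same)

lemma spanned_points: "X \<subseteq> points G \<Longrightarrow> spanned G X \<subseteq> points G"
  using spanned_minimal is_subspace_points by blast

lemma spanned_least: "X \<subseteq> spanned G Y \<Longrightarrow> Y \<subseteq> points G \<Longrightarrow> spanned G X \<subseteq> spanned G Y"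
  using spanned_minimal is_subspace_spanned by blast

lemma spanned_insert_spanned:
  assumes "X \<subseteq> points G" "p \<in> points G"
  shows "spanned G (insert p (spanned G X)) = spanned G (insert p X)"
proof
  have "insert p (spanned G X) \<subseteq> spanned G (insert p X)"
    using spanned_subset[of "insert p X"] spanned_mono[of X "insert p X"] by blast
  then show "spanned G (insert p (spanned G X)) \<subseteq> spanned G (insert p X)"
    using spanned_least[of _ "insert p X"] assms by blast
  show "spanned G (insert p X) \<subseteq> spanned G (insert p (spanned G X))"
    using spanned_mono[of "insert p X" "insert p (spanned G X)"] spanned_subset[of X] by blast
qed

lemma spanned_empty [simp]: "spanned G {} = {}"
  using spanned_minimal[of "{}" "{}"] by (simp add: is_subspace_def)

lemma spanned_singleton [simp]: "p \<in> points G \<Longrightarrow> spanned G {p} = {p}"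
  using spanned_subspace[of "{p}"] by (simp add: is_subspace_def)

text \<open>Two uses of \<open>veblen\<close> show that the cone over \<open>S\<close> with vertex
  \<open>x\<close> absorbs lines. In the triangle \<open>x s t\<close> the line \<open>uv\<close>
  cuts \<open>st\<close> in a point \<open>w\<close>; in the triangle \<open>u w s\<close> the line
  \<open>xz\<close>, which meets \<open>us\<close> in \<open>x\<close>, cuts \<open>ws\<close> in
  the required \<open>h\<close>. The condition \<open>u \<notin> S\<close> keeps the second triangle
  nondegenerate.\<close>

lemma join_step:
  assumes S: "is_subspace G S" and x: "x \<in> points G" "x \<notin> S" and st: "s \<in> S" "t \<in> S"
    and u: "u \<in> line_through G x s" "u \<noteq> x" "u \<notin> S"
    and v: "v \<in> line_through G x t" "v \<noteq> x" and "u \<noteq> v"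
    and z: "z \<in> line_through G u v" "z \<noteq> x"
  shows "\<exists>h\<in>S. z \<in> line_through G x h"
proof (cases "s = t \<or> z = u \<or> z \<in> S")
  case True
  have sP: "s \<in> points G" "x \<noteq> s" using S st x subspace_points by auto
  show ?thesis
    using True st u z line_through_eq'[OF x(1) sP u(1) _ \<open>u \<noteq> v\<close>] v
      line_through_props[OF x(1), of z] subspace_points[OF S] x by blast
next
  case False
  have P: "s \<in> points G" "t \<in> points G" "x \<noteq> s" "x \<noteq> t" "s \<noteq> t"
    using S st x subspace_points False by auto
  have uP: "u \<in> points G" "v \<in> points G" using line_through_points P x u v by blast+
  have stS: "line_through G s t \<subseteq> S" using subspaceD S st P by blast
  have nc: "\<not> collinear3 G x s t"
    using line_through_eq[of _ s t] stS x P unfolding collinear3_def by blast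
  note uv = line_through_props[OF uP \<open>u \<noteq> v\<close>]
  obtain w where w: "w \<in> line_through G u v" "w \<in> line_through G s t"
    using veblen[OF x(1) P(1,2) nc, of "line_through G u v" u v] uv u v by blast
  have wS: "w \<in> S" and wP: "w \<in> points G" using w stS S subspace_points by auto
  have uw: "u \<noteq> w" using wS u by blast
  have us: "u \<noteq> s" using u st by blast
  have luw: "line_through G u w = line_through G u v"
    using line_through_eq uv w uw by blast
  have lus: "line_through G u s = line_through G x s"
    using line_through_eq' line_through_props x(1) P(1,3) u us by blast
  have lxv: "line_through G x v = line_through G x t"
    using line_through_eq' line_through_props x(1) P v by metis
  have ws: "w \<noteq> s"
  proof
    assume "w = s"
    then have "v \<in> line_through G x s" using luw lus uv by simp
    then have "line_through G x v = line_through G x s"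
      using line_through_eq' line_through_props x(1) P(1,3) v by metis
    then have "line_through G x s = line_through G x t" using lxv by simp
    then show False using nc line_through_props x(1) P unfolding collinear3_def by metis
  qed
  have nc2: "\<not> collinear3 G u w s"
    using line_through_eq[of _ w s] subspaceD[OF S wS st(1) ws] u(3) ws
    unfolding collinear3_def by blast
  have zP: "z \<in> points G" using z uv line_subset by blast
  note xz = line_through_props[OF x(1) zP z(2)[symmetric]]
  have "x \<in> line_through G u s" using lus line_through_props x(1) P(1,3) by metis
  then obtain h where h: "h \<in> line_through G x z" "h \<in> line_through G w s"
    using veblen[OF uP(1) wP P(1) nc2, of "line_through G x z" z x] xz z False u luw by auto
  have hS: "h \<in> S" using h subspaceD[OF S wS st(1) ws] by blast
  then have "x \<noteq> h" using x by blast
  then have "line_through G x h = line_through G x z" using line_through_eq xz h by blast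
  then show ?thesis using hS xz by auto
qed

text \<open>The cone over \<open>S\<close> with vertex \<open>x\<close> is already a subspace, so it
  contains the whole join. Exchange, common apartments and intersections with hyperplanes all rest
  on this consequence of \<open>veblen\<close>.\<close>

lemma join_point:
  assumes S: "is_subspace G S" and x: "x \<in> points G" "x \<notin> S"
    and y: "y \<in> spanned G (insert x S)" "y \<noteq> x"
  shows "\<exists>h\<in>S. h \<in> line_through G x y"
proof -
  \<comment> \<open>The vertex is inserted separately: for empty \<open>S\<close> there are no lines
    to carry it.\<close>
  define T where "T = insert x {z. \<exists>h\<in>S. z \<in> line_through G x h}"
  have SP: "\<And>s. s \<in> S \<Longrightarrow> s \<in> points G \<and> x \<noteq> s" using S x subspace_points by blast
  have ST: "S \<subseteq> T" unfolding T_def using line_through_props x SP by blast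
  have TP: "T \<subseteq> points G" unfolding T_def using line_through_points x SP by blast
  \<comment> \<open>\<open>join_step\<close> needs an end point outside \<open>S\<close>. If only
    \<open>v\<close> lies outside, the two are swapped; if neither does, the line lies in
    \<open>S\<close>.\<close>
  have half: "z \<in> T" if uv: "u \<in> T" "v \<in> T" "u \<noteq> v" "u \<notin> S" "z \<in> line_through G u v" for u v z
  proof -
    consider "z = x" | "u = x" "z \<noteq> x" | "v = x" "z \<noteq> x" | "u \<noteq> x" "v \<noteq> x" "z \<noteq> x" by blast
    then show ?thesis
    proof cases
      case 1 then show ?thesis by (simp add: T_def)
    next
      case 2
      then obtain s where s: "s \<in> S" "v \<in> line_through G x s" using uv unfolding T_def by blast
      have "line_through G u v = line_through G x s"
        using 2 s line_through_eq' line_through_props x(1) SP[OF s(1)] uv by metis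
      then show ?thesis using s uv unfolding T_def by blast
    next
      case 3
      then obtain s where s: "s \<in> S" "u \<in> line_through G x s" using uv unfolding T_def by blast
      have "line_through G u v = line_through G x s"
        using 3 s line_through_eq' line_through_props x(1) SP[OF s(1)] uv by metis
      then show ?thesis using s uv unfolding T_def by blast
    next
      case 4
      obtain s t where "s \<in> S" "u \<in> line_through G x s" "t \<in> S" "v \<in> line_through G x t"
        using 4 uv unfolding T_def by blast
      then show ?thesis using join_step[OF S x, of s t u v z] 4 uv unfolding T_def by blast
    qed
  qed
  have "is_subspace G T" unfolding is_subspace_def
  proof (intro conjI ballI impI TP subsetI)
    fix u v z assume uv: "u \<in> T" "v \<in> T" "u \<noteq> v" "z \<in> line_through G u v"
    have "line_through G v u = line_through G u v"
      using line_through_eq line_through_props uv TP by (metis subsetD)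
    then show "z \<in> T" using half[of u v z] half[of v u z] uv subspaceD[OF S, of u v] ST
      by (metis subsetD)
  qed
  then have "y \<in> T" using y spanned_minimal[of "insert x S" T] ST unfolding T_def by blast
  then obtain h where h: "h \<in> S" "y \<in> line_through G x h" using y unfolding T_def by blast
  then have "line_through G x y = line_through G x h"
    using line_through_eq' line_through_props x(1) SP[OF h(1)] y by metis
  then show ?thesis using h line_through_props x(1) SP[OF h(1)] by metis
qed

text \<open>For \<open>p \<noteq> q\<close> the line \<open>pq\<close> meets the span of
  \<open>X\<close> in a point \<open>h\<close> different from \<open>q\<close>, and the line
  \<open>qh\<close> leads back to \<open>p\<close>.\<close>

lemma exchange:
  assumes X: "X \<subseteq> points G" "p \<in> points G" and q: "q \<in> spanned G (insert p X)" "q \<notin> spanned G X"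
  shows "p \<in> spanned G (insert q X)"
proof (cases "p = q")
  case True then show ?thesis using spanned_subset by blast
next
  case False
  have sub: "is_subspace G (spanned G X)" using is_subspace_spanned X by blast
  have p: "p \<notin> spanned G X" using q X spanned_least[of "insert p X" X] spanned_subset[of X] by blast
  have qP: "q \<in> points G" using q X spanned_points[of "insert p X"] by blast
  obtain h where h: "h \<in> spanned G X" "h \<in> line_through G p q"
    using join_point[OF sub X(2) p, of q] q False by (auto simp: spanned_insert_spanned X)
  have hP: "h \<in> points G" "q \<noteq> h" using h X spanned_points q by auto
  have "line_through G q h = line_through G p q"
    using line_through_eq' line_through_props h hP X qP False by metis
  moreover have "line_through G q h \<subseteq> spanned G (insert q X)"
    using subspaceD[OF is_subspace_spanned, of "insert q X" q h] X qP hP h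
      spanned_subset[of "insert q X"] spanned_mono[of X "insert q X"] by blast
  ultimately show ?thesis using line_through_props X qP False by blast
qed

section \<open>Independence, rank and supports with respect to a base\<close>

lemma independent_iff:
  "independent G X \<longleftrightarrow> X \<subseteq> points G \<and> (\<forall>x\<in>X. x \<notin> spanned G (X - {x}))"
proof (intro iffI conjI ballI)
  fix x assume X: "independent G X" and x: "x \<in> X"
  show "x \<notin> spanned G (X - {x})"
  proof
    assume "x \<in> spanned G (X - {x})"
    then have "X \<subseteq> spanned G (X - {x})" using spanned_subset[of "X - {x}"] by blast
    then have "spanned G X = spanned G (X - {x})"
      using spanned_least[of X "X - {x}"] spanned_mono[of "X - {x}" X] X
      unfolding independent_def by blast
    then show False using X x unfolding independent_def by (metis Diff_subset DiffD2 psubsetI singletonI)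
  qed
next
  assume X: "X \<subseteq> points G \<and> (\<forall>x\<in>X. x \<notin> spanned G (X - {x}))"
  show "independent G X" unfolding independent_def
  proof (intro conjI allI impI notI)
    fix Y assume Y: "Y \<subset> X" "spanned G Y = spanned G X"
    then obtain x where x: "x \<in> X" "x \<notin> Y" by blast
    have "x \<in> spanned G Y" using Y x spanned_subset[of X] by blast
    then show False using X x Y spanned_mono[of Y "X - {x}"] by blast
  qed (use X in blast)
qed (auto simp: independent_def)

lemma independent_points: "independent G X \<Longrightarrow> X \<subseteq> points G"
  by (simp add: independent_def)

lemma independent_mono: "independent G X \<Longrightarrow> Y \<subseteq> X \<Longrightarrow> independent G Y"
  unfolding independent_iff using spanned_mono[of "Y - {_}" "X - {_}"] by blast

lemma independent_insert:
  assumes "independent G X" "p \<in> points G" "p \<notin> spanned G X"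
  shows "independent G (insert p X)"
  unfolding independent_iff
proof (intro conjI ballI notI)
  fix x assume x: "x \<in> insert p X" "x \<in> spanned G (insert p X - {x})"
  have pX: "p \<notin> X" using assms spanned_subset[of X] by blast
  show False
  proof (cases "x = p")
    case True then show False using x assms pX by simp
  next
    case False
    then have xX: "x \<in> X" and eq: "insert p X - {x} = insert p (X - {x})" using x by auto
    have "p \<in> spanned G (insert x (X - {x}))"
      using exchange[of "X - {x}" p x] x eq assms xX unfolding independent_iff by auto
    then show False using assms xX by (simp add: insert_absorb)
  qed
qed (use assms in \<open>auto simp: independent_def\<close>)

lemma independent_mem:
  "independent G X \<Longrightarrow> Y \<subseteq> X \<Longrightarrow> x \<in> X \<Longrightarrow> x \<in> spanned G Y \<longleftrightarrow> x \<in> Y"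
  unfolding independent_iff using spanned_subset[of Y] spanned_mono[of Y "X - {x}"] by blast

lemma independent_spanned_Int: "independent G X \<Longrightarrow> Y \<subseteq> X \<Longrightarrow> X \<inter> spanned G Y = Y"
  using independent_mem[of X Y] by auto

text \<open>Steinitz exchange: a point \<open>x\<close> of \<open>X - Y\<close> is replaced by some
  \<open>y\<close> of \<open>Y\<close> outside the span of \<open>X - {x}\<close>. Such a
  \<open>y\<close> exists, as otherwise that span would contain \<open>Y\<close> and hence
  \<open>x\<close>. The size stays the same while \<open>X - Y\<close> shrinks.\<close>

lemma independent_card_le_finite:
  assumes "finite X" "independent G X" "finite Y" "Y \<subseteq> points G" "X \<subseteq> spanned G Y"
  shows "card X \<le> card Y"
  using assms
proof (induction "card (X - Y)" arbitrary: X)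
  case 0
  then show ?case by (simp add: card_mono)
next
  case (Suc m)
  obtain x where x: "x \<in> X" "x \<notin> Y"
    using Suc.hyps(2) by (metis card.empty Diff_eq_empty_iff nat.simps(3) subsetI)
  have xn: "x \<notin> spanned G (X - {x})" using x Suc.prems(2) unfolding independent_iff by blast
  have XP: "X - {x} \<subseteq> points G" using Suc.prems independent_points by blast
  have "\<not> Y \<subseteq> spanned G (X - {x})"
    using spanned_least[of Y "X - {x}"] XP xn x Suc.prems(5) by blast
  then obtain y where y: "y \<in> Y" "y \<notin> spanned G (X - {x})" by blast
  let ?X = "insert y (X - {x})"
  have ynX: "y \<notin> X - {x}" using y spanned_subset[of "X - {x}"] by blast
  have "?X - Y = (X - Y) - {x}" using x y by blast
  then have "m = card (?X - Y)" using Suc.hyps(2) x Suc.prems(1) by simp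
  moreover have "independent G ?X"
    using independent_insert[OF independent_mono[OF Suc.prems(2)]] y Suc.prems(4) by blast
  moreover have "?X \<subseteq> spanned G Y" using Suc.prems(5) y spanned_subset[of Y] by blast
  ultimately have "card ?X \<le> card Y" using Suc by simp
  moreover have "card ?X = card X"
    using ynX x Suc.prems(1) by (metis card.remove card_insert_disjoint finite_Diff)
  ultimately show ?case by simp
qed

text \<open>An infinite \<open>X\<close> would contain an independent set of
  \<open>Suc (card Y)\<close> points, contrary to the finite case.\<close>

lemma independent_card_le:
  assumes "independent G X" "finite Y" "Y \<subseteq> points G" "X \<subseteq> spanned G Y"
  shows "finite X \<and> card X \<le> card Y"
proof -
  have "finite X"
  proof (rule ccontr)
    assume "infinite X"
    then obtain Z where Z: "Z \<subseteq> X" "finite Z" "card Z = Suc (card Y)"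
      using infinite_arbitrarily_large by blast
    then show False using independent_card_le_finite[of Z Y] assms independent_mono[of X Z] by auto
  qed
  then show ?thesis using independent_card_le_finite assms by blast
qed

lemma independent_extend:
  assumes "finite Y" "independent G X" "Y \<subseteq> points G"
  shows "\<exists>Z. X \<subseteq> Z \<and> Z \<subseteq> X \<union> Y \<and> independent G Z \<and> Y \<subseteq> spanned G Z"
  using assms
proof (induction Y)
  case empty then show ?case by blast
next
  case (insert y Y)
  then obtain Z where Z: "X \<subseteq> Z" "Z \<subseteq> X \<union> Y" "independent G Z" "Y \<subseteq> spanned G Z" by auto
  show ?case
  proof (cases "y \<in> spanned G Z")
    case True then show ?thesis using Z by blast
  next
    case False
    have "independent G (insert y Z)" using independent_insert Z False insert.prems by blast
    moreover have "insert y Y \<subseteq> spanned G (insert y Z)"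
      using Z spanned_mono[of Z "insert y Z"] spanned_subset[of "insert y Z"] by blast
    ultimately show ?thesis using Z by (intro exI[of _ "insert y Z"]) blast
  qed
qed

text \<open>Rank is dimension plus one, so that the empty subspace has rank \<open>0\<close>.\<close>

definition has_rank :: "'a set \<Rightarrow> nat \<Rightarrow> bool" where
  "has_rank S r \<longleftrightarrow> (\<exists>X. independent G X \<and> finite X \<and> card X = r \<and> spanned G X = S)"

lemma has_rankI: "independent G X \<Longrightarrow> finite X \<Longrightarrow> has_rank (spanned G X) (card X)"
  unfolding has_rank_def by blast

lemma has_rank_subspace: "has_rank S r \<Longrightarrow> is_subspace G S"
  unfolding has_rank_def independent_def using is_subspace_spanned by blast

lemma has_rank_mono:
  assumes "has_rank S r" "has_rank T t" "S \<subseteq> T"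
  shows "r \<le> t"
proof -
  obtain X Y where "independent G X" "card X = r" "spanned G X = S"
    and "independent G Y" "finite Y" "card Y = t" "spanned G Y = T"
    using assms unfolding has_rank_def by blast
  then show ?thesis
    using independent_card_le[of X Y] independent_points[of Y] spanned_subset[of X] assms(3) by auto
qed

lemma has_rank_unique: "has_rank S r \<Longrightarrow> has_rank S t \<Longrightarrow> r = t"
  by (simp add: antisym has_rank_mono)

lemma has_rank_card:
  assumes "independent G X" "has_rank (spanned G X) r"
  shows "finite X \<and> card X = r"
proof -
  obtain Y where Y: "independent G Y" "finite Y" "card Y = r" "spanned G Y = spanned G X"
    using assms unfolding has_rank_def by auto
  have "finite X" using independent_card_le[OF assms(1) Y(2)] Y spanned_subset[of X]
      independent_points[OF Y(1)] by auto
  then show ?thesis using has_rankI assms has_rank_unique by blast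
qed

lemma has_rank_basis_extend:
  assumes "independent G X" "X \<subseteq> T" "has_rank T t"
  shows "\<exists>Z. X \<subseteq> Z \<and> independent G Z \<and> finite Z \<and> card Z = t \<and> spanned G Z = T"
proof -
  obtain Y where Y: "independent G Y" "finite Y" "card Y = t" "spanned G Y = T"
    using assms unfolding has_rank_def by auto
  then obtain Z where Z: "X \<subseteq> Z" "Z \<subseteq> X \<union> Y" "independent G Z" "Y \<subseteq> spanned G Z"
    using independent_extend[OF Y(2) assms(1)] independent_points by metis
  have "Z \<subseteq> T" using Z Y assms spanned_subset[of Y] by blast
  then have "spanned G Z = T"
    using spanned_least[of Y Z] spanned_least[of Z Y] Z Y independent_points by blast
  then show ?thesis using has_rank_card[OF Z(3)] assms Z by blast
qed

lemma has_rank_eq: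
  assumes "has_rank S r" "has_rank T r" "S \<subseteq> T"
  shows "S = T"
proof -
  obtain X where X: "independent G X" "finite X" "card X = r" "spanned G X = S"
    using assms unfolding has_rank_def by auto
  then obtain Z where Z: "X \<subseteq> Z" "finite Z" "card Z = r" "spanned G Z = T"
    using has_rank_basis_extend[OF X(1) _ assms(2)] assms spanned_subset[of X] by blast
  then have "X = Z" using X card_subset_eq by blast
  then show ?thesis using X Z by simp
qed

text \<open>A largest independent subset of \<open>S\<close> spans \<open>S\<close>. It exists
  because all independent subsets have at most \<open>t\<close> points, although \<open>S\<close>
  itself may be infinite.\<close>

lemma subspace_has_rank:
  assumes "is_subspace G S" "S \<subseteq> T" "has_rank T t"
  shows "\<exists>r\<le>t. has_rank S r"
proof -
  obtain Y where Y: "independent G Y" "finite Y" "card Y = t" "spanned G Y = T"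
    using assms unfolding has_rank_def by auto
  let ?Q = "\<lambda>X. independent G X \<and> X \<subseteq> S"
  have bound: "finite X \<and> card X \<le> t" if "?Q X" for X
    using independent_card_le[of X Y] that Y assms independent_points by blast
  have "?Q {}" by (simp add: independent_def)
  then obtain X where X: "?Q X" and max: "\<And>Z. ?Q Z \<Longrightarrow> card Z \<le> card X"
    using ex_has_greatest_nat[of ?Q "{}" card "Suc t"] bound by (metis less_Suc_eq_le)
  have "S \<subseteq> spanned G X"
  proof (rule subsetI, rule ccontr)
    fix p assume p: "p \<in> S" "p \<notin> spanned G X"
    then have "?Q (insert p X)" using independent_insert X subspace_points[OF assms(1)] by blast
    moreover have "p \<notin> X" using p spanned_subset[of X] by blast
    ultimately show False using max[of "insert p X"] bound[OF X] by simp
  qed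
  then have "spanned G X = S" using spanned_minimal X assms(1) by blast
  then show ?thesis using has_rankI[of X] X bound[OF X] by auto
qed

lemma has_rank_insert:
  assumes "has_rank S r" "p \<in> points G" "p \<notin> S"
  shows "has_rank (spanned G (insert p S)) (Suc r)"
proof -
  obtain X where X: "independent G X" "finite X" "card X = r" "spanned G X = S"
    using assms unfolding has_rank_def by auto
  have "p \<notin> X" using X assms spanned_subset[of X] by blast
  then show ?thesis using has_rankI[of "insert p X"] independent_insert[of X p] X assms
      spanned_insert_spanned[of X p] independent_points by auto
qed

lemma has_rank_cover:
  assumes "has_rank S r" "has_rank T (Suc r)" "S \<subseteq> T" "p \<in> T" "p \<notin> S"
  shows "spanned G (insert p S) = T"
  using has_rank_eq[OF has_rank_insert[OF assms(1) _ assms(5)] assms(2)] assms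
    spanned_minimal[of "insert p S" T] has_rank_subspace[OF assms(2)] subspace_points by blast

lemma has_rank_0: "has_rank S 0 \<longleftrightarrow> S = {}"
proof
  assume "has_rank S 0"
  then show "S = {}" unfolding has_rank_def by auto
next
  have "independent G {}" by (simp add: independent_def)
  then show "S = {} \<Longrightarrow> has_rank S 0" using has_rankI[of "{}"] by simp
qed

lemma has_rank_1: "has_rank S (Suc 0) \<longleftrightarrow> (\<exists>p\<in>points G. S = {p})"
proof
  assume "has_rank S (Suc 0)"
  then obtain X where X: "independent G X" "card X = 1" "spanned G X = S"
    unfolding has_rank_def by auto
  then obtain p where "X = {p}" using card_1_singletonE by blast
  then show "\<exists>p\<in>points G. S = {p}" using X independent_points[of X] by auto
next
  assume "\<exists>p\<in>points G. S = {p}"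
  then show "has_rank S (Suc 0)"
    using has_rank_insert[of "{}" 0] has_rank_0 by auto
qed

text \<open>A spanning set of least size is independent, and by Steinitz exchange no spanning set is
  smaller than an independent one. From here on ranks replace dimensions.\<close>

lemma has_dim_iff: "has_dim G S k \<longleftrightarrow> has_rank S (Suc k)"
proof
  assume S: "has_dim G S k"
  then obtain X where X: "X \<subseteq> points G" "finite X" "card X = k + 1" "spanned G X = S"
    unfolding has_dim_def by blast
  have "independent G X" unfolding independent_def
  proof (intro conjI allI impI notI)
    fix Y assume Y: "Y \<subset> X" "spanned G Y = spanned G X"
    then have "card Y < card X" using X psubset_card_mono by blast
    moreover have "k + 1 \<le> card Y" using S X Y finite_subset[of Y X] unfolding has_dim_def by auto
    ultimately show False using X by simp
  qed (use X in blast)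
  then show "has_rank S (Suc k)" using X unfolding has_rank_def by auto
next
  assume S: "has_rank S (Suc k)"
  then obtain X where X: "independent G X" "finite X" "card X = Suc k" "spanned G X = S"
    unfolding has_rank_def by auto
  have "Suc k \<le> card Y" if "Y \<subseteq> points G" "finite Y" "spanned G Y = S" for Y
    using independent_card_le[of X Y] X that spanned_subset[of X] by auto
  then show "has_dim G S k" using X has_rank_subspace[OF S] independent_points[OF X(1)]
    unfolding has_dim_def by auto
qed

text \<open>Substitute for the support of a coordinate vector. Take \<open>Z\<close> of least size;
  a point \<open>z\<close> of \<open>Z - Y\<close> could be exchanged against \<open>x\<close> and
  would then lie in the span of \<open>B - {z}\<close>.\<close>

lemma least_support:
  assumes B: "independent G B" "finite B" and x: "x \<in> spanned G B"
  shows "\<exists>Z\<subseteq>B. x \<in> spanned G Z \<and> (\<forall>Y\<subseteq>B. x \<in> spanned G Y \<longrightarrow> Z \<subseteq> Y)"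
proof -
  let ?Q = "\<lambda>Z. Z \<subseteq> B \<and> x \<in> spanned G Z"
  obtain Z where Z: "?Q Z" and min: "\<And>Y. ?Q Y \<Longrightarrow> card Z \<le> card Y"
    using ex_has_least_nat[of ?Q B card] x by auto
  have "Z \<subseteq> Y" if Y: "Y \<subseteq> B" "x \<in> spanned G Y" for Y
  proof (rule subsetI, rule ccontr)
    fix z assume z: "z \<in> Z" "z \<notin> Y"
    have BP: "B \<subseteq> points G" using B independent_points by blast
    have "finite Z" using Z B finite_subset by blast
    then have "card (Z - {z}) < card Z" using z by (meson card_Diff1_less)
    then have "x \<notin> spanned G (Z - {z})" using min[of "Z - {z}"] Z by auto
    then have "z \<in> spanned G (insert x (Z - {z}))"
      using exchange[of "Z - {z}" z x] Z z BP by (auto simp: insert_absorb)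
    moreover have "insert x (Z - {z}) \<subseteq> spanned G (B - {z})"
      using Y z Z spanned_mono[of Y "B - {z}"] spanned_subset[of "B - {z}"] by blast
    ultimately have "z \<in> spanned G (B - {z})" using spanned_least[of _ "B - {z}"] BP by blast
    then show False using B z Z unfolding independent_iff by blast
  qed
  then show ?thesis using Z by blast
qed

text \<open>The least support of a common point lies in every member of the family. The family must
  be nonempty, since the intersection over the empty family is the whole type.\<close>

lemma spanned_Int_Inter:
  assumes B: "independent G B" "finite B"
    and \<S>: "\<S> \<noteq> {}" "\<And>S. S \<in> \<S> \<Longrightarrow> \<exists>Y\<subseteq>B. spanned G Y = S"
  shows "spanned G (B \<inter> \<Inter>\<S>) = \<Inter>\<S>"
proof (intro antisym subsetI)
  fix x assume x: "x \<in> \<Inter>\<S>"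
  obtain S0 where "S0 \<in> \<S>" using \<S>(1) by blast
  then obtain Y0 where "Y0 \<subseteq> B" "x \<in> spanned G Y0" using x \<S>(2) by blast
  then have "x \<in> spanned G B" using spanned_mono[of Y0 B] by blast
  then obtain Z where Z: "Z \<subseteq> B" "x \<in> spanned G Z" "\<forall>Y\<subseteq>B. x \<in> spanned G Y \<longrightarrow> Z \<subseteq> Y"
    using least_support[OF B] by meson
  have "Z \<subseteq> S" if S: "S \<in> \<S>" for S
  proof -
    obtain Y where "Y \<subseteq> B" "spanned G Y = S" using \<S>(2) S by blast
    then show ?thesis using Z(3) x S spanned_subset[of Y] by blast
  qed
  then show "x \<in> spanned G (B \<inter> \<Inter>\<S>)" using Z spanned_mono[of Z "B \<inter> \<Inter>\<S>"] by blast
next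
  fix x assume x: "x \<in> spanned G (B \<inter> \<Inter>\<S>)"
  have "x \<in> S" if S: "S \<in> \<S>" for S
  proof -
    obtain Y where "Y \<subseteq> B" "spanned G Y = S" using \<S>(2) S by blast
    then have "is_subspace G S" using is_subspace_spanned[of Y] independent_points[OF B(1)] by blast
    then show ?thesis using spanned_minimal[of "B \<inter> \<Inter>\<S>" S] S x by blast
  qed
  then show "x \<in> \<Inter>\<S>" by blast
qed

end

section \<open>Flags and apartments\<close>

text \<open>Entry \<open>k\<close> uses the \<open>k + 1\<close> points \<open>y 0\<close>, ...,
  \<open>y k\<close>. The point \<open>y n\<close> enters no component; within a base it is the one
  left over.\<close>

definition flag_of :: "nat \<Rightarrow> 'a geometry \<Rightarrow> (nat \<Rightarrow> 'a) \<Rightarrow> 'a set list" where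
  "flag_of n G y = map (\<lambda>k. spanned G (y ` {..k})) [0..<n]"

lemma length_flag_of [simp]: "length (flag_of n G y) = n"
  by (simp add: flag_of_def)

lemma nth_flag_of [simp]: "k < n \<Longrightarrow> flag_of n G y ! k = spanned G (y ` {..k})"
  by (simp add: flag_of_def)

lemma flag_of_cong: "(\<And>i. i \<le> n \<Longrightarrow> y i = z i) \<Longrightarrow> flag_of n G y = flag_of n G z"
  unfolding flag_of_def by (auto intro!: arg_cong[of _ _ "spanned G"] image_cong)

text \<open>For a flag of the apartment of \<open>B\<close>, this relation orders \<open>B\<close> by first occurrence in the
  flag. The flags with \<open>precedes F a b\<close> form a root (half-apartment).\<close>

definition precedes :: "'a set list \<Rightarrow> 'a \<Rightarrow> 'a \<Rightarrow> bool" where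
  "precedes F a b \<longleftrightarrow> (\<forall>S\<in>set F. b \<in> S \<longrightarrow> a \<in> S)"

text \<open>By strong induction the enumerations agree below \<open>i\<close>, so neither can list
  the other's \<open>i\<close>-th value before position \<open>i\<close>; comparing these two values
  under \<open>R\<close> leaves only equality.\<close>

lemma order_enumeration_unique:
  fixes y z :: "nat \<Rightarrow> 'a"
  assumes y: "bij_betw y {..n} B" "\<And>i j. i \<le> n \<Longrightarrow> j \<le> n \<Longrightarrow> R (y i) (y j) \<longleftrightarrow> i \<le> j"
    and z: "bij_betw z {..n} B" "\<And>i j. i \<le> n \<Longrightarrow> j \<le> n \<Longrightarrow> R (z i) (z j) \<longleftrightarrow> i \<le> j"
    and "i \<le> n"
  shows "y i = z i"
  using \<open>i \<le> n\<close>
proof (induction i rule: less_induct)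
  case (less i)
  have "z i \<in> y ` {..n}" "y i \<in> z ` {..n}"
    using bij_betwE[OF y(1)] bij_betwE[OF z(1)] bij_betw_imp_surj_on[OF y(1)]
      bij_betw_imp_surj_on[OF z(1)] less.prems by auto
  then obtain k m where k: "k \<le> n" "z i = y k" and m: "m \<le> n" "y i = z m" by auto
  have inj: "inj_on y {..n}" "inj_on z {..n}" using y z bij_betw_imp_inj_on by blast+
  have "i \<le> k"
  proof (rule ccontr)
    assume "\<not> i \<le> k"
    then have "z i = z k" using less.IH[of k] k by simp
    then show False using inj_onD[OF inj(2), of i k] k less.prems \<open>\<not> i \<le> k\<close> by simp
  qed
  have "i \<le> m"
  proof (rule ccontr)
    assume "\<not> i \<le> m"
    then have "y i = y m" using less.IH[of m] m by simp
    then show False using inj_onD[OF inj(1), of i m] m less.prems \<open>\<not> i \<le> m\<close> by simp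
  qed
  have "R (z i) (y i)" using z(2)[of i m] m \<open>i \<le> m\<close> less.prems by simp
  then have "k \<le> i" using y(2)[of k i] k less.prems by simp
  then show ?case using k \<open>i \<le> k\<close> by simp
qed

text \<open>Keys prescribe an order only as far as an argument needs it; sorting breaks the ties
  arbitrarily.\<close>

lemma enumerate_by_key:
  fixes r :: "'a \<Rightarrow> nat"
  assumes "finite B" "card B = Suc n"
  shows "\<exists>y. bij_betw y {..n} B \<and> (\<forall>i j. i \<le> j \<longrightarrow> j \<le> n \<longrightarrow> r (y i) \<le> r (y j))"
proof -
  obtain xs where xs: "set xs = B" "distinct xs" using finite_distinct_list assms(1) by blast
  define zs where "zs = sort_key r xs"
  have zs: "set zs = B" "distinct zs" "sorted (map r zs)" by (simp_all add: zs_def xs)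
  then have len: "length zs = Suc n" using distinct_card assms by metis
  have "bij_betw ((!) zs) {..n} B"
    using bij_betw_nth[OF zs(2), of "{..n}" B] zs(1) len by (simp add: lessThan_Suc_atMost)
  moreover have "r (zs ! i) \<le> r (zs ! j)" if "i \<le> j" "j \<le> n" for i j
    using sorted_nth_mono[OF zs(3), of i j] that len by simp
  ultimately show ?thesis by blast
qed

locale projective_space_dim = projective_space G for G :: "'a geometry" +
  fixes n :: nat
  assumes dim: "has_dim G (points G) n"
begin

abbreviation flags :: "'a set list set" where "flags \<equiv> maximal_flags n G"
abbreviation apartment :: "'a set \<Rightarrow> 'a set list set" where "apartment \<equiv> apartment_of n G"
abbreviation flag :: "(nat \<Rightarrow> 'a) \<Rightarrow> 'a set list" where "flag \<equiv> flag_of n G"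

lemma rank_points: "has_rank (points G) (Suc n)"
  using dim has_dim_iff by blast

lemma baseD:
  assumes "is_base G B"
  shows "independent G B" "finite B" "card B = Suc n" "B \<subseteq> points G"
    "spanned G B = points G"
  using assms has_rank_card[of B "Suc n"] rank_points independent_points
  unfolding is_base_def by auto

lemma independent_base:
  assumes "independent G X" "card X = Suc n"
  shows "is_base G X"
proof -
  have "finite X" using assms card.infinite by fastforce
  then have "has_rank (spanned G X) (Suc n)" using assms has_rankI by metis
  then have "spanned G X = points G"
    using has_rank_eq[OF _ rank_points] spanned_points independent_points assms by blast
  then show ?thesis using assms unfolding is_base_def by blast
qed

lemma independent_extend_base:
  assumes "independent G X"
  shows "\<exists>B. X \<subseteq> B \<and> is_base G B"
  using has_rank_basis_extend[OF assms independent_points[OF assms] rank_points]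
  unfolding is_base_def by blast

lemma bij_mem_span:
  assumes "is_base G B" "bij_betw y {..n} B" "j \<le> n" "k \<le> n"
  shows "y j \<in> spanned G (y ` {..k}) \<longleftrightarrow> j \<le> k"
proof -
  have inj: "inj_on y {..n}" and im: "y ` {..n} = B" using assms by (auto simp: bij_betw_def)
  have "y j \<in> B" "y ` {..k} \<subseteq> B" using im assms by auto
  then have "y j \<in> spanned G (y ` {..k}) \<longleftrightarrow> y j \<in> y ` {..k}"
    using independent_mem[OF baseD(1)[OF assms(1)]] by blast
  also have "\<dots> \<longleftrightarrow> j \<le> k"
    using inj_on_image_mem_iff[OF inj, of j "{..k}"] assms by auto
  finally show ?thesis .
qed

lemma base_Int_span:
  assumes "is_base G B" "bij_betw y {..n} B" "k \<le> n"
  shows "B \<inter> spanned G (y ` {..k}) = y ` {..k}"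
proof -
  have "y ` {..k} \<subseteq> B" using assms by (auto simp: bij_betw_def)
  then show ?thesis using independent_spanned_Int baseD(1)[OF assms(1)] by blast
qed

lemma flag_in_apartment:
  assumes B: "is_base G B" and y: "bij_betw y {..n} B"
  shows "flag y \<in> apartment B"
proof -
  have inj: "inj_on y {..n}" and im: "y ` {..n} = B" using y by (auto simp: bij_betw_def)
  have dims: "has_dim G (spanned G (y ` {..k})) k" if "k < n" for k
  proof -
    have "y ` {..k} \<subseteq> B" using im that by auto
    then have "independent G (y ` {..k})" using independent_mono[OF baseD(1)[OF B]] by blast
    moreover have "card (y ` {..k}) = Suc k"
      using card_image[OF inj_on_subset[OF inj, of "{..k}"]] that by auto
    ultimately show ?thesis using has_rankI[of "y ` {..k}"] has_dim_iff by simp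
  qed
  have strict: "spanned G (y ` {..i}) \<subset> spanned G (y ` {..j})" if "i < j" "j < n" for i j
  proof -
    have "y ` {..i} \<subseteq> y ` {..j}" using that by auto
    then have "spanned G (y ` {..i}) \<subseteq> spanned G (y ` {..j})" by (rule spanned_mono)
    then show ?thesis using bij_mem_span[OF B y, of j i] bij_mem_span[OF B y, of j j] that by auto
  qed
  have "\<exists>Y\<subseteq>B. spanned G Y = S" if S: "S \<in> set (flag y)" for S
  proof -
    obtain k where "k < n" "S = spanned G (y ` {..k})" using S by (auto simp: flag_of_def)
    then show ?thesis using im by (intro exI[of _ "y ` {..k}"]) auto
  qed
  then show ?thesis
    using dims strict unfolding apartment_of_def maximal_flags_def
    by (auto simp: sorted_wrt_iff_nth_less)
qed

text \<open>Completing a flag by the empty subspace and the whole space makes the index equal to the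
  rank, from \<open>0\<close> to \<open>Suc n\<close>, so both ends need no separate treatment
  later.\<close>

definition flag_comp :: "'a set list \<Rightarrow> nat \<Rightarrow> 'a set" where
  "flag_comp F i = (if i = 0 then {} else if i \<le> n then F ! (i - 1) else points G)"

lemma flag_comp_rank:
  assumes "F \<in> flags" "i \<le> Suc n"
  shows "has_rank (flag_comp F i) i"
proof -
  consider "i = 0" | "0 < i" "i \<le> n" | "i = Suc n" using assms by linarith
  then show ?thesis
  proof cases
    case 1 then show ?thesis by (simp add: flag_comp_def has_rank_0)
  next
    case 2
    then have "has_dim G (F ! (i - 1)) (i - 1)" using assms by (auto simp: maximal_flags_def)
    then show ?thesis using 2 has_dim_iff by (simp add: flag_comp_def)
  next
    case 3 then show ?thesis using rank_points by (simp add: flag_comp_def)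
  qed
qed

lemma flag_comp_Suc:
  assumes "F \<in> flags" "i \<le> n"
  shows "flag_comp F i \<subseteq> flag_comp F (Suc i)"
proof -
  consider "i = 0" | "0 < i" "i < n" | "0 < i" "i = n" using assms by linarith
  then show ?thesis
  proof cases
    case 2
    then have "F ! (i - 1) \<subset> F ! i"
      using assms sorted_wrt_nth_less[of "(\<subset>)" F "i - 1" i] by (auto simp: maximal_flags_def)
    then show ?thesis using 2 by (auto simp: flag_comp_def)
  next
    case 3
    then show ?thesis using flag_comp_rank[of F i] assms has_rank_subspace subspace_points
      by (auto simp: flag_comp_def)
  qed (simp add: flag_comp_def)
qed

lemma flag_comp_mono:
  assumes "F \<in> flags" "i \<le> j" "j \<le> Suc n"
  shows "flag_comp F i \<subseteq> flag_comp F j"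
  using assms(2,3)
proof (induction j rule: dec_induct)
  case (step j) then show ?case using flag_comp_Suc[OF assms(1), of j] by auto
qed simp

text \<open>Ranks grow by one, so any single point of a layer, added to the lower component, already
  spans the upper one. Hence arbitrary choices from the layers give a base adapted to
  \<open>F\<close>.\<close>

lemma flag_comp_enumeration:
  assumes F: "F \<in> flags" and y: "\<And>i. i \<le> n \<Longrightarrow> y i \<in> flag_comp F (Suc i) - flag_comp F i"
  shows "is_base G (y ` {..n})" "bij_betw y {..n} (y ` {..n})" "F = flag y"
proof -
  have *: "i \<le> Suc n \<Longrightarrow>
    spanned G (y ` {..<i}) = flag_comp F i \<and> independent G (y ` {..<i}) \<and> inj_on y {..<i}" for i
  proof (induction i)
    case 0
    then show ?case by (simp add: flag_comp_def independent_def)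
  next
    case (Suc i)
    note IH = Suc.IH[OF Suc_leD[OF Suc.prems]]
    have yi: "y i \<in> flag_comp F (Suc i)" "y i \<notin> flag_comp F i" using y Suc.prems by auto
    note rk = flag_comp_rank[OF F Suc_leD[OF Suc.prems]] flag_comp_rank[OF F Suc.prems]
    have sub: "flag_comp F i \<subseteq> flag_comp F (Suc i)" using flag_comp_Suc F Suc.prems by simp
    have yP: "y i \<in> points G" using yi subspace_points[OF has_rank_subspace[OF rk(2)]] by blast
    have P: "y ` {..<i} \<subseteq> points G" using IH independent_points by blast
    have ins: "y ` {..<Suc i} = insert (y i) (y ` {..<i})" by (auto simp: lessThan_Suc)
    have "spanned G (insert (y i) (flag_comp F i)) = flag_comp F (Suc i)"
      by (rule has_rank_cover[OF rk sub yi])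
    then have "spanned G (y ` {..<Suc i}) = flag_comp F (Suc i)"
      using IH spanned_insert_spanned[OF P yP] ins by simp
    moreover have "independent G (y ` {..<Suc i})"
      using independent_insert[of "y ` {..<i}" "y i"] IH yP yi ins by simp
    moreover have "y i \<notin> y ` {..<i}" using IH yi spanned_subset[of "y ` {..<i}"] by blast
    ultimately show ?case using IH by (simp add: lessThan_Suc)
  qed
  note top = *[of "Suc n", unfolded lessThan_Suc_atMost]
  show "is_base G (y ` {..n})" using top by (simp add: is_base_def flag_comp_def)
  show "bij_betw y {..n} (y ` {..n})" using top by (simp add: bij_betw_def)
  show "F = flag y"
  proof (rule nth_equalityI)
    show "length F = length (flag y)" using F by (simp add: maximal_flags_def)
    fix k assume "k < length F"
    then show "F ! k = flag y ! k" using F *[of "Suc k"]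
      by (simp add: maximal_flags_def flag_comp_def lessThan_Suc_atMost)
  qed
qed

text \<open>Every layer of \<open>F\<close> contains a point of \<open>B\<close>: otherwise the
  points of \<open>B\<close> spanning the upper component would all lie in the lower one. The
  \<open>n + 1\<close> points so obtained exhaust \<open>B\<close>.\<close>

lemma apartment_flag:
  assumes B: "is_base G B" and F: "F \<in> apartment B"
  shows "\<exists>y. bij_betw y {..n} B \<and> F = flag y"
proof -
  have Fm: "F \<in> flags" using F by (simp add: apartment_of_def)
  have gen: "\<exists>Y\<subseteq>B. spanned G Y = flag_comp F i" if i: "i \<le> Suc n" for i
  proof -
    consider "i = 0" | "0 < i" "i \<le> n" | "i = Suc n" using i by linarith
    then show ?thesis
    proof cases
      case 1 then show ?thesis by (intro exI[of _ "{}"]) (simp add: flag_comp_def)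
    next
      case 2
      then have "F ! (i - 1) \<in> set F" using Fm by (auto simp: maximal_flags_def)
      then show ?thesis using F 2 by (auto simp: apartment_of_def flag_comp_def)
    next
      case 3 then show ?thesis using baseD[OF B] by (intro exI[of _ B]) (simp add: flag_comp_def)
    qed
  qed
  have "\<exists>p. p \<in> B \<inter> flag_comp F (Suc i) - flag_comp F i" if i: "i \<le> n" for i
  proof (rule ccontr)
    assume no: "\<not> ?thesis"
    obtain Y where Y: "Y \<subseteq> B" "spanned G Y = flag_comp F (Suc i)" using gen[of "Suc i"] i by auto
    then have "Y \<subseteq> flag_comp F i" using no spanned_subset[of Y] by blast
    moreover have rk: "has_rank (flag_comp F i) i" "has_rank (flag_comp F (Suc i)) (Suc i)"
      using flag_comp_rank[OF Fm] i by auto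
    ultimately have "flag_comp F (Suc i) \<subseteq> flag_comp F i"
      using spanned_minimal Y has_rank_subspace by blast
    then show False using has_rank_mono rk by fastforce
  qed
  then obtain y where y: "\<And>i. i \<le> n \<Longrightarrow> y i \<in> B \<inter> flag_comp F (Suc i) - flag_comp F i"
    by metis
  then have *: "is_base G (y ` {..n})" "bij_betw y {..n} (y ` {..n})" "F = flag y"
    using flag_comp_enumeration[OF Fm, of y] by auto
  have "y ` {..n} = B"
    using card_subset_eq[of B "y ` {..n}"] baseD(3)[OF *(1)] baseD[OF B] y by auto
  then show ?thesis using * by auto
qed

text \<open>The Jordan-Hoelder permutation \<open>j\<close> matches layer \<open>i\<close> of
  \<open>F\<close> with a layer of \<open>D\<close>, and a point \<open>x i\<close> common to both
  is chosen. In the order of \<open>F\<close> these points enumerate a base adapted to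
  \<open>F\<close>, in the order permuted by \<open>j\<close> the same base adapted to
  \<open>D\<close>.\<close>

lemma common_apartment:
  assumes F: "F \<in> flags" and D: "D \<in> flags"
  shows "\<exists>B. is_base G B \<and> F \<in> apartment B \<and> D \<in> apartment B"
proof -
  let ?E = "flag_comp F" and ?D = "flag_comp D"
  let ?Q = "\<lambda>i j. ?E (Suc i) \<inter> ?D (Suc j) - ?E i \<noteq> {}"
  \<comment> \<open>The first place in \<open>D\<close> at which a point of layer \<open>i\<close>
    of \<open>F\<close> turns up.\<close>
  define j where "j i = (LEAST j. ?Q i j)" for i
  have sub: "?E i \<subseteq> ?E k" "?D i \<subseteq> ?D k" if "i \<le> k" "k \<le> Suc n" for i k
    using that F D flag_comp_mono by auto
  have ssp: "is_subspace G (?E i)" "is_subspace G (?D i)" if "i \<le> Suc n" for i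
    using that F D flag_comp_rank has_rank_subspace by blast+
  have Qn: "?Q i n" if "i \<le> n" for i
  proof -
    have "\<not> ?E (Suc i) \<subseteq> ?E i"
      using has_rank_mono[OF flag_comp_rank[OF F, of "Suc i"] flag_comp_rank[OF F, of i]] that by auto
    moreover have "?D (Suc n) = points G" by (simp add: flag_comp_def)
    moreover have "?E (Suc i) \<subseteq> points G" using subspace_points[OF ssp(1)] that by simp
    ultimately show ?thesis by blast
  qed
  have Qj: "?Q i (j i)" and jn: "j i \<le> n" if "i \<le> n" for i
    unfolding j_def using Qn[OF that] by (rule LeastI, rule Least_le)
  have jmin: "?E (Suc i) \<inter> ?D m \<subseteq> ?E i" if "i \<le> n" "m \<le> j i" for i m
  proof (cases m)
    case 0 then show ?thesis by (simp add: flag_comp_def)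
  next
    case (Suc k)
    then have "\<not> ?Q i k" using not_less_Least[of k "?Q i"] that unfolding j_def by simp
    then show ?thesis using Suc by blast
  qed
  have "\<exists>x. x \<in> ?E (Suc i) \<inter> ?D (Suc (j i)) - ?E i" if "i \<le> n" for i
    using Qj[OF that] by blast
  then obtain x where x: "\<And>i. i \<le> n \<Longrightarrow> x i \<in> ?E (Suc i) \<inter> ?D (Suc (j i)) - ?E i"
    by metis
  have xD: "x i \<notin> ?D (j i)" if "i \<le> n" for i
    using jmin[OF that, of "j i"] x[OF that] by blast
  \<comment> \<open>Two chosen points in one layer of \<open>D\<close> span a line that meets the
    lower component in some \<open>h\<close>. By minimality of \<open>j i'\<close>, the point
    \<open>h\<close> lies in \<open>?E i'\<close>, as does \<open>x i\<close>; then the line through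
    them puts \<open>x i'\<close> there too.\<close>
  have jneq: "j i \<noteq> j i'" if i: "i < i'" "i' \<le> n" for i i'
  proof
    assume eq: "j i = j i'"
    let ?H = "?D (j i)" and ?K = "?D (Suc (j i))"
    have ji: "j i \<le> n" using jn i by simp
    have xx: "x i \<in> ?K" "x i' \<in> ?K" "x i \<notin> ?H" "x i' \<notin> ?H"
      using x[of i] x[of i'] xD[of i] xD[of i'] i eq by auto
    have ne: "x i' \<noteq> x i" using x[of i] x[of i'] i sub(1)[of "Suc i" i'] by auto
    have P: "x i \<in> points G" "x i' \<in> points G"
      using xx subspace_points[OF ssp(2)] ji by (meson Suc_le_mono subsetD)+
    have "spanned G (insert (x i) ?H) = ?K"
      using has_rank_cover[OF flag_comp_rank flag_comp_rank, OF D _ D] sub(2) xx ji by simp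
    then obtain h where h: "h \<in> ?H" "h \<in> line_through G (x i) (x i')"
      using join_point[OF ssp(2) P(1) xx(3), of "x i'"] ji xx ne by auto
    have xi': "x i' \<in> ?E (Suc i')" "x i \<in> ?E i'" "x i' \<notin> ?E i'"
      using x[of i] x[of i'] i sub(1)[of "Suc i" i'] by auto
    have "line_through G (x i) (x i') \<subseteq> ?E (Suc i')"
      using subspaceD[OF ssp(1), of "Suc i'" "x i" "x i'"] xi' sub(1)[of i' "Suc i'"] i ne by auto
    then have "h \<in> ?E i'" using jmin[of i' "j i"] h eq i by auto
    moreover have hx: "h \<noteq> x i" using h xx by blast
    ultimately have "line_through G h (x i) \<subseteq> ?E i'"
      using subspaceD[OF ssp(1)] xi' i by simp
    moreover have "line_through G h (x i) = line_through G (x i) (x i')"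
      using line_through_eq' line_through_props P ne h hx by metis
    ultimately show False using line_through_props P ne xi' by (metis subsetD)
  qed
  have "inj_on j {..n}"
    using jneq by (auto simp: inj_on_def) (metis linorder_neqE_nat)
  then have jb: "bij_betw j {..n} {..n}"
    using endo_inj_surj[of "{..n}" j] jn by (auto simp: bij_betw_def)
  \<comment> \<open>The inverse permutation lists the chosen points in the order in which
    \<open>D\<close> takes them up.\<close>
  define k where "k = inv_into {..n} j"
  have k: "k i \<le> n" "j (k i) = i" if "i \<le> n" for i
    using bij_betw_inv_into_right[OF jb] bij_betwE[OF bij_betw_inv_into[OF jb]] that
    unfolding k_def by auto
  let ?B = "x ` {..n}"
  have 1: "is_base G ?B" "bij_betw x {..n} ?B" "F = flag x"
    using flag_comp_enumeration[OF F, of x] x by auto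
  have "\<And>i. i \<le> n \<Longrightarrow> (x \<circ> k) i \<in> ?D (Suc i) - ?D i"
    using x xD k by fastforce
  then have 2: "D = flag (x \<circ> k)" using flag_comp_enumeration[OF D, of "x \<circ> k"] by simp
  have "bij_betw (x \<circ> k) {..n} ?B"
    unfolding k_def using bij_betw_trans[OF bij_betw_inv_into[OF jb] 1(2)] .
  then show ?thesis using 1 2 flag_in_apartment by blast
qed

lemma precedes_flag:
  assumes B: "is_base G B" and y: "bij_betw y {..n} B" and ij: "i \<le> n" "j \<le> n"
  shows "precedes (flag y) (y i) (y j) \<longleftrightarrow> i \<le> j"
proof
  assume p: "precedes (flag y) (y i) (y j)"
  show "i \<le> j"
  proof (rule ccontr)
    assume "\<not> i \<le> j"
    then have "j < n" using ij by simp
    then have "spanned G (y ` {..j}) \<in> set (flag y)" by (auto simp: flag_of_def)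
    then have "y i \<in> spanned G (y ` {..j})"
      using p bij_mem_span[OF B y ij(2,2)] unfolding precedes_def by simp
    then show False using bij_mem_span[OF B y ij] \<open>\<not> i \<le> j\<close> by simp
  qed
next
  assume "i \<le> j"
  then show "precedes (flag y) (y i) (y j)"
    using bij_mem_span[OF B y ij(1)] bij_mem_span[OF B y ij(2)]
    by (auto simp: precedes_def flag_of_def)
qed

lemma precedes_total:
  assumes "is_base G B" "F \<in> apartment B" "a \<in> B" "b \<in> B"
  shows "precedes F a b \<or> precedes F b a"
    and "precedes F a b \<Longrightarrow> precedes F b a \<Longrightarrow> a = b"
proof -
  obtain y where y: "bij_betw y {..n} B" "F = flag y" using apartment_flag assms by blast
  obtain i j where ij: "i \<le> n" "j \<le> n" "a = y i" "b = y j"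
    using y assms by (auto simp: bij_betw_def)
  note p = precedes_flag[OF assms(1) y(1)]
  show "precedes F a b \<or> precedes F b a" using p[of i j] p[of j i] y ij by auto
  show "precedes F a b \<Longrightarrow> precedes F b a \<Longrightarrow> a = b"
    using p[of i j] p[of j i] y ij by auto
qed

text \<open>Source of witnesses: flags lying in several prescribed roots at once, or in one root and
  outside another, are obtained by writing down a key.\<close>

lemma flag_with_key:
  fixes r :: "'a \<Rightarrow> nat"
  assumes B: "is_base G B"
  shows "\<exists>F\<in>apartment B. \<forall>a\<in>B. \<forall>b\<in>B. r a < r b \<longrightarrow> precedes F a b \<and> \<not> precedes F b a"
proof -
  obtain y where y: "bij_betw y {..n} B"
    and mono: "\<And>i j. i \<le> j \<Longrightarrow> j \<le> n \<Longrightarrow> r (y i) \<le> r (y j)"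
    using enumerate_by_key[OF baseD(2,3)[OF B]] by metis
  have "precedes (flag y) a b \<and> \<not> precedes (flag y) b a"
    if ab: "a \<in> B" "b \<in> B" "r a < r b" for a b
  proof -
    obtain i j where ij: "i \<le> n" "j \<le> n" "a = y i" "b = y j"
      using y ab by (auto simp: bij_betw_def)
    then have "i < j" using mono[of j i] ab by (meson not_le)
    then show ?thesis using precedes_flag[OF B y] ij by simp
  qed
  then show ?thesis using flag_in_apartment[OF B y] by blast
qed

lemma flag_eq_iff:
  assumes "is_base G B" "bij_betw y {..n} B" "bij_betw z {..n} B" "flag y = flag z" "i \<le> n"
  shows "y i = z i"
  using order_enumeration_unique[OF assms(2) _ assms(3) _ assms(5), of "precedes (flag y)"]
    precedes_flag[OF assms(1,2)] precedes_flag[OF assms(1,3)] assms(4) by simp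

lemma card_apartment:
  assumes B: "is_base G B"
  shows "finite (apartment B)" "card (apartment B) = fact (Suc n)"
proof -
  obtain y where y: "bij_betw y {..n} B"
    using enumerate_by_key[OF baseD(2,3)[OF B]] by metis
  let ?P = "{p. p permutes {..n}}"
  have yp: "bij_betw (y \<circ> p) {..n} B" if "p \<in> ?P" for p
    using bij_betw_trans[OF permutes_imp_bij y] that by simp
  have "apartment B = (\<lambda>p. flag (y \<circ> p)) ` ?P"
  proof (intro equalityI subsetI)
    fix F assume "F \<in> apartment B"
    then obtain z where z: "bij_betw z {..n} B" "F = flag z" using apartment_flag B by blast
    \<comment> \<open>Outside \<open>{..n}\<close> the map is the identity, as
      \<open>permutes\<close> demands.\<close>
    define p where "p i = (if i \<le> n then inv_into {..n} y (z i) else i)" for i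
    have "bij_betw (inv_into {..n} y \<circ> z) {..n} {..n}"
      using bij_betw_trans[OF z(1) bij_betw_inv_into[OF y]] .
    then have "bij_betw p {..n} {..n}"
      by (rule bij_betw_cong[THEN iffD1, rotated]) (simp add: p_def)
    then have "p permutes {..n}" by (rule bij_imp_permutes) (simp add: p_def)
    moreover have "flag (y \<circ> p) = flag z"
      using z y by (intro flag_of_cong)
        (auto simp: p_def bij_betw_inv_into_right bij_betwE)
    ultimately show "F \<in> (\<lambda>p. flag (y \<circ> p)) ` ?P" using z by (intro image_eqI[of _ _ p]) auto
  qed (use yp flag_in_apartment[OF B] in blast)
  moreover have "inj_on (\<lambda>p. flag (y \<circ> p)) ?P"
  proof (rule inj_onI, rule ext)
    fix p q i assume pq: "p \<in> ?P" "q \<in> ?P" "flag (y \<circ> p) = flag (y \<circ> q)"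
    show "p i = q i"
    proof (cases "i \<le> n")
      case True
      then have "y (p i) = y (q i)" using flag_eq_iff[OF B yp yp, of p q i] pq by simp
      moreover have "p i \<in> {..n}" "q i \<in> {..n}"
        using pq True permutes_in_image[of _ "{..n}" i] by auto
      ultimately show ?thesis using y by (auto simp: bij_betw_def inj_on_def)
    next
      case False then show ?thesis using pq by (auto simp: permutes_def)
    qed
  qed
  ultimately show "finite (apartment B)" "card (apartment B) = fact (Suc n)"
    using card_permutations[of "{..n}" "Suc n"] finite_permutations[of "{..n}"]
    by (auto simp: card_image)
qed

end

section \<open>Roots\<close>

lemma precedes_refl [simp]: "precedes F a a"
  by (simp add: precedes_def)

context projective_space_dim
begin

lemma apartments_Int_in_root:
  assumes B: "is_base G B" and D: "is_base G D" and "B \<noteq> D"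
  shows "\<exists>a\<in>B. \<exists>b\<in>B. a \<noteq> b \<and> (\<forall>F\<in>apartment B \<inter> apartment D. precedes F a b)"
proof (rule ccontr)
  assume no: "\<not> ?thesis"
  have sep: "\<exists>Y\<subseteq>B. b \<in> spanned G Y \<and> a \<notin> spanned G Y \<and> (\<exists>Z\<subseteq>D. spanned G Z = spanned G Y)"
    if ab: "a \<in> B" "b \<in> B" "a \<noteq> b" for a b
  proof -
    obtain F where F: "F \<in> apartment B" "F \<in> apartment D" "\<not> precedes F a b"
      using no ab by blast
    then obtain S where S: "S \<in> set F" "b \<in> S" "a \<notin> S" unfolding precedes_def by blast
    obtain Y where "Y \<subseteq> B" "spanned G Y = S" using F S unfolding apartment_of_def by blast
    moreover obtain Z where "Z \<subseteq> D" "spanned G Z = S" using F S unfolding apartment_of_def by blast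
    ultimately show ?thesis using S by blast
  qed
  have "b \<in> D" if b: "b \<in> B" for b
  proof -
    \<comment> \<open>The intersection of this family can be computed in either base. The whole
      space belongs to it, so it is nonempty.\<close>
    define \<S> where "\<S> = {S. b \<in> S \<and> (\<exists>Y\<subseteq>B. spanned G Y = S) \<and> (\<exists>Z\<subseteq>D. spanned G Z = S)}"
    have bP: "b \<in> points G" using b baseD[OF B] by blast
    have ne: "\<S> \<noteq> {}" using baseD(5)[OF B] baseD(5)[OF D] bP unfolding \<S>_def by blast
    have B_Int: "B \<inter> \<Inter>\<S> = {b}"
    proof (intro equalityI subsetI)
      fix a assume a: "a \<in> B \<inter> \<Inter>\<S>"
      show "a \<in> {b}"
      proof (rule ccontr)
        assume "a \<notin> {b}"
        then obtain Y where "Y \<subseteq> B" "b \<in> spanned G Y" "a \<notin> spanned G Y"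
            "\<exists>Z\<subseteq>D. spanned G Z = spanned G Y"
          using sep[of a b] a b by blast
        then show False using a unfolding \<S>_def by blast
      qed
    qed (use b in \<open>auto simp: \<S>_def\<close>)
    have "spanned G (B \<inter> \<Inter>\<S>) = \<Inter>\<S>"
      by (rule spanned_Int_Inter[OF baseD(1,2)[OF B] ne]) (simp add: \<S>_def)
    then have "\<Inter>\<S> = {b}" using B_Int bP by simp
    moreover have "spanned G (D \<inter> \<Inter>\<S>) = \<Inter>\<S>"
      by (rule spanned_Int_Inter[OF baseD(1,2)[OF D] ne]) (simp add: \<S>_def)
    ultimately have "D \<inter> {b} \<noteq> {}" by (metis insert_not_empty spanned_empty)
    then show ?thesis by blast
  qed
  then have "B = D" using card_subset_eq[of D B] baseD(2,3)[OF B] baseD(2,3)[OF D] by auto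
  then show False using \<open>B \<noteq> D\<close> by simp
qed

text \<open>Replacing \<open>b\<close> by a third point of the line \<open>ab\<close> keeps exactly the flags of a root.\<close>

lemma root_eq_apartments_Int:
  assumes B: "is_base G B" and ab: "a \<in> B" "b \<in> B" "a \<noteq> b"
  shows "\<exists>D. is_base G D \<and> apartment B \<inter> apartment D = {F \<in> apartment B. precedes F a b}"
proof -
  have P: "a \<in> points G" "b \<in> points G" using ab baseD(4)[OF B] by auto
  let ?l = "line_through G a b"
  note l = line_through_props[OF P ab(3)]
  obtain c where c: "c \<in> ?l" "c \<noteq> a" "c \<noteq> b" using thick l by metis
  have cP: "c \<in> points G" using c l line_subset by blast
  have lac: "line_through G a c = ?l" and lbc: "line_through G b c = ?l"
    using line_through_eq l c by metis+
  have closed: "b \<in> S" if "is_subspace G S" "a \<in> S" "c \<in> S" for S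
    using subspaceD[OF that(1), of a c] that c lac l by auto
  have closed_a: "a \<in> S" if "is_subspace G S" "b \<in> S" "c \<in> S" for S
    using subspaceD[OF that(1), of b c] that c lbc l by auto
  have closed_c: "c \<in> S" if "is_subspace G S" "a \<in> S" "b \<in> S" for S
    using subspaceD[OF that(1), of a b] that c ab by auto
  have sub: "is_subspace G (spanned G Y)" if "Y \<subseteq> B" for Y
    using that baseD(4)[OF B] is_subspace_spanned by blast
  have bn: "b \<notin> spanned G (B - {b})" using baseD(1)[OF B] ab unfolding independent_iff by blast
  have cn: "c \<notin> spanned G (B - {b})"
    using closed[OF sub, of "B - {b}"] bn spanned_subset[of "B - {b}"] ab by blast
  let ?D = "insert c (B - {b})"
  have "c \<notin> B - {b}" using cn spanned_subset[of "B - {b}"] by blast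
  then have "card ?D = Suc n" using baseD(2,3)[OF B] ab by simp
  moreover have "independent G ?D"
    using independent_insert[OF independent_mono[OF baseD(1)[OF B]] cP cn] by blast
  ultimately have D: "is_base G ?D" using independent_base by blast
  have subD: "is_subspace G (spanned G Y)" if "Y \<subseteq> ?D" for Y
    using that baseD(4)[OF D] is_subspace_spanned by blast
  have "apartment B \<inter> apartment ?D = {F \<in> apartment B. precedes F a b}"
  proof (intro equalityI subsetI IntI CollectI conjI)
    fix F assume F: "F \<in> apartment B \<inter> apartment ?D"
    show "precedes F a b" unfolding precedes_def
    proof (intro ballI impI, rule ccontr)
      fix S assume S: "S \<in> set F" "b \<in> S" "a \<notin> S"
      obtain Z where Z: "Z \<subseteq> ?D" "spanned G Z = S" using F S unfolding apartment_of_def by blast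
      have "c \<notin> S" using closed_a[OF subD[OF Z(1)]] Z S by blast
      then have "Z \<subseteq> B - {b}" using Z spanned_subset[of Z] by blast
      then show False using bn spanned_mono[of Z "B - {b}"] Z S by blast
    qed
  next
    fix F assume F: "F \<in> {F \<in> apartment B. precedes F a b}"
    have "\<exists>Z\<subseteq>?D. spanned G Z = S" if S: "S \<in> set F" for S
    proof -
      obtain Y where Y: "Y \<subseteq> B" "spanned G Y = S" using F S unfolding apartment_of_def by blast
      show ?thesis
      proof (cases "b \<in> S")
        case False
        then have "Y \<subseteq> ?D" using Y spanned_subset[of Y] by blast
        then show ?thesis using Y by blast
      next
        case True
        have aS: "a \<in> S" using F S True unfolding precedes_def by blast
        then have abY: "a \<in> Y" "b \<in> Y" using independent_mem[OF baseD(1)[OF B] Y(1)] ab Y True by auto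
        \<comment> \<open>Since \<open>a\<close> stays in the spanning set, trading \<open>b\<close>
          for the third point \<open>c\<close> of the line does not change the span.\<close>
        let ?Z = "insert c (Y - {b})"
        have ZD: "?Z \<subseteq> ?D" using Y by blast
        have "c \<in> S" using closed_c[OF sub[OF Y(1)]] Y aS True by blast
        then have "?Z \<subseteq> spanned G Y" using Y spanned_subset[of Y] by blast
        then have 1: "spanned G ?Z \<subseteq> spanned G Y" using spanned_minimal sub Y(1) by blast
        have "b \<in> spanned G ?Z"
          using closed[OF subD[OF ZD]] spanned_subset[of ?Z] abY ab by blast
        then have "Y \<subseteq> spanned G ?Z" using spanned_subset[of ?Z] by blast
        then have "spanned G Y \<subseteq> spanned G ?Z" using spanned_minimal subD ZD by blast
        then show ?thesis using 1 ZD Y by blast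
      qed
    qed
    then show "F \<in> apartment ?D" using F unfolding apartment_of_def by blast
  qed auto
  then show ?thesis using D by blast
qed

end

section \<open>Oriented edges, topological orders and maps of edges\<close>

lemma two_edges_key:
  assumes "p\<^sub>1 \<noteq> q\<^sub>1" "p\<^sub>2 \<noteq> q\<^sub>2" "\<not> (p\<^sub>1 = q\<^sub>2 \<and> p\<^sub>2 = q\<^sub>1)"
  shows "\<exists>r :: 'a \<Rightarrow> nat. r p\<^sub>1 < r q\<^sub>1 \<and> r p\<^sub>2 < r q\<^sub>2"
proof (cases "p\<^sub>1 = q\<^sub>2")
  case False
  then show ?thesis using assms
    by (intro exI[of _ "\<lambda>v. if v = p\<^sub>1 then 0 else if v = p\<^sub>2 then 1 else 2"]) auto
next
  case True
  then show ?thesis using assms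
    by (intro exI[of _ "\<lambda>v. if v = p\<^sub>2 then 0 else if v = p\<^sub>1 then 1 else 2"]) auto
qed

text \<open>A key that increases along given oriented edges is a topological order. Here
  \<open>p\<^sub>1\<close> is the end of no edge, so it comes first; the other two edges are not
  opposite and can be ordered after it.\<close>

lemma three_edges_key:
  assumes "p\<^sub>1 \<noteq> q\<^sub>1" "p\<^sub>2 \<noteq> q\<^sub>2" "p\<^sub>3 \<noteq> q\<^sub>3" "\<not> (p\<^sub>2 = q\<^sub>3 \<and> p\<^sub>3 = q\<^sub>2)"
    and source: "p\<^sub>1 \<noteq> q\<^sub>2" "p\<^sub>1 \<noteq> q\<^sub>3"
  shows "\<exists>r :: 'a \<Rightarrow> nat. r p\<^sub>1 < r q\<^sub>1 \<and> r p\<^sub>2 < r q\<^sub>2 \<and> r p\<^sub>3 < r q\<^sub>3"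
proof (cases "p\<^sub>2 = q\<^sub>3")
  case False
  then show ?thesis using assms
    by (intro exI[of _ "\<lambda>v. if v = p\<^sub>1 then 0 else if v = p\<^sub>2 then 1 else if v = p\<^sub>3 then 2 else 3"])
      auto
next
  case True
  then show ?thesis using assms
    by (intro exI[of _ "\<lambda>v. if v = p\<^sub>1 then 0 else if v = p\<^sub>3 then 1 else if v = p\<^sub>2 then 2 else 3"])
      auto
qed

text \<open>If no key exists, none of the three starting points is a source, so each is the end of
  another edge. With opposite edges excluded, only the two directed triangles remain.\<close>

lemma three_edges_cycle:
  assumes ne: "p\<^sub>1 \<noteq> q\<^sub>1" "p\<^sub>2 \<noteq> q\<^sub>2" "p\<^sub>3 \<noteq> q\<^sub>3"
    and opp: "\<not> (p\<^sub>1 = q\<^sub>2 \<and> p\<^sub>2 = q\<^sub>1)" "\<not> (p\<^sub>2 = q\<^sub>3 \<and> p\<^sub>3 = q\<^sub>2)" "\<not> (p\<^sub>3 = q\<^sub>1 \<and> p\<^sub>1 = q\<^sub>3)"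
    and no: "\<nexists>r :: 'a \<Rightarrow> nat. r p\<^sub>1 < r q\<^sub>1 \<and> r p\<^sub>2 < r q\<^sub>2 \<and> r p\<^sub>3 < r q\<^sub>3"
  shows "(q\<^sub>1 = p\<^sub>2 \<and> q\<^sub>2 = p\<^sub>3 \<and> q\<^sub>3 = p\<^sub>1) \<or> (q\<^sub>1 = p\<^sub>3 \<and> q\<^sub>3 = p\<^sub>2 \<and> q\<^sub>2 = p\<^sub>1)"
proof -
  have "p\<^sub>1 = q\<^sub>2 \<or> p\<^sub>1 = q\<^sub>3" using three_edges_key[OF ne opp(2)] no by metis
  moreover have "p\<^sub>2 = q\<^sub>3 \<or> p\<^sub>2 = q\<^sub>1" using three_edges_key[OF ne(2,3,1) opp(3)] no by metis
  moreover have "p\<^sub>3 = q\<^sub>1 \<or> p\<^sub>3 = q\<^sub>2" using three_edges_key[OF ne(3,1,2) opp(1)] no by metis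
  ultimately show ?thesis using opp by auto
qed

text \<open>By the previous lemma, \<open>cyclic\<close> says that \<open>(a, b) \<mapsto> (s a b, t a b)\<close> sends directed
  triangles to directed triangles.\<close>

lemma edge_map_vertex_map:
  fixes s t :: "'a \<Rightarrow> 'a \<Rightarrow> 'b"
  assumes third: "\<And>a b. \<exists>c\<in>B. c \<noteq> a \<and> c \<noteq> b"
    and ne: "\<And>a b. a \<in> B \<Longrightarrow> b \<in> B \<Longrightarrow> a \<noteq> b \<Longrightarrow> s a b \<noteq> t a b"
    and swap: "\<And>a b. a \<in> B \<Longrightarrow> b \<in> B \<Longrightarrow> a \<noteq> b \<Longrightarrow> s b a = t a b"
    and inj: "\<And>a b c d. a \<in> B \<Longrightarrow> b \<in> B \<Longrightarrow> a \<noteq> b \<Longrightarrow> c \<in> B \<Longrightarrow> d \<in> B \<Longrightarrow> c \<noteq> d \<Longrightarrow>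
      s a b = s c d \<Longrightarrow> t a b = t c d \<Longrightarrow> a = c \<and> b = d"
    and cyclic: "\<And>a b c. a \<in> B \<Longrightarrow> b \<in> B \<Longrightarrow> c \<in> B \<Longrightarrow> a \<noteq> b \<Longrightarrow> b \<noteq> c \<Longrightarrow> c \<noteq> a \<Longrightarrow>
      \<nexists>r :: 'b \<Rightarrow> nat. r (s a b) < r (t a b) \<and> r (s b c) < r (t b c) \<and> r (s c a) < r (t c a)"
  shows "\<exists>\<pi>. inj_on \<pi> B \<and>
    ((\<forall>a\<in>B. \<forall>b\<in>B. a \<noteq> b \<longrightarrow> s a b = \<pi> a \<and> t a b = \<pi> b) \<or>
     (\<forall>a\<in>B. \<forall>b\<in>B. a \<noteq> b \<longrightarrow> s a b = \<pi> b \<and> t a b = \<pi> a))"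
proof -
  \<comment> \<open>The image of the cycle \<open>a b c\<close> is a directed triangle, run through
    in one of two directions. In one, the images of \<open>ab\<close> and \<open>ac\<close> share
    their source, and likewise at \<open>b\<close>; in the other they share their target.\<close>
  have tri: "(s a b = s a c \<and> s b a = s b c) \<or> (t a b = t a c \<and> t b a = t b c)"
    if B: "a \<in> B" "b \<in> B" "c \<in> B" and d: "a \<noteq> b" "b \<noteq> c" "c \<noteq> a" for a b c
  proof -
    have opp: "\<not> (s x y = t y z \<and> s y z = t x y)"
      if "x \<in> B" "y \<in> B" "z \<in> B" "x \<noteq> y" "y \<noteq> z" "z \<noteq> x" for x y z
      using that swap[of y z] swap[of z y] inj[of x y z y] by metis
    have "(t a b = s b c \<and> t b c = s c a \<and> t c a = s a b) \<or>
        (t a b = s c a \<and> t c a = s b c \<and> t b c = s a b)"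
      using B d by (intro three_edges_cycle cyclic ne opp) auto
    then show ?thesis
      using swap[of a b] swap[of b a] swap[of a c] swap[of c a] B d by metis
  qed
  \<comment> \<open>At a vertex \<open>a\<close>, the images of all edges leaving \<open>a\<close>
    have a common source (\<open>pos\<close>) or a common target (\<open>neg\<close>), the candidate
    for the image of \<open>a\<close>.\<close>
  define pos where "pos a \<longleftrightarrow> (\<forall>b\<in>B. \<forall>c\<in>B. b \<noteq> a \<longrightarrow> c \<noteq> a \<longrightarrow> s a b = s a c)" for a
  define neg where "neg a \<longleftrightarrow> (\<forall>b\<in>B. \<forall>c\<in>B. b \<noteq> a \<longrightarrow> c \<noteq> a \<longrightarrow> t a b = t a c)" for a
  have pn: "pos a \<or> neg a" if a: "a \<in> B" for a
  proof (cases "pos a")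
    case False
    then obtain b c where bc: "b \<in> B" "c \<in> B" "b \<noteq> a" "c \<noteq> a" "s a b \<noteq> s a c"
      unfolding pos_def by blast
    then have eq: "t a b = t a c" using tri[of a b c] a by metis
    \<comment> \<open>Otherwise the image of \<open>ad\<close> would share its source with the
      images of both \<open>ab\<close> and \<open>ac\<close>, whose sources differ.\<close>
    have "t a d = t a b" if "d \<in> B" "d \<noteq> a" for d
      using tri[of a d b] tri[of a d c] that a bc eq by metis
    then show ?thesis unfolding neg_def by metis
  qed simp
  \<comment> \<open>Within one triangle the direction is the same at \<open>a\<close> and at
    \<open>b\<close>. Injectivity rules out that the sources and the targets agree simultaneously,
    so \<open>b\<close> cannot be of the other kind.\<close>
  have pos_pos: "pos b" if "a \<in> B" "b \<in> B" "pos a" for a b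
  proof (cases "a = b")
    case False
    obtain c where c: "c \<in> B" "c \<noteq> a" "c \<noteq> b" using third by blast
    have "s a b = s a c"
      using \<open>pos a\<close>[unfolded pos_def, rule_format, of b c] \<open>b \<in> B\<close> c False by blast
    then have "t a b \<noteq> t a c" using inj[of a b a c] that c False by metis
    then have "s b a = s b c" using tri[of a b c] that c False by metis
    then have "t b a \<noteq> t b c" using inj[of b a b c] that c False by metis
    then have "\<not> neg b" using that c False unfolding neg_def by metis
    then show ?thesis using pn[of b] that by simp
  qed (use that in simp)
  \<comment> \<open>An arbitrary second vertex: the common source or target is read off on the edge
    from \<open>a\<close> to \<open>e a\<close>.\<close>
  define e where "e a = (SOME b. b \<in> B \<and> b \<noteq> a)" for a
  have e: "e a \<in> B \<and> e a \<noteq> a" for a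
    unfolding e_def by (rule someI_ex) (use third in blast)
  show ?thesis
  proof (cases "\<exists>a\<in>B. pos a")
    case True
    then have sp: "s a b = s a (e a)" if "a \<in> B" "b \<in> B" "a \<noteq> b" for a b
      using pos_pos that e[of a] unfolding pos_def by metis
    then have tp: "t a b = s b (e b)" if "a \<in> B" "b \<in> B" "a \<noteq> b" for a b
      using that swap by metis
    have "inj_on (\<lambda>a. s a (e a)) B"
      by (intro inj_onI) (use sp tp ne in metis)
    then show ?thesis using sp tp by (intro exI[of _ "\<lambda>a. s a (e a)"]) simp
  next
    case False
    then have sp: "t a b = t a (e a)" if "a \<in> B" "b \<in> B" "a \<noteq> b" for a b
      using pn that e[of a] unfolding neg_def by metis
    then have tp: "s a b = t b (e b)" if "a \<in> B" "b \<in> B" "a \<noteq> b" for a b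
      using that swap by metis
    have "inj_on (\<lambda>a. t a (e a)) B"
      by (intro inj_onI) (use sp tp ne in metis)
    then show ?thesis using sp tp by (intro exI[of _ "\<lambda>a. t a (e a)"]) simp
  qed
qed

text \<open>If the oriented edges differ, then \<open>ab\<close> and \<open>dc\<close> are not
  opposite, and a key increasing along both yields a flag in the first root but not in the second.
  So mere inclusion of roots forces equality.\<close>

lemma (in projective_space_dim) root_unique:
  assumes B: "is_base G B" and ab: "a \<in> B" "b \<in> B" "a \<noteq> b" "c \<in> B" "d \<in> B" "c \<noteq> d"
    and imp: "\<And>F. F \<in> apartment B \<Longrightarrow> precedes F a b \<Longrightarrow> precedes F c d"
  shows "a = c \<and> b = d"
proof (rule ccontr)
  assume "\<not> (a = c \<and> b = d)"
  then obtain r :: "'a \<Rightarrow> nat" where "r a < r b" "r d < r c"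
    using two_edges_key[of a b d c] ab by metis
  then show False using flag_with_key[OF B, of r] ab imp by blast
qed

text \<open>The target space is a parameter because the locale is used twice: for \<open>P'\<close>
  and, when orders are reversed, for its dual.\<close>

locale apartment_map = P: projective_space_dim P n + P': projective_space_dim P' n
  for P :: "'a geometry" and P' :: "'b geometry" and n :: nat +
  fixes f :: "'a set list \<Rightarrow> 'b set list"
  assumes n: "2 \<le> n"
    and f_flags: "f ` maximal_flags n P \<subseteq> maximal_flags n P'"
    and f_apartment: "\<And>A. is_apartment n P A \<Longrightarrow> is_apartment n P' (f ` A)"
begin

section \<open>Images of roots and the resulting vertex map\<close>

lemma apartment_image:
  assumes "is_base P B"
  shows "\<exists>B'. is_base P' B' \<and> f ` P.apartment B = P'.apartment B'"
proof -
  have "is_apartment n P' (f ` P.apartment B)"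
    using assms f_apartment unfolding is_apartment_def by blast
  then show ?thesis unfolding is_apartment_def by blast
qed

lemma inj_f: "inj_on f P.flags"
proof (rule inj_onI)
  fix F D assume FD: "F \<in> P.flags" "D \<in> P.flags" "f F = f D"
  obtain B where B: "is_base P B" "F \<in> P.apartment B" "D \<in> P.apartment B"
    using P.common_apartment FD by blast
  obtain B' where B': "is_base P' B'" "f ` P.apartment B = P'.apartment B'"
    using apartment_image B by blast
  have "inj_on f (P.apartment B)"
    using P.card_apartment[OF B(1)] P'.card_apartment[OF B'(1)] B'(2)
    by (intro eq_card_imp_inj_on) auto
  then show "F = D" using FD B by (auto simp: inj_on_def)
qed

lemma apartment_subset_flags: "P.apartment B \<subseteq> P.flags"
  by (auto simp: apartment_of_def)

text \<open>The root is cut out of the apartment of \<open>B\<close> by another apartment. A flag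
  outside the root shows, by injectivity of \<open>f\<close>, that the two image apartments differ,
  so their intersection lies in a root.\<close>

lemma root_image_le:
  assumes B: "is_base P B" and B': "is_base P' B'" "f ` P.apartment B = P'.apartment B'"
    and ab: "a \<in> B" "b \<in> B" "a \<noteq> b"
  shows "\<exists>c\<in>B'. \<exists>d\<in>B'. c \<noteq> d \<and>
    (\<forall>F\<in>P.apartment B. precedes F a b \<longrightarrow> precedes (f F) c d)"
proof -
  obtain D where D: "is_base P D"
      "P.apartment B \<inter> P.apartment D = {F \<in> P.apartment B. precedes F a b}"
    using P.root_eq_apartments_Int B ab by blast
  obtain D' where D': "is_base P' D'" "f ` P.apartment D = P'.apartment D'"
    using apartment_image D by blast
  obtain F where F: "F \<in> P.apartment B" "\<not> precedes F a b"
    using P.flag_with_key[OF B, of "\<lambda>x. if x = b then 0 else 1"] ab by force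
  then have "F \<notin> P.apartment D" using D by blast
  then have "f F \<notin> f ` P.apartment D"
    using F apartment_subset_flags[of B] apartment_subset_flags[of D] inj_f
    by (auto simp: inj_on_def)
  then have "B' \<noteq> D'" using B' D' F by blast
  then obtain c d where cd: "c \<in> B'" "d \<in> B'" "c \<noteq> d"
      "\<forall>F\<in>P'.apartment B' \<inter> P'.apartment D'. precedes F c d"
    using P'.apartments_Int_in_root B' D' by blast
  have "precedes (f F) c d" if "F \<in> P.apartment B" "precedes F a b" for F
  proof -
    have "F \<in> P.apartment D" using D that by blast
    then show ?thesis using cd(4) B' D' that by blast
  qed
  then show ?thesis using cd by blast
qed

text \<open>The roots \<open>ab\<close> and \<open>ba\<close> cover the apartment, so the roots
  \<open>cd\<close> and \<open>c'd'\<close> containing their images cover the image. Hence the root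
  \<open>dc\<close> lies in \<open>c'd'\<close>, which forces them to coincide, and both inclusions
  become equalities.\<close>

lemma root_image:
  assumes B: "is_base P B" and B': "is_base P' B'" "f ` P.apartment B = P'.apartment B'"
    and ab: "a \<in> B" "b \<in> B" "a \<noteq> b"
  shows "\<exists>c\<in>B'. \<exists>d\<in>B'. c \<noteq> d \<and>
    (\<forall>F\<in>P.apartment B. precedes F a b \<longleftrightarrow> precedes (f F) c d)"
proof -
  obtain c d where cd: "c \<in> B'" "d \<in> B'" "c \<noteq> d"
      "\<And>F. F \<in> P.apartment B \<Longrightarrow> precedes F a b \<Longrightarrow> precedes (f F) c d"
    using root_image_le[OF B B' ab] by blast
  obtain c' d' where cd': "c' \<in> B'" "d' \<in> B'" "c' \<noteq> d'"
      "\<And>F. F \<in> P.apartment B \<Longrightarrow> precedes F b a \<Longrightarrow> precedes (f F) c' d'"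
    using root_image_le[OF B B' ab(2,1)] ab(3) by blast
  have image: "f F \<in> P'.apartment B'" if "F \<in> P.apartment B" for F using B' that by blast
  have "d = c' \<and> c = d'"
  proof (rule P'.root_unique[OF B'(1)])
    fix F' assume F': "F' \<in> P'.apartment B'" "precedes F' d c"
    then obtain F where F: "F \<in> P.apartment B" "F' = f F" using B' by blast
    have "\<not> precedes F a b"
      using cd(4)[OF F(1)] P'.precedes_total(2)[OF B'(1) F'(1)] F F' cd(1-3) by blast
    then show "precedes F' c' d'"
      using P.precedes_total(1)[OF B F(1) ab(1,2)] cd'(4)[OF F(1)] F by blast
  qed (use cd cd' in auto)
  then have "precedes F a b" if "F \<in> P.apartment B" "precedes (f F) c d" for F
    using that cd' cd(1-3) P.precedes_total(1)[OF B that(1) ab(1,2)]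
      P'.precedes_total(2)[OF B'(1) image[OF that(1)], of c d] by blast
  then show ?thesis using cd by blast
qed

lemma vertex_map_exists:
  assumes B: "is_base P B" and B': "is_base P' B'" "f ` P.apartment B = P'.apartment B'"
  shows "\<exists>\<pi>. bij_betw \<pi> B B' \<and>
    ((\<forall>F\<in>P.apartment B. \<forall>a\<in>B. \<forall>b\<in>B. precedes F a b \<longleftrightarrow> precedes (f F) (\<pi> a) (\<pi> b)) \<or>
     (\<forall>F\<in>P.apartment B. \<forall>a\<in>B. \<forall>b\<in>B. precedes F a b \<longleftrightarrow> precedes (f F) (\<pi> b) (\<pi> a)))"
proof -
  let ?Q = "\<lambda>a b c d. c \<in> B' \<and> d \<in> B' \<and> c \<noteq> d \<and>
    (\<forall>F\<in>P.apartment B. precedes F a b \<longleftrightarrow> precedes (f F) c d)"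
  have "\<exists>p. a \<in> B \<longrightarrow> b \<in> B \<longrightarrow> a \<noteq> b \<longrightarrow> ?Q a b (fst p) (snd p)" for a b
    using root_image[OF B B', of a b] by (metis fst_conv snd_conv)
  then obtain st where st: "\<And>a b. a \<in> B \<Longrightarrow> b \<in> B \<Longrightarrow> a \<noteq> b \<Longrightarrow> ?Q a b (fst (st a b)) (snd (st a b))"
    by metis
  define s t where "s a b = fst (st a b)" and "t a b = snd (st a b)" for a b
  have st: "?Q a b (s a b) (t a b)" if "a \<in> B" "b \<in> B" "a \<noteq> b" for a b
    using st that by (simp add: s_def t_def)
  have image: "f F \<in> P'.apartment B'" if "F \<in> P.apartment B" for F using B' that by blast
  have uniq: "c = c' \<and> d = d'" if Q: "?Q a b c d" "?Q a b c' d'" for a b c d c' d'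
  proof (rule P'.root_unique[OF B'(1)])
    fix F' assume F': "F' \<in> P'.apartment B'" "precedes F' c d"
    then obtain F where "F \<in> P.apartment B" "F' = f F" using B' by blast
    then show "precedes F' c' d'" using Q F' by blast
  qed (use Q in auto)
  have flip: "precedes F b a \<longleftrightarrow> \<not> precedes F a b"
    if "F \<in> P.apartment B" "a \<in> B" "b \<in> B" "a \<noteq> b" for F a b
    using P.precedes_total[OF B that(1-3)] that by blast
  have flip': "precedes F b a \<longleftrightarrow> \<not> precedes F a b"
    if "F \<in> P'.apartment B'" "a \<in> B'" "b \<in> B'" "a \<noteq> b" for F a b
    using P'.precedes_total[OF B'(1) that(1-3)] that by blast
  have swap: "s b a = t a b" if ab: "a \<in> B" "b \<in> B" "a \<noteq> b" for a b
  proof -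
    have "?Q b a (t a b) (s a b)"
      using st[OF ab] flip[OF _ ab] flip'[of _ "s a b" "t a b"] image by auto
    then show ?thesis using uniq st[of b a] ab by blast
  qed
  \<comment> \<open>The bound \<open>2 \<le> n\<close> enters here: a base has at least three
    points.\<close>
  have third: "\<exists>c\<in>B. c \<noteq> a \<and> c \<noteq> b" for a b
  proof (rule ccontr)
    assume "\<not> ?thesis"
    then have "B \<subseteq> {a, b}" by blast
    then have "card B \<le> card {a, b}" by (intro card_mono) auto
    then show False using P.baseD(3)[OF B] n by (simp add: card_insert_if split: if_splits)
  qed
  have "\<exists>\<pi>. inj_on \<pi> B \<and>
    ((\<forall>a\<in>B. \<forall>b\<in>B. a \<noteq> b \<longrightarrow> s a b = \<pi> a \<and> t a b = \<pi> b) \<or>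
     (\<forall>a\<in>B. \<forall>b\<in>B. a \<noteq> b \<longrightarrow> s a b = \<pi> b \<and> t a b = \<pi> a))"
  proof (rule edge_map_vertex_map[OF third _ swap])
    fix a b c d assume *: "a \<in> B" "b \<in> B" "a \<noteq> b" "c \<in> B" "d \<in> B" "c \<noteq> d"
      "s a b = s c d" "t a b = t c d"
    show "a = c \<and> b = d"
      by (rule P.root_unique[OF B *(1-6)]) (use st[OF *(1-3)] st[OF *(4-6)] *(7,8) in auto)
  next
    fix a b c assume *: "a \<in> B" "b \<in> B" "c \<in> B" "a \<noteq> b" "b \<noteq> c" "c \<noteq> a"
    show "\<nexists>r :: 'b \<Rightarrow> nat. r (s a b) < r (t a b) \<and> r (s b c) < r (t b c) \<and> r (s c a) < r (t c a)"
    proof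
      assume "\<exists>r :: 'b \<Rightarrow> nat. r (s a b) < r (t a b) \<and> r (s b c) < r (t b c) \<and> r (s c a) < r (t c a)"
      then obtain r :: "'b \<Rightarrow> nat"
        where r: "r (s a b) < r (t a b)" "r (s b c) < r (t b c)" "r (s c a) < r (t c a)" by blast
      obtain F' where F': "F' \<in> P'.apartment B'"
          "\<And>x y. x \<in> B' \<Longrightarrow> y \<in> B' \<Longrightarrow> r x < r y \<Longrightarrow> precedes F' x y"
        using P'.flag_with_key[OF B'(1), of r] by blast
      obtain F where F: "F \<in> P.apartment B" "F' = f F" using F' B' by blast
      \<comment> \<open>A key for the three image edges would come from a flag that orders
        \<open>a\<close>, \<open>b\<close>, \<open>c\<close> cyclically.\<close>
      have "precedes F a b" "precedes F b c" "precedes F c a"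
        using F' F r st[of a b] st[of b c] st[of c a] * by auto
      then have "precedes F a c" "precedes F c a" unfolding precedes_def by auto
      then show False using P.precedes_total(2)[OF B F(1)] * by blast
    qed
  qed (use st in auto)
  then obtain \<pi> where \<pi>: "inj_on \<pi> B"
    "(\<forall>a\<in>B. \<forall>b\<in>B. a \<noteq> b \<longrightarrow> s a b = \<pi> a \<and> t a b = \<pi> b) \<or>
     (\<forall>a\<in>B. \<forall>b\<in>B. a \<noteq> b \<longrightarrow> s a b = \<pi> b \<and> t a b = \<pi> a)" by blast
  have "\<pi> a \<in> B'" if "a \<in> B" for a
  proof -
    obtain b where b: "b \<in> B" "b \<noteq> a" using third by blast
    then show ?thesis using \<pi>(2) st[of a b] that by metis
  qed
  then have "\<pi> ` B = B'"
    using \<pi>(1) P.baseD[OF B] P'.baseD[OF B'(1)] by (intro card_subset_eq) (auto simp: card_image)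
  then have bij: "bij_betw \<pi> B B'" using \<pi>(1) by (simp add: bij_betw_def)
  from \<pi>(2) show ?thesis
  proof
    assume *: "\<forall>a\<in>B. \<forall>b\<in>B. a \<noteq> b \<longrightarrow> s a b = \<pi> a \<and> t a b = \<pi> b"
    have "precedes F a b \<longleftrightarrow> precedes (f F) (\<pi> a) (\<pi> b)"
      if "F \<in> P.apartment B" "a \<in> B" "b \<in> B" for F a b
      using st[of a b] * that by (cases "a = b") auto
    then show ?thesis using bij by blast
  next
    assume *: "\<forall>a\<in>B. \<forall>b\<in>B. a \<noteq> b \<longrightarrow> s a b = \<pi> b \<and> t a b = \<pi> a"
    have "precedes F a b \<longleftrightarrow> precedes (f F) (\<pi> b) (\<pi> a)"
      if "F \<in> P.apartment B" "a \<in> B" "b \<in> B" for F a b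
      using st[of a b] * that by (cases "a = b") auto
    then show ?thesis using bij by blast
  qed
qed

text \<open>Stated through enumerations rather than through \<open>precedes\<close>, so that the
  components of the image flag can be read off directly.\<close>

definition straight :: "'a set \<Rightarrow> 'b set \<Rightarrow> ('a \<Rightarrow> 'b) \<Rightarrow> bool" where
  "straight B B' \<pi> \<longleftrightarrow> is_base P' B' \<and> bij_betw \<pi> B B' \<and>
    (\<forall>y. bij_betw y {..n} B \<longrightarrow> f (P.flag y) = P'.flag (\<pi> \<circ> y))"

text \<open>The index \<open>n - i\<close> runs through \<open>y\<close> backwards, so the image
  component in position \<open>k\<close> is spanned by the images of the last \<open>k + 1\<close>
  points of \<open>y\<close>.\<close>

definition twisted :: "'a set \<Rightarrow> 'b set \<Rightarrow> ('a \<Rightarrow> 'b) \<Rightarrow> bool" where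
  "twisted B B' \<pi> \<longleftrightarrow> is_base P' B' \<and> bij_betw \<pi> B B' \<and>
    (\<forall>y. bij_betw y {..n} B \<longrightarrow> f (P.flag y) = P'.flag (\<lambda>i. \<pi> (y (n - i))))"

lemma straight_or_twisted:
  assumes B: "is_base P B"
  shows "\<exists>B' \<pi>. straight B B' \<pi> \<or> twisted B B' \<pi>"
proof -
  obtain B' where B': "is_base P' B'" "f ` P.apartment B = P'.apartment B'"
    using apartment_image B by blast
  obtain \<pi> where \<pi>: "bij_betw \<pi> B B'"
    "(\<forall>F\<in>P.apartment B. \<forall>a\<in>B. \<forall>b\<in>B. precedes F a b \<longleftrightarrow> precedes (f F) (\<pi> a) (\<pi> b)) \<or>
     (\<forall>F\<in>P.apartment B. \<forall>a\<in>B. \<forall>b\<in>B. precedes F a b \<longleftrightarrow> precedes (f F) (\<pi> b) (\<pi> a))"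
    using vertex_map_exists[OF B B'] by blast
  \<comment> \<open>The image is some flag of the apartment of \<open>B'\<close>, hence an
    enumeration; the order relation leaves only one choice for it.\<close>
  have enum: "f (P.flag y) = P'.flag z"
    if y: "bij_betw y {..n} B" and z: "bij_betw z {..n} B'"
      and zp: "\<And>i j. i \<le> n \<Longrightarrow> j \<le> n \<Longrightarrow> precedes (f (P.flag y)) (z i) (z j) \<longleftrightarrow> i \<le> j" for y z
  proof -
    have "f (P.flag y) \<in> P'.apartment B'" using P.flag_in_apartment[OF B y] B' by blast
    then obtain w where w: "bij_betw w {..n} B'" "f (P.flag y) = P'.flag w"
      using P'.apartment_flag[OF B'(1)] by blast
    have "w i = z i" if "i \<le> n" for i
      using order_enumeration_unique[OF w(1) _ z zp that, of ] P'.precedes_flag[OF B'(1) w(1)] w(2)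
      by simp
    then show ?thesis using w flag_of_cong by metis
  qed
  have yB: "y i \<in> B" if "bij_betw y {..n} B" "i \<le> n" for y i
    using that bij_betwE by fastforce
  from \<pi>(2) show ?thesis
  proof
    assume *: "\<forall>F\<in>P.apartment B. \<forall>a\<in>B. \<forall>b\<in>B. precedes F a b \<longleftrightarrow> precedes (f F) (\<pi> a) (\<pi> b)"
    have "f (P.flag y) = P'.flag (\<pi> \<circ> y)" if y: "bij_betw y {..n} B" for y
    proof (rule enum[OF y bij_betw_trans[OF y \<pi>(1)]])
      fix i j assume "i \<le> n" "j \<le> n"
      then show "precedes (f (P.flag y)) ((\<pi> \<circ> y) i) ((\<pi> \<circ> y) j) \<longleftrightarrow> i \<le> j"
        using * P.flag_in_apartment[OF B y] yB[OF y] P.precedes_flag[OF B y] by auto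
    qed
    then show ?thesis using B' \<pi> unfolding straight_def by blast
  next
    assume *: "\<forall>F\<in>P.apartment B. \<forall>a\<in>B. \<forall>b\<in>B. precedes F a b \<longleftrightarrow> precedes (f F) (\<pi> b) (\<pi> a)"
    have rev: "bij_betw (\<lambda>i. n - i) {..n} {..n}"
      by (rule bij_betwI[where g = "\<lambda>i. n - i"]) auto
    have "f (P.flag y) = P'.flag (\<lambda>i. \<pi> (y (n - i)))" if y: "bij_betw y {..n} B" for y
    proof (rule enum[OF y])
      show "bij_betw (\<lambda>i. \<pi> (y (n - i))) {..n} B'"
        using bij_betw_trans[OF rev bij_betw_trans[OF y \<pi>(1)]] by (simp add: o_def)
      fix i j assume ij: "i \<le> n" "j \<le> n"
      have "precedes (f (P.flag y)) (\<pi> (y (n - i))) (\<pi> (y (n - j))) \<longleftrightarrow>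
          precedes (P.flag y) (y (n - j)) (y (n - i))"
        using * P.flag_in_apartment[OF B y] yB[OF y] by auto
      also have "\<dots> \<longleftrightarrow> i \<le> j" using P.precedes_flag[OF B y, of "n - j" "n - i"] ij by auto
      finally show "precedes (f (P.flag y)) (\<pi> (y (n - i))) (\<pi> (y (n - j))) \<longleftrightarrow> i \<le> j" .
    qed
    then show ?thesis using B' \<pi> unfolding twisted_def by blast
  qed
qed

end

section \<open>The dual space\<close>

context projective_space_dim
begin

context
  assumes n: "2 \<le> n"
begin

abbreviation dual :: "'a set geometry" where "dual \<equiv> dual_space n G"
abbreviation hc :: "'a set \<Rightarrow> 'a set set" where "hc \<equiv> hyperplanes_containing n G"

lemma hc_iff: "H \<in> hc U \<longleftrightarrow> has_rank H n \<and> U \<subseteq> H"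
  using n by (simp add: hyperplanes_containing_def has_dim_iff)

lemma points_dual: "points dual = {H. has_rank H n}"
  using n by (simp add: dual_space_def has_dim_iff)

lemma lines_dual: "lines dual = {hc U | U. has_rank U (n - 1)}"
proof -
  have "Suc (n - 2) = n - 1" using n by simp
  then show ?thesis by (simp add: dual_space_def has_dim_iff)
qed

text \<open>Fix \<open>z\<close> in \<open>S\<close> outside \<open>H\<close>. The line from
  \<open>z\<close> to any other point of \<open>S\<close> meets \<open>H\<close>, and does so inside
  \<open>S\<close>; hence \<open>z\<close> and \<open>S \<inter> H\<close> span \<open>S\<close>,
  and the rank drops by exactly one.\<close>

lemma hyperplane_Int:
  assumes H: "has_rank H n" and S: "has_rank S r" and "\<not> S \<subseteq> H"
  shows "\<exists>q. r = Suc q \<and> has_rank (S \<inter> H) q"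
proof -
  note ssp = has_rank_subspace[OF H] has_rank_subspace[OF S]
  have sub: "is_subspace G (S \<inter> H)" by (rule is_subspace_Int[OF ssp(2,1)])
  then obtain q where q: "has_rank (S \<inter> H) q" using subspace_has_rank[of "S \<inter> H" S r] S by blast
  obtain z where z: "z \<in> S" "z \<notin> H" using assms(3) by blast
  have zP: "z \<in> points G" using z ssp subspace_points by blast
  let ?T = "spanned G (insert z (S \<inter> H))"
  have TP: "insert z (S \<inter> H) \<subseteq> points G" using zP sub subspace_points by blast
  have span: "spanned G (insert z H) = points G"
    using has_rank_cover[OF H rank_points subspace_points[OF ssp(1)] zP z(2)] .
  have "z' \<in> ?T" if z': "z' \<in> S" for z'
  proof (cases "z' = z")
    case True then show ?thesis using spanned_subset[of "insert z (S \<inter> H)"] by blast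
  next
    case False
    have z'P: "z' \<in> points G" using z' ssp subspace_points by blast
    obtain h where h: "h \<in> H" "h \<in> line_through G z z'"
      using join_point[OF ssp(1) zP z(2), of z'] span z'P False by auto
    have hS: "h \<in> S" using h subspaceD[OF ssp(2) z(1) z'] False by blast
    have hz: "h \<noteq> z" using h z by blast
    have hP: "h \<in> points G" using hS ssp subspace_points by blast
    have "z \<in> ?T" "h \<in> ?T" using hS h spanned_subset[of "insert z (S \<inter> H)"] by auto
    then have "line_through G z h \<subseteq> ?T" using subspaceD[OF is_subspace_spanned[OF TP]] hz by metis
    moreover have "line_through G z h = line_through G z z'"
      using line_through_eq' line_through_props zP z'P False h hz by metis
    ultimately show ?thesis using line_through_props[OF zP z'P] False by auto
  qed
  moreover have "?T \<subseteq> S" using spanned_minimal[of "insert z (S \<inter> H)" S] ssp(2) z by simp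
  ultimately have "?T = S" by blast
  then have "has_rank S (Suc q)" using has_rank_insert[OF q zP] z by simp
  then show ?thesis using q S has_rank_unique by blast
qed

text \<open>A basis of \<open>U\<close> together with \<open>p\<close> extends to a base of the
  space; omitting \<open>p\<close> from it leaves a spanning set of the hyperplane.\<close>

lemma hyperplane_separates:
  assumes U: "is_subspace G U" and p: "p \<in> points G" "p \<notin> U"
  shows "\<exists>H. has_rank H n \<and> U \<subseteq> H \<and> p \<notin> H"
proof -
  obtain r where "has_rank U r" using subspace_has_rank U subspace_points rank_points by blast
  then obtain X where X: "independent G X" "spanned G X = U" unfolding has_rank_def by blast
  then have "independent G (insert p X)" using independent_insert p by simp
  then obtain B where B: "insert p X \<subseteq> B" "is_base G B" using independent_extend_base by blast
  let ?H = "spanned G (B - {p})"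
  have "card (B - {p}) = n" using baseD(2,3)[OF B(2)] B(1) by simp
  moreover have "independent G (B - {p})"
    by (rule independent_mono[OF baseD(1)[OF B(2)]]) blast
  ultimately have "has_rank ?H n" using has_rankI[of "B - {p}"] baseD(2)[OF B(2)] by simp
  moreover have "U \<subseteq> ?H"
  proof -
    have "X \<subseteq> B - {p}" using X p(2) B(1) spanned_subset[of X] by auto
    then show ?thesis unfolding X(2)[symmetric] by (rule spanned_mono)
  qed
  moreover have "p \<notin> ?H" using baseD(1)[OF B(2)] B(1) unfolding independent_iff by blast
  ultimately show ?thesis by blast
qed

lemma hyperplane_over:
  assumes "has_rank U r" "r \<le> n"
  shows "\<exists>H. has_rank H n \<and> U \<subseteq> H"
proof -
  have "U \<noteq> points G" using has_rank_unique[OF assms(1)] rank_points assms(2) by fastforce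
  then obtain p where "p \<in> points G" "p \<notin> U"
    using subspace_points[OF has_rank_subspace[OF assms(1)]] by blast
  then show ?thesis using hyperplane_separates has_rank_subspace[OF assms(1)] by blast
qed

lemma hyperplanes_Int:
  assumes "has_rank H n" "has_rank K n" "H \<noteq> K"
  shows "has_rank (H \<inter> K) (n - 1)"
proof -
  have "\<not> H \<subseteq> K" using has_rank_eq assms by blast
  then show ?thesis using hyperplane_Int[OF assms(2,1)] by auto
qed

lemma dual_line_eq:
  assumes "l \<in> lines dual" "H \<in> l" "K \<in> l" "H \<noteq> K"
  shows "l = hc (H \<inter> K)"
proof -
  obtain U where U: "l = hc U" "has_rank U (n - 1)" using assms(1) lines_dual by auto
  then have "has_rank H n" "has_rank K n" "U \<subseteq> H \<inter> K" using assms by (auto simp: hc_iff)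
  then have "U = H \<inter> K" using has_rank_eq[OF U(2) hyperplanes_Int] assms(4) by blast
  then show ?thesis using U by simp
qed

lemma hyperplanes_Int_mem:
  assumes "has_rank H n" "has_rank K n" "H \<noteq> K"
  shows "hc (H \<inter> K) \<in> lines dual \<and> H \<in> hc (H \<inter> K) \<and> K \<in> hc (H \<inter> K)"
  using hyperplanes_Int[OF assms] assms by (auto simp: lines_dual hc_iff)

lemma dual_line_through:
  assumes "has_rank H n" "has_rank K n" "H \<noteq> K"
  shows "line_through dual H K = hc (H \<inter> K)"
  unfolding line_through_def
  by (rule the_equality) (use hyperplanes_Int_mem[OF assms] dual_line_eq assms in auto)

lemma has_rank_subspace_pred:
  assumes "has_rank S (Suc r)"
  shows "\<exists>U\<subseteq>S. has_rank U r"
proof -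
  obtain X where X: "independent G X" "finite X" "card X = Suc r" "spanned G X = S"
    using assms unfolding has_rank_def by blast
  then obtain x where "x \<in> X" by fastforce
  then have "card (X - {x}) = r" using X by simp
  then have "has_rank (spanned G (X - {x})) r"
    using has_rankI[of "X - {x}"] independent_mono[OF X(1)] X(2) by auto
  then show ?thesis using spanned_mono[of "X - {x}" X] X by blast
qed

text \<open>Degenerate triples are always collinear: three equal hyperplanes share a subspace of
  rank \<open>n - 1\<close>, and two different ones share their intersection. So distinctness comes
  for free.\<close>

lemma dual_noncollinear:
  assumes "has_rank A n" "has_rank B n" "has_rank C n" "\<not> collinear3 dual A B C"
  shows "A \<noteq> B \<and> A \<noteq> C \<and> B \<noteq> C \<and> \<not> A \<inter> B \<subseteq> C"
proof -
  have no: "\<not> (U \<subseteq> A \<and> U \<subseteq> B \<and> U \<subseteq> C)" if "has_rank U (n - 1)" for U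
  proof
    assume "U \<subseteq> A \<and> U \<subseteq> B \<and> U \<subseteq> C"
    then have "A \<in> hc U" "B \<in> hc U" "C \<in> hc U" using assms hc_iff by auto
    moreover have "hc U \<in> lines dual" using that lines_dual by blast
    ultimately show False using assms(4) unfolding collinear3_def by blast
  qed
  have "Suc (n - 1) = n" using n by simp
  then obtain U where U: "U \<subseteq> A" "has_rank U (n - 1)"
    using has_rank_subspace_pred[of A "n - 1"] assms(1) by auto
  then have ne: "A \<noteq> B \<or> A \<noteq> C" using no by blast
  have AB: "A \<noteq> B \<Longrightarrow> \<not> A \<inter> B \<subseteq> C" using no[OF hyperplanes_Int[OF assms(1,2)]] by blast
  have AC: "A \<noteq> C \<Longrightarrow> \<not> A \<inter> C \<subseteq> B" using no[OF hyperplanes_Int[OF assms(1,3)]] by blast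
  show ?thesis using ne AB AC by blast
qed

text \<open>The half of the dimension formula that places two subspaces in a common hyperplane; this
  is what the axiom \<open>veblen\<close> for the dual requires.\<close>

lemma has_rank_join_le:
  assumes "has_rank W r" "has_rank U (Suc r)" "has_rank V (Suc r)" "W \<subseteq> U" "W \<subseteq> V"
  shows "\<exists>T t. has_rank T t \<and> t \<le> r + 2 \<and> U \<subseteq> T \<and> V \<subseteq> T"
proof -
  have "\<not> U \<subseteq> W" "\<not> V \<subseteq> W" using has_rank_mono[OF _ assms(1)] assms(2,3) by fastforce+
  then obtain u v where uv: "u \<in> U" "u \<notin> W" "v \<in> V" "v \<notin> W" by blast
  have P: "u \<in> points G" "v \<in> points G" "U \<subseteq> points G"
    using uv assms has_rank_subspace subspace_points by blast+
  have U: "spanned G (insert u W) = U" and V: "spanned G (insert v W) = V"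
    using has_rank_cover assms uv by auto
  let ?T = "spanned G (insert v U)"
  have "W \<subseteq> ?T" "v \<in> ?T" and UT: "U \<subseteq> ?T" using spanned_subset[of "insert v U"] assms by auto
  then have "V \<subseteq> ?T"
    using V spanned_minimal[of "insert v W" ?T] is_subspace_spanned[of "insert v U"] P by auto
  moreover have "\<exists>t\<le>r + 2. has_rank ?T t"
  proof (cases "v \<in> U")
    case True
    then have "?T = U" using spanned_subspace[OF has_rank_subspace[OF assms(2)]]
      by (simp add: insert_absorb)
    then show ?thesis using assms(2) by (intro exI[of _ "Suc r"]) simp
  next
    case False
    then show ?thesis using has_rank_insert[OF assms(2) P(2)] by (intro exI[of _ "r + 2"]) simp
  qed
  ultimately show ?thesis using UT by blast
qed

text \<open>For \<open>veblen\<close>, both \<open>X \<inter> Y\<close> and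
  \<open>B \<inter> C\<close> contain \<open>A \<inter> B \<inter> C\<close> with rank one less.
  Their join therefore has rank at most \<open>n\<close> and lies in a hyperplane, the required
  common point of the two dual lines. For \<open>thick\<close>, three points of a line missing
  \<open>U\<close> span three hyperplanes with it.\<close>

lemma dual_projective_space: "projective_space dual"
proof
  fix l assume l: "l \<in> lines dual"
  then obtain U where U: "l = hc U" "has_rank U (n - 1)" using lines_dual by auto
  \<comment> \<open>As \<open>n - 1 > 0\<close>, there is a point of \<open>U\<close>; a hyperplane
    avoiding it is not on the dual line.\<close>
  have "U \<noteq> {}" using U has_rank_unique[of U "n - 1" 0] has_rank_0[of U] n by auto
  then obtain p where p: "p \<in> U" by blast
  then have "p \<in> points G" using U has_rank_subspace subspace_points by blast
  moreover have "is_subspace G {}" by (simp add: is_subspace_def)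
  ultimately obtain H where H: "has_rank H n" "p \<notin> H" using hyperplane_separates[of "{}" p] by blast
  then have "H \<in> points dual - l" using U p by (auto simp: points_dual hc_iff)
  moreover have "l \<subseteq> points dual" using U by (auto simp: points_dual hc_iff)
  ultimately show "l \<subset> points dual" by blast
next
  fix H K assume HK: "H \<in> points dual" "K \<in> points dual" "H \<noteq> K"
  then have r: "has_rank H n" "has_rank K n" by (simp_all add: points_dual)
  show "\<exists>!l. l \<in> lines dual \<and> H \<in> l \<and> K \<in> l"
    using hyperplanes_Int_mem[OF r HK(3)] dual_line_eq[OF _ _ _ HK(3)] by blast
next
  fix A B C l X Y
  assume "A \<in> points dual" "B \<in> points dual" "C \<in> points dual"
    and nc: "\<not> collinear3 dual A B C"
    and l: "l \<in> lines dual" "X \<in> l" "Y \<in> l"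
    and X: "X \<in> line_through dual A B" "X \<noteq> A" and Y: "Y \<in> line_through dual A C" "Y \<noteq> A"
  then have A: "has_rank A n" and B: "has_rank B n" and C: "has_rank C n"
    by (simp_all add: points_dual)
  note nc = dual_noncollinear[OF A B C nc]
  have X: "has_rank X n" "A \<inter> B \<subseteq> X" "X \<noteq> A" using X dual_line_through[OF A B] nc hc_iff by auto
  have Y: "has_rank Y n" "A \<inter> C \<subseteq> Y" "Y \<noteq> A" using Y dual_line_through[OF A C] nc hc_iff by auto
  \<comment> \<open>If they were equal, \<open>A \<inter> X\<close> would contain
    \<open>A \<inter> B\<close> and \<open>A \<inter> C\<close>, all of the same rank, and the three
    hyperplanes would be collinear.\<close>
  have "X \<noteq> Y"
  proof
    assume "X = Y"
    have "has_rank (A \<inter> B) (n - 1)" "has_rank (A \<inter> C) (n - 1)" "has_rank (A \<inter> X) (n - 1)"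
      using hyperplanes_Int A B C X nc by auto
    then have "A \<inter> B = A \<inter> X" "A \<inter> C = A \<inter> X"
      using has_rank_eq[of "A \<inter> B" "n - 1" "A \<inter> X"] has_rank_eq[of "A \<inter> C" "n - 1" "A \<inter> X"]
        X(2) Y(2) \<open>X = Y\<close> by auto
    then show False using nc by blast
  qed
  then have lXY: "l = hc (X \<inter> Y)" using dual_line_eq l by blast
  let ?W = "A \<inter> B \<inter> C"
  obtain q where q: "n - 1 = Suc q" "has_rank ?W q"
    using hyperplane_Int[OF C hyperplanes_Int[OF A B]] nc by auto
  have XY: "has_rank (X \<inter> Y) (Suc q)" using hyperplanes_Int[OF X(1) Y(1) \<open>X \<noteq> Y\<close>] q by simp
  have BC: "has_rank (B \<inter> C) (Suc q)" using hyperplanes_Int[OF B C] nc q by simp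
  obtain T t where T: "has_rank T t" "t \<le> q + 2" "X \<inter> Y \<subseteq> T" "B \<inter> C \<subseteq> T"
    using has_rank_join_le[OF q(2) XY BC] X(2) Y(2) by blast
  moreover have "t \<le> n" using T(2) q(1) by linarith
  ultimately obtain Z where "has_rank Z n" "T \<subseteq> Z" using hyperplane_over by blast
  then have "Z \<in> hc (X \<inter> Y)" "Z \<in> hc (B \<inter> C)" using T by (auto simp: hc_iff)
  then show "l \<inter> line_through dual B C \<noteq> {}" using lXY dual_line_through[OF B C] nc by blast
next
  fix l assume "l \<in> lines dual"
  then obtain U where U: "l = hc U" "has_rank U (n - 1)" using lines_dual by auto
  note Us = has_rank_subspace[OF U(2)]
  have rk: "has_rank (spanned G (insert p U)) n" if "p \<in> points G" "p \<notin> U" for p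
    using has_rank_insert[OF U(2) that] n by simp
  have new: "\<exists>p\<in>points G. p \<notin> S" if "has_rank S r" "r \<le> n" for S r
    using has_rank_unique[OF that(1)] rank_points that subspace_points[OF has_rank_subspace[OF that(1)]]
    by (metis not_less_eq_eq order_refl subsetI subset_antisym)
  obtain a where a: "a \<in> points G" "a \<notin> U" using new[OF U(2)] by auto
  let ?A = "spanned G (insert a U)"
  obtain b where b: "b \<in> points G" "b \<notin> ?A" using new[OF rk[OF a]] by auto
  have subA: "insert a U \<subseteq> ?A" by (rule spanned_subset)
  have ab: "a \<noteq> b" "b \<notin> U" using b subA by auto
  let ?B = "spanned G (insert b U)"
  have subB: "insert b U \<subseteq> ?B" by (rule spanned_subset)
  have UP: "insert a U \<subseteq> points G" "insert b U \<subseteq> points G" using a b Us subspace_points by auto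
  note ssA = is_subspace_spanned[OF UP(1)] and ssB = is_subspace_spanned[OF UP(2)]
  have aB: "a \<notin> ?B" using exchange[of U b a] b a ab spanned_subspace[OF Us] subspace_points[OF Us] by auto
  note lab = line_through_props[OF a(1) b(1) ab(1)]
  obtain c where c: "c \<in> line_through G a b" "c \<noteq> a" "c \<noteq> b" using thick lab by metis
  have cP: "c \<in> points G" using c lab line_subset by blast
  have lac: "line_through G a c = line_through G a b" "line_through G b c = line_through G a b"
    using line_through_eq lab c by metis+
  have cA: "c \<notin> ?A"
  proof
    assume "c \<in> ?A"
    then have "line_through G a c \<subseteq> ?A" using subspaceD[OF ssA, of a c] subA c by blast
    then show False using lac lab b by auto
  qed
  have cB: "c \<notin> ?B"
  proof
    assume "c \<in> ?B"
    then have "line_through G b c \<subseteq> ?B" using subspaceD[OF ssB, of b c] subB c by blast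
    then show False using lac lab aB by auto
  qed
  let ?C = "spanned G (insert c U)"
  have subC: "insert c U \<subseteq> ?C" by (rule spanned_subset)
  have "c \<notin> U" using cA subA by blast
  then have "?A \<in> l" "?B \<in> l" "?C \<in> l"
    using rk[OF a] rk[OF b(1) ab(2)] rk[OF cP] subA subB subC U(1) by (auto simp: hc_iff)
  moreover have "?A \<noteq> ?B" "?A \<noteq> ?C" "?B \<noteq> ?C" using aB cA cB subA subB subC by auto
  ultimately show "\<exists>p q r. p \<in> l \<and> q \<in> l \<and> r \<in> l \<and> p \<noteq> q \<and> p \<noteq> r \<and> q \<noteq> r" by blast
qed

interpretation D: projective_space dual
  by (rule dual_projective_space)

section \<open>Subspaces of the dual space\<close>

lemma hc_anti: "V \<subseteq> U \<Longrightarrow> hc U \<subseteq> hc V"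
  unfolding hyperplanes_containing_def by blast

lemma hc_subset_iff:
  assumes "is_subspace G U" "is_subspace G V"
  shows "hc U \<subseteq> hc V \<longleftrightarrow> V \<subseteq> U"
proof
  assume sub: "hc U \<subseteq> hc V"
  show "V \<subseteq> U"
  proof (rule subsetI, rule ccontr)
    fix p assume p: "p \<in> V" "p \<notin> U"
    then obtain H where "has_rank H n" "U \<subseteq> H" "p \<notin> H"
      using hyperplane_separates[OF assms(1)] subspace_points[OF assms(2)] by blast
    then have "H \<in> hc U" "H \<notin> hc V" using p(1) by (auto simp: hc_iff)
    then show False using sub by blast
  qed
qed (rule hc_anti)

lemma hc_psubset_iff:
  "is_subspace G U \<Longrightarrow> is_subspace G V \<Longrightarrow> hc U \<subset> hc V \<longleftrightarrow> V \<subset> U"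
  by (simp add: less_le_not_le hc_subset_iff)

lemma hc_inj: "is_subspace G U \<Longrightarrow> is_subspace G V \<Longrightarrow> hc U = hc V \<Longrightarrow> U = V"
  using hc_subset_iff by blast

lemma dual_corr_hc: "is_subspace G U \<Longrightarrow> dual_corr n G (hc U) = U"
  unfolding dual_corr_def by (rule the_equality) (auto dest: hc_inj)

lemma hc_subspace:
  assumes "is_subspace G U"
  shows "is_subspace dual (hc U)"
proof -
  have "line_through dual H K \<subseteq> hc U" if "H \<in> hc U" "K \<in> hc U" "H \<noteq> K" for H K
  proof -
    have "line_through dual H K = hc (H \<inter> K)" "U \<subseteq> H \<inter> K"
      using that dual_line_through[of H K] by (auto simp: hc_iff)
    then show ?thesis using hc_anti[of U "H \<inter> K"] by simp
  qed
  then show ?thesis unfolding is_subspace_def by (auto simp: points_dual hc_iff)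
qed

text \<open>Let \<open>w\<close> be a point of \<open>V\<close> outside \<open>H\<close>. If
  \<open>K\<close> is neither \<open>H\<close> nor a hyperplane over \<open>V\<close>, then
  \<open>w\<close> and \<open>K \<inter> H\<close> span a hyperplane over \<open>V\<close> which
  shares \<open>K \<inter> H\<close> with \<open>H\<close>; so \<open>K\<close> is on the dual line
  joining it to \<open>H\<close>.\<close>

lemma hc_Int_subset:
  assumes V: "is_subspace G V" and H: "has_rank H n"
  shows "hc (V \<inter> H) \<subseteq> spanned dual (insert H (hc V))"
proof
  fix K assume "K \<in> hc (V \<inter> H)"
  then have K: "has_rank K n" "V \<inter> H \<subseteq> K" by (auto simp: hc_iff)
  let ?S = "spanned dual (insert H (hc V))"
  have sub: "insert H (hc V) \<subseteq> ?S" by (rule D.spanned_subset)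
  show "K \<in> ?S"
  proof (cases "K = H \<or> V \<subseteq> K")
    case True then show ?thesis using sub K by (auto simp: hc_iff)
  next
    case False
    then have VH: "\<not> V \<subseteq> H" using K by blast
    obtain v where v: "has_rank V v" using subspace_has_rank V subspace_points rank_points by blast
    obtain q where q: "v = Suc q" "has_rank (V \<inter> H) q" using hyperplane_Int[OF H v VH] by blast
    obtain w where w: "w \<in> V" "w \<notin> H" using VH by blast
    have wP: "w \<in> points G" using w V subspace_points by blast
    have Vw: "spanned G (insert w (V \<inter> H)) = V"
      using has_rank_cover[OF q(2)] v q(1) w by auto
    have KH: "has_rank (K \<inter> H) (n - 1)" using hyperplanes_Int K H False by blast
    let ?T = "spanned G (insert w (K \<inter> H))"
    have T: "has_rank ?T n" using has_rank_insert[OF KH wP] w n by simp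
    have Tsub: "insert w (K \<inter> H) \<subseteq> ?T" by (rule spanned_subset)
    then have "V \<subseteq> ?T" using Vw spanned_minimal[of "insert w (V \<inter> H)" ?T] K has_rank_subspace[OF T] by blast
    then have TS: "?T \<in> ?S" using sub T by (auto simp: hc_iff)
    have HT: "H \<noteq> ?T" using w Tsub by blast
    have "K \<inter> H = H \<inter> ?T" using has_rank_eq[OF KH hyperplanes_Int[OF H T HT]] Tsub by blast
    then have "K \<in> line_through dual H ?T" using dual_line_through[OF H T HT] K by (auto simp: hc_iff)
    moreover have "insert H (hc V) \<subseteq> points dual" using H by (auto simp: points_dual hc_iff)
    then have "is_subspace dual ?S" by (rule D.is_subspace_spanned)
    ultimately show ?thesis using D.subspaceD[of ?S H ?T] sub TS HT by blast
  qed
qed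

text \<open>Adding hyperplanes one at a time reduces this to \<open>hc_Int_subset\<close>.
  Intersecting with \<open>points G\<close> accounts for the empty family: the empty subspace of the
  dual corresponds to the whole space.\<close>

lemma spanned_dual:
  assumes "finite \<Y>" "\<Y> \<subseteq> points dual"
  shows "spanned dual \<Y> = hc (points G \<inter> \<Inter>\<Y>) \<and> is_subspace G (points G \<inter> \<Inter>\<Y>)"
  using assms
proof (induction \<Y>)
  case empty
  have "hc (points G) = {}"
    using has_rank_mono[OF rank_points, of _ n] by (auto simp: hc_iff)
  then show ?case using is_subspace_points D.spanned_empty by simp
next
  case (insert H \<Y>)
  let ?V = "points G \<inter> \<Inter>\<Y>"
  have IH: "spanned dual \<Y> = hc ?V" "is_subspace G ?V" using insert by auto
  have H: "has_rank H n" and YP: "\<Y> \<subseteq> points dual" using insert.prems by (auto simp: points_dual)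
  have eq: "points G \<inter> \<Inter>(insert H \<Y>) = ?V \<inter> H" by blast
  have ssp: "is_subspace G (?V \<inter> H)" by (rule is_subspace_Int[OF IH(2) has_rank_subspace[OF H]])
  have "spanned dual (insert H (hc ?V)) = spanned dual (insert H \<Y>)"
    using D.spanned_insert_spanned[OF YP, of H] IH(1) insert.prems by simp
  then have "hc (?V \<inter> H) \<subseteq> spanned dual (insert H \<Y>)" using hc_Int_subset[OF IH(2) H] by simp
  moreover have "insert H \<Y> \<subseteq> hc (?V \<inter> H)"
    using insert.prems by (auto simp: points_dual hc_iff)
  then have "spanned dual (insert H \<Y>) \<subseteq> hc (?V \<inter> H)"
    by (rule D.spanned_minimal[OF _ hc_subspace[OF ssp]])
  ultimately show ?case using eq ssp by simp
qed

text \<open>The hyperplanes opposite to the points of \<open>Y\<close> in the simplex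
  \<open>B\<close>, as in a dual basis. The second argument singles out the part belonging to a
  subset of the base.\<close>

definition dual_base :: "'a set \<Rightarrow> 'a set \<Rightarrow> 'a set set" where
  "dual_base B Y = (\<lambda>b. spanned G (B - {b})) ` Y"

lemma
  assumes B: "is_base G B" and Y: "Y \<subseteq> B"
  shows spanned_dual_base: "spanned dual (dual_base B Y) = hc (spanned G (B - Y))"
    and dual_base_points: "dual_base B Y \<subseteq> points dual"
    and finite_dual_base: "finite (dual_base B Y)"
    and card_dual_base: "card (dual_base B Y) = card Y"
proof -
  note B' = baseD[OF B]
  let ?h = "\<lambda>b. spanned G (B - {b})"
  have mem: "a \<in> ?h b \<longleftrightarrow> a \<noteq> b" if "a \<in> B" "b \<in> B" for a b
    using independent_mem[OF B'(1), of "B - {b}" a] that by blast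
  have "has_rank (?h b) n" if "b \<in> B" for b
    using has_rankI[OF independent_mono[OF B'(1), of "B - {b}"]] B'(2,3) that by simp
  then show P: "dual_base B Y \<subseteq> points dual" using Y by (auto simp: dual_base_def points_dual)
  have "finite Y" using Y B'(2) finite_subset by blast
  then show fin: "finite (dual_base B Y)" by (simp add: dual_base_def)
  have "inj_on ?h Y"
  proof (rule inj_onI)
    fix a b assume ab: "a \<in> Y" "b \<in> Y" "?h a = ?h b"
    then show "a = b" using mem[of a b] mem[of a a] Y by auto
  qed
  then show "card (dual_base B Y) = card Y" by (simp add: dual_base_def card_image)
  \<comment> \<open>Of the points of \<open>B\<close>, the hyperplane opposite to \<open>b\<close>
    misses only \<open>b\<close>; so those on all hyperplanes of the family form
    \<open>B - Y\<close>.\<close>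
  have "points G \<inter> \<Inter>(dual_base B Y) = spanned G (B - Y)"
  proof (cases "Y = {}")
    case True then show ?thesis using B'(5) by (simp add: dual_base_def)
  next
    case False
    have "B \<inter> \<Inter>(dual_base B Y) = B - Y" using mem Y by (auto simp: dual_base_def)
    moreover have "spanned G (B \<inter> \<Inter>(dual_base B Y)) = \<Inter>(dual_base B Y)"
      by (rule spanned_Int_Inter[OF B'(1,2)]) (use False in \<open>auto simp: dual_base_def\<close>)
    moreover have "spanned G (B - Y) \<subseteq> points G" using spanned_points B'(4) by blast
    ultimately show ?thesis by auto
  qed
  then show "spanned dual (dual_base B Y) = hc (spanned G (B - Y))"
    using spanned_dual[OF fin P] by simp
qed

lemma independent_dual_base:
  assumes B: "is_base G B"
  shows "independent dual (dual_base B B)"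
  unfolding D.independent_iff
proof (intro conjI ballI notI dual_base_points[OF B subset_refl])
  fix H assume H: "H \<in> dual_base B B" "H \<in> spanned dual (dual_base B B - {H})"
  then obtain b where b: "b \<in> B" "H = spanned G (B - {b})" by (auto simp: dual_base_def)
  have "dual_base B B - {H} \<subseteq> dual_base B (B - {b})" using b by (auto simp: dual_base_def)
  then have "H \<in> spanned dual (dual_base B (B - {b}))"
    using H(2) D.spanned_mono by blast
  then have "H \<in> hc (spanned G (B - (B - {b})))" using spanned_dual_base[OF B, of "B - {b}"] by simp
  moreover have "B - (B - {b}) = {b}" using b by blast
  ultimately have "b \<in> H" using b baseD(4)[OF B] by (auto simp: hc_iff)
  then show False using b baseD(1)[OF B] unfolding independent_iff by blast
qed

text \<open>A basis \<open>X\<close> of \<open>U\<close> extends to a base \<open>B\<close>, and the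
  hyperplanes opposite to the \<open>n + 1 - r\<close> points of \<open>B - X\<close> form a basis
  of \<open>hc U\<close>.\<close>

lemma hc_rank:
  assumes "has_rank U r"
  shows "D.has_rank (hc U) (Suc n - r)"
proof -
  obtain X where X: "independent G X" "finite X" "card X = r" "spanned G X = U"
    using assms unfolding has_rank_def by blast
  obtain B where B: "X \<subseteq> B" "is_base G B" using independent_extend_base X by blast
  let ?Y = "dual_base B (B - X)"
  have "independent dual ?Y"
    by (rule D.independent_mono[OF independent_dual_base[OF B(2)]]) (auto simp: dual_base_def)
  moreover have "card ?Y = Suc n - r"
    using card_dual_base[OF B(2), of "B - X"] baseD(2,3)[OF B(2)] X B(1) by (simp add: card_Diff_subset)
  moreover have "spanned dual ?Y = hc U"
    using spanned_dual_base[OF B(2), of "B - X"] B(1) X(4) by (simp add: double_diff)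
  ultimately show ?thesis using D.has_rankI[of ?Y] finite_dual_base[OF B(2), of "B - X"] by auto
qed

lemma dual_has_dim: "has_dim dual (points dual) n"
proof -
  have "points dual = hc {}" by (auto simp: points_dual hc_iff)
  then show ?thesis using hc_rank[of "{}" 0] has_rank_0 D.has_dim_iff by simp
qed

lemma projective_space_dim_dual: "projective_space_dim dual n"
  using dual_has_dim by unfold_locales

interpretation D: projective_space_dim dual n
  by (rule projective_space_dim_dual)

lemma dual_base_is_base: "is_base G B \<Longrightarrow> is_base dual (dual_base B B)"
  using D.independent_base independent_dual_base card_dual_base[of B B] baseD(3) by simp

lemma dual_subspace_hc:
  assumes "is_subspace dual T"
  shows "\<exists>U. is_subspace G U \<and> T = hc U"
proof -
  obtain r where "D.has_rank T r"
    using D.subspace_has_rank[OF assms D.subspace_points[OF assms] D.rank_points] by blast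
  then obtain \<Y> where \<Y>: "independent dual \<Y>" "finite \<Y>" "spanned dual \<Y> = T"
    unfolding D.has_rank_def by blast
  then show ?thesis using spanned_dual[OF \<Y>(2) D.independent_points[OF \<Y>(1)]] by blast
qed

text \<open>Inverse of the identification of flags built into \<open>dual_induced\<close>; the list
  is reversed because \<open>hc\<close> reverses inclusions.\<close>

definition dual_flag :: "'a set list \<Rightarrow> 'a set set list" where
  "dual_flag F = rev (map hc F)"

lemma flag_subspace: "F \<in> flags \<Longrightarrow> S \<in> set F \<Longrightarrow> is_subspace G S"
  by (auto simp: maximal_flags_def in_set_conv_nth has_dim_def)

lemma dual_flag_in_flags:
  assumes F: "F \<in> flags"
  shows "dual_flag F \<in> D.flags"
proof -
  have len: "length F = n" using F by (simp add: maximal_flags_def)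
  have nth: "dual_flag F ! k = hc (F ! (n - Suc k))" if "k < n" for k
    using that len by (simp add: dual_flag_def rev_nth)
  have ssp: "is_subspace G (F ! k)" if "k < n" for k
    using flag_subspace[OF F] that len by simp
  have "has_dim dual (dual_flag F ! k) k" if k: "k < n" for k
  proof -
    have "has_dim G (F ! (n - Suc k)) (n - Suc k)" using F k by (simp add: maximal_flags_def)
    then have "D.has_rank (hc (F ! (n - Suc k))) (Suc n - Suc (n - Suc k))"
      using hc_rank has_dim_iff by blast
    moreover have "Suc n - Suc (n - Suc k) = Suc k" using k by simp
    ultimately show ?thesis using nth[OF k] D.has_dim_iff by simp
  qed
  moreover have "dual_flag F ! i \<subset> dual_flag F ! j" if ij: "i < j" "j < n" for i j
  proof -
    have "F ! (n - Suc j) \<subset> F ! (n - Suc i)"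
      using F ij len sorted_wrt_nth_less[of "(\<subset>)" F "n - Suc j" "n - Suc i"]
      by (simp add: maximal_flags_def)
    moreover have "is_subspace G (F ! (n - Suc i))" "is_subspace G (F ! (n - Suc j))"
      using ssp ij by simp_all
    ultimately have "hc (F ! (n - Suc i)) \<subset> hc (F ! (n - Suc j))" by (simp add: hc_psubset_iff)
    then show ?thesis using nth[of i] nth[of j] ij by simp
  qed
  ultimately show ?thesis
    using len by (auto simp: maximal_flags_def sorted_wrt_iff_nth_less dual_flag_def)
qed

lemma dual_flag_inverse:
  "F \<in> flags \<Longrightarrow> rev (map (dual_corr n G) (dual_flag F)) = F"
  using flag_subspace[of F] dual_corr_hc
  by (simp add: dual_flag_def rev_map o_def map_idI)

lemma dual_flag_surj:
  assumes T: "T \<in> D.flags"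
  shows "\<exists>F\<in>flags. dual_flag F = T"
proof -
  have len: "length T = n" using T by (simp add: maximal_flags_def)
  have "\<exists>V. is_subspace G V \<and> T ! k = hc V" if "k < n" for k
    using dual_subspace_hc T that by (simp add: maximal_flags_def has_dim_def)
  then obtain V where V: "\<And>k. k < n \<Longrightarrow> is_subspace G (V k)" "\<And>k. k < n \<Longrightarrow> T ! k = hc (V k)"
    by metis
  define F where "F = map (\<lambda>k. V (n - Suc k)) [0..<n]"
  have lenF: "length F = n" by (simp add: F_def)
  have nth: "F ! k = V (n - Suc k)" if "k < n" for k using that by (simp add: F_def)
  have rk: "has_dim G (V k) (n - Suc k)" if k: "k < n" for k
  proof -
    obtain r where r: "r \<le> Suc n" "has_rank (V k) r"
      using subspace_has_rank V(1)[OF k] subspace_points rank_points by blast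
    have "has_dim dual (hc (V k)) k"
      using T k unfolding V(2)[OF k, symmetric] by (simp add: maximal_flags_def)
    then have "Suc n - r = Suc k"
      using hc_rank[OF r(2)] D.has_dim_iff D.has_rank_unique by blast
    then have "r = Suc (n - Suc k)" using k by linarith
    then show ?thesis using r has_dim_iff by blast
  qed
  have mono: "V j \<subset> V i" if ij: "i < j" "j < n" for i j
  proof -
    have "T ! i \<subset> T ! j"
      using T ij len sorted_wrt_nth_less[of "(\<subset>)" T i j] by (simp add: maximal_flags_def)
    then have "hc (V i) \<subset> hc (V j)" using V(2)[of i] V(2)[of j] ij by simp
    then show ?thesis using hc_psubset_iff[of "V i" "V j"] V(1) ij by simp
  qed
  have "F \<in> flags" unfolding maximal_flags_def sorted_wrt_iff_nth_less
  proof (intro CollectI conjI allI impI)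
    fix k assume k: "k < n"
    then have "n - Suc (n - Suc k) = k" by simp
    then show "has_dim G (F ! k) k" using rk[of "n - Suc k"] nth[OF k] k by simp
  next
    fix i j assume "i < j" "j < length F"
    then show "F ! i \<subset> F ! j" using mono[of "n - Suc j" "n - Suc i"] nth lenF by simp
  qed (rule lenF)
  moreover have "dual_flag F = T"
    by (rule nth_equalityI) (use len lenF nth V(2) in \<open>auto simp: dual_flag_def rev_nth\<close>)
  ultimately show ?thesis by blast
qed

text \<open>Complementation in \<open>B\<close> does the translation: a component spanned by
  \<open>Y\<close> becomes one spanned by the hyperplanes opposite to \<open>B - Y\<close>, and
  conversely.\<close>

lemma dual_flag_apartment:
  assumes B: "is_base G B"
  shows "dual_flag ` apartment B = D.apartment (dual_base B B)"
proof (intro equalityI subsetI)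
  fix T assume "T \<in> dual_flag ` apartment B"
  then obtain F where F: "F \<in> apartment B" "T = dual_flag F" by blast
  have "\<exists>\<Y>\<subseteq>dual_base B B. spanned dual \<Y> = S'" if S': "S' \<in> set T" for S'
  proof -
    obtain S where S: "S \<in> set F" "S' = hc S" using S' F by (auto simp: dual_flag_def)
    obtain Y where Y: "Y \<subseteq> B" "spanned G Y = S" using F(1) S(1) unfolding apartment_of_def by blast
    have "spanned dual (dual_base B (B - Y)) = S'"
      unfolding spanned_dual_base[OF B Diff_subset] S(2) Y(2)[symmetric]
      using Y(1) by (simp add: double_diff)
    then show ?thesis by (intro exI[of _ "dual_base B (B - Y)"]) (auto simp: dual_base_def)
  qed
  then show "T \<in> D.apartment (dual_base B B)"
    using dual_flag_in_flags F unfolding apartment_of_def by blast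
next
  fix T assume T: "T \<in> D.apartment (dual_base B B)"
  then obtain F where F: "F \<in> flags" "dual_flag F = T"
    using dual_flag_surj unfolding apartment_of_def by blast
  have "\<exists>Y\<subseteq>B. spanned G Y = S" if S: "S \<in> set F" for S
  proof -
    have "hc S \<in> set T" using S F by (auto simp: dual_flag_def)
    then obtain \<Y> where "\<Y> \<subseteq> dual_base B B" "spanned dual \<Y> = hc S"
      using T unfolding apartment_of_def by blast
    then obtain Y where Y: "Y \<subseteq> B" "spanned dual (dual_base B Y) = hc S"
      by (auto simp: dual_base_def subset_image_iff)
    then have "hc (spanned G (B - Y)) = hc S" using spanned_dual_base[OF B Y(1)] by simp
    then have "spanned G (B - Y) = S"
      using hc_inj is_subspace_spanned[of "B - Y"] baseD(4)[OF B] flag_subspace[OF F(1) S] by blast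
    then show ?thesis by blast
  qed
  then show "T \<in> dual_flag ` apartment B" using F unfolding apartment_of_def by blast
qed

end

end

section \<open>Types are kept or reversed globally\<close>

text \<open>If a place \<open>i < card D\<close> were taken by a point outside \<open>D\<close>, all
  of \<open>D\<close> would have to be listed in the \<open>i\<close> places before it.\<close>

lemma enumeration_initial_segment:
  fixes r :: "'a \<Rightarrow> nat"
  assumes y: "bij_betw y {..n} B" "\<And>i j. i \<le> j \<Longrightarrow> j \<le> n \<Longrightarrow> r (y i) \<le> r (y j)"
    and D: "D \<subseteq> B" "\<And>a b. a \<in> D \<Longrightarrow> b \<in> B - D \<Longrightarrow> r a < r b"
  shows "y ` {..<card D} = D"
proof -
  have inj: "inj_on y {..n}" and im: "y ` {..n} = B" using y by (auto simp: bij_betw_def)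
  have "finite B" using im by auto
  then have "card D \<le> card B" using D(1) card_mono by blast
  then have le: "card D \<le> Suc n" using bij_betw_same_card[OF y(1)] by simp
  have "y i \<in> D" if i: "i < card D" for i
  proof (rule ccontr)
    assume yi: "y i \<notin> D"
    have yB: "y i \<in> B" using im i le by auto
    have "D \<subseteq> y ` {..<i}"
    proof
      fix d assume d: "d \<in> D"
      then obtain j where j: "j \<le> n" "d = y j" using D(1) im by auto
      have "\<not> i \<le> j" using y(2)[of i j] D(2)[OF d, of "y i"] j yi yB by auto
      then show "d \<in> y ` {..<i}" using j by auto
    qed
    then have "card D \<le> card {..<i}" using surj_card_le[of "{..<i}" D y] by simp
    then show False using i by simp
  qed
  then have "y ` {..<card D} \<subseteq> D" by auto
  moreover have "{..<card D} \<subseteq> {..n}" using le by auto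
  then have "card (y ` {..<card D}) = card D"
    using card_image[OF inj_on_subset[OF inj]] by simp
  moreover have "finite D" using D(1) \<open>finite B\<close> finite_subset by blast
  ultimately show ?thesis by (simp add: card_subset_eq)
qed

context projective_space_dim
begin

lemma enumerate_base_from:
  assumes B: "is_base G B" and q: "q \<in> Y" "Y \<subseteq> B"
  shows "\<exists>y. bij_betw y {..n} B \<and> y 0 = q \<and> y ` {..<card Y} = Y"
proof -
  define r :: "'a \<Rightarrow> nat" where "r a = (if a = q then 0 else if a \<in> Y then 1 else 2)" for a
  obtain y where y: "bij_betw y {..n} B" "\<And>i j. i \<le> j \<Longrightarrow> j \<le> n \<Longrightarrow> r (y i) \<le> r (y j)"
    using enumerate_by_key[OF baseD(2,3)[OF B], of r] by blast
  have "y ` {..<card Y} = Y"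
    by (rule enumeration_initial_segment[of y n B r]) (use y q in \<open>auto simp: r_def\<close>)
  moreover have "y ` {..<card {q}} = {q}"
    by (rule enumeration_initial_segment[of y n B r]) (use y q in \<open>auto simp: r_def\<close>)
  then have "y 0 = q" by (simp add: lessThan_Suc)
  ultimately show ?thesis using y by blast
qed

lemma flag_through:
  assumes S: "has_rank S (Suc k)" "k < n" and q: "q \<in> S"
  shows "\<exists>F\<in>flags. F ! 0 = {q} \<and> F ! k = S"
proof -
  have qP: "q \<in> points G" using q S has_rank_subspace subspace_points by blast
  then have "independent G {q}" using independent_insert[of "{}" q] by (simp add: independent_def)
  then obtain Y where Y: "q \<in> Y" "independent G Y" "card Y = Suc k" "spanned G Y = S"
    using has_rank_basis_extend[of "{q}" S "Suc k"] S q by auto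
  obtain B where B: "Y \<subseteq> B" "is_base G B" using independent_extend_base Y by blast
  obtain y where y: "bij_betw y {..n} B" "y 0 = q" "y ` {..<card Y} = Y"
    using enumerate_base_from[OF B(2) Y(1) B(1)] by blast
  have "y ` {..k} = Y" using y(3) Y(3) by (simp add: lessThan_Suc_atMost)
  then have "flag y ! 0 = {q} \<and> flag y ! k = S" using S(2) Y(4) y(2) qP by simp
  moreover have "flag y \<in> flags" using flag_in_apartment[OF B(2) y(1)] by (simp add: apartment_of_def)
  ultimately show ?thesis by blast
qed

lemma flag_length: "F \<in> flags \<Longrightarrow> length F = n"
  by (simp add: maximal_flags_def)

lemma flag_rank: "F \<in> flags \<Longrightarrow> k < n \<Longrightarrow> has_rank (F ! k) (Suc k)"
  by (simp add: maximal_flags_def has_dim_iff)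

lemma flag_mono:
  "F \<in> flags \<Longrightarrow> i \<le> j \<Longrightarrow> j < n \<Longrightarrow> F ! i \<subseteq> F ! j"
  using sorted_wrt_nth_less[of "(\<subset>)" F i j]
  by (cases "i = j") (auto simp: maximal_flags_def)

lemma flag_point: "F \<in> flags \<Longrightarrow> 0 < n \<Longrightarrow> \<exists>p\<in>points G. F ! 0 = {p}"
  using flag_rank[of F 0] has_rank_1 by simp

lemma flag_eqI:
  "F \<in> flags \<Longrightarrow> D \<in> flags \<Longrightarrow> (\<And>k. k < n \<Longrightarrow> F ! k = D ! k) \<Longrightarrow> F = D"
  by (rule nth_equalityI) (simp_all add: flag_length)

lemma base_exists: "\<exists>B. is_base G B"
  using independent_extend_base[of "{}"] by (simp add: independent_def)

text \<open>Transposing the first two points of the enumeration changes only the initial segment of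
  length one.\<close>

lemma first_neighbour:
  assumes n: "0 < n" and B: "is_base G B" and F: "F \<in> apartment B"
  shows "\<exists>D\<in>apartment B. D \<noteq> F \<and> (\<forall>k<n. 0 < k \<longrightarrow> D ! k = F ! k)"
proof -
  obtain y where y: "bij_betw y {..n} B" "F = flag y" using apartment_flag B F by blast
  let ?\<tau> = "transpose 0 (1::nat)"
  have "bij_betw ?\<tau> {..n} {..n}" using n by (auto simp: bij_betw_def)
  then have z: "bij_betw (y \<circ> ?\<tau>) {..n} B" using y(1) bij_betw_trans by blast
  have im: "(y \<circ> ?\<tau>) ` {..k} = y ` {..k}" if "0 < k" for k
    using that unfolding image_comp[symmetric] by simp
  have "flag (y \<circ> ?\<tau>) \<noteq> F"
  proof
    assume "flag (y \<circ> ?\<tau>) = F"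
    then have "y 1 = y 0" using flag_eq_iff[OF B z y(1), of 0] y(2) by simp
    then show False using y(1) n by (auto simp: bij_betw_def inj_on_def)
  qed
  moreover have "flag (y \<circ> ?\<tau>) ! k = F ! k" if "k < n" "0 < k" for k
    using im[OF that(2)] that(1) y(2) by simp
  ultimately show ?thesis using flag_in_apartment[OF B z] by blast
qed

lemma flag_nth_eq_iff:
  assumes B: "is_base G B" and y: "bij_betw y {..n} B" and z: "bij_betw z {..n} B" and "k < n"
    and eq: "flag y ! k = flag z ! k"
  shows "y ` {..k} = z ` {..k}"
proof -
  have "spanned G (y ` {..k}) = spanned G (z ` {..k})" using eq assms(4) by simp
  then have "B \<inter> spanned G (y ` {..k}) = B \<inter> spanned G (z ` {..k})" by (rule arg_cong)
  then show ?thesis unfolding base_Int_span[OF B y less_imp_le[OF assms(4)]]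
      base_Int_span[OF B z less_imp_le[OF assms(4)]] .
qed

end

text \<open>Translates reversed enumerations into complements: component \<open>n - 1 - k\<close> of
  a reversed flag is spanned by what the first \<open>k + 1\<close> points leave over.\<close>

lemma bij_betw_image_final_segment:
  assumes y: "bij_betw y {..n} B" and k: "k < n"
  shows "(\<lambda>i. y (n - i)) ` {..n - Suc k} = B - y ` {..k}"
proof -
  have inj: "inj_on y {..n}" and im: "y ` {..n} = B" using y by (auto simp: bij_betw_def)
  have seg: "(\<lambda>i. n - i) ` {..n - Suc k} = {..n} - {..k}"
  proof (intro equalityI subsetI)
    fix j assume "j \<in> {..n} - {..k}"
    then show "j \<in> (\<lambda>i. n - i) ` {..n - Suc k}"
      by (intro image_eqI[of _ _ "n - j"]) auto
  qed (use k in auto)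
  have "(\<lambda>i. y (n - i)) ` {..n - Suc k} = y ` ({..n} - {..k})"
    unfolding seg[symmetric] by (simp add: image_image)
  also have "\<dots> = B - y ` {..k}"
    using inj_on_image_set_diff[OF inj, of "{..n}" "{..k}"] im k by auto
  finally show ?thesis .
qed

context apartment_map
begin

section \<open>Adjacency in the first component\<close>

lemma f_in_flags: "F \<in> P.flags \<Longrightarrow> f F \<in> P'.flags"
  using f_flags by blast

lemma straight_nth:
  assumes B: "is_base P B" and st: "straight B B' \<pi>"
    and F: "F \<in> P.apartment B" and D: "D \<in> P.apartment B" and k: "k < n" "F ! k = D ! k"
  shows "f F ! k = f D ! k"
proof -
  obtain y z where y: "bij_betw y {..n} B" "F = P.flag y" and z: "bij_betw z {..n} B" "D = P.flag z"
    using P.apartment_flag[OF B] F D by blast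
  have eq: "y ` {..k} = z ` {..k}" using P.flag_nth_eq_iff[OF B y(1) z(1) k(1)] k(2) y(2) z(2) by simp
  have "f F = P'.flag (\<pi> \<circ> y)" "f D = P'.flag (\<pi> \<circ> z)" using st y z by (auto simp: straight_def)
  then show ?thesis by (simp only: nth_flag_of[OF k(1)] image_comp[symmetric] eq)
qed

lemma twisted_nth:
  assumes B: "is_base P B" and tw: "twisted B B' \<pi>"
    and F: "F \<in> P.apartment B" and D: "D \<in> P.apartment B" and k: "k < n" "F ! k = D ! k"
  shows "f F ! (n - Suc k) = f D ! (n - Suc k)"
proof -
  obtain y z where y: "bij_betw y {..n} B" "F = P.flag y" and z: "bij_betw z {..n} B" "D = P.flag z"
    using P.apartment_flag[OF B] F D by blast
  have "y ` {..k} = z ` {..k}" using P.flag_nth_eq_iff[OF B y(1) z(1) k(1)] k(2) y(2) z(2) by simp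
  then have eq: "(\<lambda>i. y (n - i)) ` {..n - Suc k} = (\<lambda>i. z (n - i)) ` {..n - Suc k}"
    using bij_betw_image_final_segment[OF y(1) k(1)] bij_betw_image_final_segment[OF z(1) k(1)]
    by simp
  have im: "(\<lambda>i. \<pi> (w (n - i))) ` {..n - Suc k} = \<pi> ` ((\<lambda>i. w (n - i)) ` {..n - Suc k})"
    for w :: "nat \<Rightarrow> 'a" by (simp add: image_image)
  have "f F = P'.flag (\<lambda>i. \<pi> (y (n - i)))" "f D = P'.flag (\<lambda>i. \<pi> (z (n - i)))"
    using tw y z by (auto simp: twisted_def)
  moreover have "n - Suc k < n" using k(1) by simp
  ultimately show ?thesis by (simp only: nth_flag_of im eq)
qed

text \<open>Adjacency at the first position, equality included. The type \<open>'c\<close> is free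
  because flags of both spaces are compared.\<close>

definition upper_equal :: "'c set list \<Rightarrow> 'c set list \<Rightarrow> bool" where
  "upper_equal F D \<longleftrightarrow> (\<forall>k<n. 0 < k \<longrightarrow> F ! k = D ! k)"

lemma upper_equal_straight:
  assumes "is_base P B" "straight B B' \<pi>" "F \<in> P.apartment B" "D \<in> P.apartment B" "upper_equal F D"
  shows "upper_equal (f F) (f D)"
  using straight_nth[OF assms(1-4)] assms(5) unfolding upper_equal_def by blast

text \<open>Position \<open>k\<close> of the images corresponds to position \<open>n - 1 - k\<close>
  of the originals, so a change in the first component can show only in the last.\<close>

lemma upper_equal_twisted:
  assumes "is_base P B" "twisted B B' \<pi>" "F \<in> P.apartment B" "D \<in> P.apartment B" "upper_equal F D"
    and "Suc k < n"
  shows "f F ! k = f D ! k"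
  using twisted_nth[OF assms(1-4), of "n - Suc k"] assms(5,6) unfolding upper_equal_def
  by (simp add: Suc_diff_Suc)

text \<open>For \<open>n \<ge> 2\<close> the first and the last position differ, so together the two
  agreements cover all positions; injectivity of \<open>f\<close> finishes.\<close>

lemma upper_equal_eq:
  assumes "F \<in> P.flags" "D \<in> P.flags" "upper_equal (f F) (f D)"
    and "\<And>k. Suc k < n \<Longrightarrow> f F ! k = f D ! k"
  shows "F = D"
proof -
  have "f F = f D"
  proof (rule P'.flag_eqI[OF f_in_flags f_in_flags])
    fix k assume "k < n"
    then show "f F ! k = f D ! k" using assms(3,4) n unfolding upper_equal_def
      by (cases k) auto
  qed (use assms in auto)
  then show ?thesis using inj_f assms(1,2) by (auto simp: inj_on_def)
qed

text \<open>A property of a single flag, independent of any apartment; it carries the type of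
  \<open>f\<close> from one apartment to another through a shared flag.\<close>

definition good :: "'a set list \<Rightarrow> bool" where
  "good F \<longleftrightarrow> (\<forall>D\<in>P.flags. upper_equal F D \<longrightarrow> upper_equal (f F) (f D))"

text \<open>Three flags that pairwise agree above the first component have images that pairwise agree
  outside one common position, so a single pair decides between the first and the last.\<close>

lemma good_from_pair:
  assumes F: "F \<in> P.flags" and D: "D \<in> P.flags" "D \<noteq> F" "upper_equal F D" "upper_equal (f F) (f D)"
  shows "good F"
  unfolding good_def
proof (intro ballI impI)
  fix E assume E: "E \<in> P.flags" "upper_equal F E"
  have ED: "upper_equal E D" using E D unfolding upper_equal_def by metis
  obtain B where B: "is_base P B" "F \<in> P.apartment B" "E \<in> P.apartment B"
    using P.common_apartment F E by blast
  obtain C where C: "is_base P C" "E \<in> P.apartment C" "D \<in> P.apartment C"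
    using P.common_apartment D E by blast
  obtain B' \<pi> where B': "straight B B' \<pi> \<or> twisted B B' \<pi>" using straight_or_twisted B by blast
  obtain C' \<rho> where C': "straight C C' \<rho> \<or> twisted C C' \<rho>" using straight_or_twisted C by blast
  show "upper_equal (f F) (f E)"
  proof (rule ccontr)
    assume no: "\<not> upper_equal (f F) (f E)"
    then have tB: "twisted B B' \<pi>" using B' upper_equal_straight B E by blast
    have "\<not> upper_equal (f E) (f D)" using no D(4) unfolding upper_equal_def by metis
    then have tC: "twisted C C' \<rho>" using C' upper_equal_straight C ED by blast
    \<comment> \<open>Passing from \<open>F\<close> to \<open>E\<close> and from \<open>E\<close> to
      \<open>D\<close> changes only the last component of the image, while \<open>f F\<close> and
      \<open>f D\<close> differ at most in the first.\<close>
    have "f F ! k = f D ! k" if "Suc k < n" for k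
      using upper_equal_twisted[OF B(1) tB B(2,3) E(2) that]
        upper_equal_twisted[OF C(1) tC C(2,3) ED that] by simp
    then show False using upper_equal_eq F D by blast
  qed
qed

text \<open>In a twisted apartment the image of the first neighbour of \<open>F\<close> would agree
  with \<open>f F\<close> outside the last position; as \<open>F\<close> is good, it also agrees
  outside the first, which would make the neighbour equal to \<open>F\<close>.\<close>

lemma good_imp_straight:
  assumes B: "is_base P B" and F: "F \<in> P.apartment B" "good F"
  shows "\<exists>B' \<pi>. straight B B' \<pi>"
proof -
  obtain B' \<pi> where B': "straight B B' \<pi> \<or> twisted B B' \<pi>" using straight_or_twisted B by blast
  obtain D where D: "D \<in> P.apartment B" "D \<noteq> F" "\<forall>k<n. 0 < k \<longrightarrow> D ! k = F ! k"
    using P.first_neighbour[OF _ B F(1)] n by auto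
  have FD: "upper_equal F D" using D(3) unfolding upper_equal_def by simp
  have flags: "F \<in> P.flags" "D \<in> P.flags" using F D apartment_subset_flags by blast+
  then have ue: "upper_equal (f F) (f D)" using F(2) FD unfolding good_def by blast
  have "\<not> twisted B B' \<pi>"
  proof
    assume "twisted B B' \<pi>"
    then have "F = D" using upper_equal_eq[OF flags ue] upper_equal_twisted[OF B _ F(1) D(1) FD] by blast
    then show False using D(2) by simp
  qed
  then show ?thesis using B' by blast
qed

lemma straight_imp_good:
  assumes B: "is_base P B" "straight B B' \<pi>" and F: "F \<in> P.apartment B"
  shows "good F"
proof -
  obtain D where D: "D \<in> P.apartment B" "D \<noteq> F" "\<forall>k<n. 0 < k \<longrightarrow> D ! k = F ! k"
    using P.first_neighbour[OF _ B(1) F] n by auto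
  have FD: "upper_equal F D" using D(3) unfolding upper_equal_def by simp
  have "F \<in> P.flags" "D \<in> P.flags" using F D apartment_subset_flags by blast+
  then show ?thesis using good_from_pair D(2) FD upper_equal_straight[OF B F D(1) FD] by blast
qed

lemma flag_in_some_apartment: "F \<in> P.flags \<Longrightarrow> \<exists>B. is_base P B \<and> F \<in> P.apartment B"
  using P.common_apartment by blast

lemma apartment_nonempty: "is_base P B \<Longrightarrow> \<exists>F. F \<in> P.apartment B"
  using P.flag_with_key by blast

text \<open>An apartment containing one flag of each of the two given apartments transfers the type
  between them.\<close>

lemma all_straight:
  assumes B: "is_base P B" "straight B B' \<pi>" and C: "is_base P C"
  shows "\<exists>C' \<rho>. straight C C' \<rho>"
proof -
  obtain F D where F: "F \<in> P.apartment B" and D: "D \<in> P.apartment C" using apartment_nonempty B C by blast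
  then obtain E where E: "is_base P E" "F \<in> P.apartment E" "D \<in> P.apartment E"
    using P.common_apartment apartment_subset_flags by blast
  obtain E' \<sigma> where "straight E E' \<sigma>" using good_imp_straight[OF E(1,2)] straight_imp_good[OF B F] by blast
  then have "good D" using straight_imp_good E by blast
  then show ?thesis using good_imp_straight C D by blast
qed

end

section \<open>The induced embedding\<close>

context projective_space
begin

lemma line_is_subspace: "l \<in> lines G \<Longrightarrow> is_subspace G l"
  unfolding is_subspace_def using line_subset line_through_eq by blast

lemma spanned_pair:
  assumes "p \<in> points G" "q \<in> points G" "p \<noteq> q"
  shows "spanned G {p, q} = line_through G p q" "independent G {p, q}"
proof -
  note l = line_through_props[OF assms]
  have "spanned G {p, q} \<subseteq> line_through G p q"
    using spanned_minimal[of "{p, q}"] line_is_subspace l by simp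
  moreover have "line_through G p q \<subseteq> spanned G {p, q}"
    using subspaceD[OF is_subspace_spanned, of "{p, q}" p q] assms spanned_subset[of "{p, q}"] by simp
  ultimately show "spanned G {p, q} = line_through G p q" by blast
  have "independent G {q}" using assms independent_insert[of "{}" q] by (simp add: independent_def)
  then show "independent G {p, q}" using independent_insert[of "{q}" p] assms by simp
qed

lemma has_rank_2: "has_rank S 2 \<longleftrightarrow> S \<in> lines G"
proof
  assume "has_rank S 2"
  then obtain X where X: "independent G X" "card X = 2" "spanned G X = S" unfolding has_rank_def by blast
  then obtain p q where "X = {p, q}" "p \<noteq> q" by (auto simp: card_2_iff)
  then show "S \<in> lines G" using X spanned_pair line_through_props independent_points[of X] by auto
next
  assume S: "S \<in> lines G"
  then obtain p q where pq: "p \<in> S" "q \<in> S" "p \<noteq> q" using thick by metis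
  then have P: "p \<in> points G" "q \<in> points G" using S line_subset by blast+
  have "spanned G {p, q} = S" using spanned_pair[OF P pq(3)] line_through_eq[OF S pq] by simp
  then show "has_rank S 2" using has_rankI[OF spanned_pair(2)[OF P pq(3)]] pq(3)
    by (simp add: numeral_2_eq_2)
qed

lemma independent_triple_noncollinear:
  assumes "independent G {a, b, c}" "a \<noteq> b" "a \<noteq> c" "b \<noteq> c"
  shows "\<not> collinear3 G a b c"
proof
  assume "collinear3 G a b c"
  then obtain l where l: "l \<in> lines G" "a \<in> l" "b \<in> l" "c \<in> l" unfolding collinear3_def by blast
  have P: "a \<in> points G" "b \<in> points G" using l line_subset by blast+
  have "c \<in> spanned G {a, b}" using spanned_pair(1)[OF P assms(2)] line_through_eq[OF l(1-3) assms(2)] l by simp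
  then show False using independent_mem[OF assms(1), of "{a, b}" c] assms by auto
qed

end

lemma (in projective_space_dim) noncollinear_independent:
  assumes n: "1 \<le> n" and P: "a \<in> points G" "b \<in> points G" "c \<in> points G" and nc: "\<not> collinear3 G a b c"
  shows "independent G {a, b, c} \<and> a \<noteq> b \<and> a \<noteq> c \<and> b \<noteq> c"
proof -
  \<comment> \<open>A second point gives a line through \<open>a\<close>, so that even
    \<open>a = b = c\<close> would be collinear.\<close>
  have "\<not> points G \<subseteq> {a}"
  proof
    assume "points G \<subseteq> {a}"
    then have "has_rank (points G) (Suc 0)" using has_rank_1 P(1) by blast
    then show False using has_rank_unique[OF rank_points] n by force
  qed
  then obtain d where d: "d \<in> points G" "d \<noteq> a" by blast
  have two: "\<exists>l\<in>lines G. p \<in> l \<and> q \<in> l" if "p \<in> points G" "q \<in> points G" "p \<noteq> q" for p q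
    using line_through_props[OF that] by blast
  have ne: "a \<noteq> b \<and> a \<noteq> c \<and> b \<noteq> c"
    using two[of a b] two[of a c] two[of b c] two[of a d] d P nc unfolding collinear3_def by metis
  then have ab: "a \<noteq> b" by simp
  have "c \<notin> spanned G {a, b}"
    using spanned_pair(1)[OF P(1,2) ab] line_through_props[OF P(1,2) ab] nc unfolding collinear3_def by blast
  then have "independent G {c, a, b}"
    using independent_insert[OF spanned_pair(2)[OF P(1,2) ab] P(3)] by simp
  then show ?thesis using ne by (simp add: insert_commute)
qed

context apartment_map
begin

context
  assumes straight: "\<And>B. is_base P B \<Longrightarrow> \<exists>B' \<pi>. straight B B' \<pi>"
begin

text \<open>Since any two flags share an apartment, what \<open>straight_nth\<close> says inside one
  apartment holds globally.\<close>

lemma nth_determined: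
  assumes "F \<in> P.flags" "D \<in> P.flags" "k < n" "F ! k = D ! k"
  shows "f F ! k = f D ! k"
  using P.common_apartment[OF assms(1,2)] straight straight_nth assms(3,4) by blast

text \<open>Every point of \<open>P\<close> begins some flag, and by \<open>nth_determined\<close>
  the choice of this flag does not matter.\<close>

definition point_map :: "'a \<Rightarrow> 'b" where
  "point_map p = (THE q. \<exists>F\<in>P.flags. F ! 0 = {p} \<and> f F ! 0 = {q})"

lemma point_map:
  assumes F: "F \<in> P.flags" "F ! 0 = {p}"
  shows "f F ! 0 = {point_map p}"
proof -
  obtain q where q: "f F ! 0 = {q}" using P'.flag_point[OF f_in_flags[OF F(1)]] n by auto
  have "point_map p = q" unfolding point_map_def
  proof (rule the_equality)
    fix q' assume "\<exists>D\<in>P.flags. D ! 0 = {p} \<and> f D ! 0 = {q'}"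
    then obtain D where "D \<in> P.flags" "D ! 0 = {p}" "f D ! 0 = {q'}" by blast
    then show "q' = q" using nth_determined[OF F(1), of D 0] F q n by simp
  qed (use F q in blast)
  then show ?thesis using q by simp
qed

lemma point_map_points:
  assumes "p \<in> points P"
  shows "point_map p \<in> points P'"
proof -
  have "P.has_rank {p} (Suc 0)" using P.has_rank_1 assms by blast
  then obtain F where F: "F \<in> P.flags" "F ! 0 = {p}" using P.flag_through[of "{p}" 0 p] n by auto
  then show ?thesis using point_map[OF F] P'.flag_point[OF f_in_flags[OF F(1)]] n by auto
qed

lemma point_map_base:
  assumes B: "is_base P B" "straight B B' \<pi>" and b: "b \<in> B"
  shows "point_map b = \<pi> b"
proof -
  obtain y where y: "bij_betw y {..n} B" "y 0 = b" using P.enumerate_base_from[OF B(1) b subset_refl] by blast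
  have "b \<in> points P" using P.baseD(4)[OF B(1)] b by blast
  then have "P.flag y ! 0 = {b}" using y n by simp
  moreover have "P.flag y \<in> P.flags" using P.flag_in_apartment[OF B(1) y(1)] apartment_subset_flags by blast
  ultimately have "f (P.flag y) ! 0 = {point_map b}" by (rule point_map[rotated])
  moreover have "\<pi> b \<in> points P'"
    using B(2) b P'.baseD(4)[of B'] bij_betwE unfolding straight_def by blast
  then have "f (P.flag y) ! 0 = {\<pi> b}" using B(2) y n unfolding straight_def by simp
  ultimately show ?thesis by simp
qed

text \<open>On a base containing \<open>X\<close> the point map is the vertex map of that apartment,
  a bijection onto a base of \<open>P'\<close>.\<close>

lemma point_map_independent:
  assumes X: "independent P X"
  shows "independent P' (point_map ` X)" "inj_on point_map X"
proof -
  obtain B where B: "X \<subseteq> B" "is_base P B" using P.independent_extend_base X by blast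
  obtain B' \<pi> where st: "straight B B' \<pi>" using straight B by blast
  have eq: "point_map b = \<pi> b" if "b \<in> X" for b using point_map_base[OF B(2) st] that B by blast
  have \<pi>: "bij_betw \<pi> B B'" "is_base P' B'" using st unfolding straight_def by auto
  have "point_map ` X = \<pi> ` X" using eq by (rule image_cong[OF refl])
  then have "point_map ` X \<subseteq> B'" using \<pi>(1) B(1) by (auto simp: bij_betw_def)
  then show "independent P' (point_map ` X)" using P'.independent_mono P'.baseD(1)[OF \<pi>(2)] by blast
  have "inj_on \<pi> X" using \<pi>(1) B(1) inj_on_subset by (auto simp: bij_betw_def)
  then show "inj_on point_map X" using eq by (simp cong: inj_on_cong)
qed

lemma point_map_inj: "inj_on point_map (points P)"
proof (rule inj_onI, rule ccontr)
  fix p q assume pq: "p \<in> points P" "q \<in> points P" "point_map p = point_map q" "p \<noteq> q"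
  show False using point_map_independent(2)[OF P.spanned_pair(2)[OF pq(1,2,4)]] pq by simp
qed

text \<open>A flag starting at \<open>p\<close> with the same component in position \<open>k\<close>
  has an image with that component \<open>f F ! k\<close>, and this image starts at
  \<open>point_map p\<close>.\<close>

lemma point_map_mem:
  assumes "F \<in> P.flags" "k < n" "p \<in> F ! k"
  shows "point_map p \<in> f F ! k"
proof -
  obtain D where D: "D \<in> P.flags" "D ! 0 = {p}" "D ! k = F ! k"
    using P.flag_through[OF P.flag_rank[OF assms(1,2)] assms(2,3)] by blast
  have "point_map p \<in> f D ! 0" using point_map[OF D(1,2)] by simp
  then have "point_map p \<in> f D ! k" using P'.flag_mono[OF f_in_flags[OF D(1)], of 0 k] assms(2) by blast
  then show ?thesis using nth_determined[OF D(1) assms(1,2) D(3)] by simp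
qed

lemma flag_line: "F \<in> P.flags \<Longrightarrow> F ! 1 \<in> lines P"
  using P.flag_rank[of F 1] P.has_rank_2 n by (simp add: numeral_2_eq_2)

lemma flag_line': "F \<in> P'.flags \<Longrightarrow> F ! 1 \<in> lines P'"
  using P'.flag_rank[of F 1] P'.has_rank_2 n by (simp add: numeral_2_eq_2)

lemma line_flag:
  assumes "l \<in> lines P" "p \<in> l"
  shows "\<exists>F\<in>P.flags. F ! 0 = {p} \<and> F ! 1 = l"
  using P.flag_through[of l 1 p] P.has_rank_2[of l] assms n by (simp add: numeral_2_eq_2)

lemma line_flag':
  assumes "l \<in> lines P'" "p \<in> l"
  shows "\<exists>F\<in>P'.flags. F ! 0 = {p} \<and> F ! 1 = l"
  using P'.flag_through[of l 1 p] P'.has_rank_2[of l] assms n by (simp add: numeral_2_eq_2)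

lemma point_map_line:
  assumes "F \<in> P.flags"
  shows "point_map ` (F ! 1) \<subseteq> f F ! 1"
  using point_map_mem[OF assms, of 1] n by auto

lemma point_map_noncollinear:
  assumes "a \<in> points P" "b \<in> points P" "c \<in> points P" "\<not> collinear3 P a b c"
  shows "\<not> collinear3 P' (point_map a) (point_map b) (point_map c)"
proof -
  have abc: "independent P {a, b, c}" "a \<noteq> b" "a \<noteq> c" "b \<noteq> c"
    using P.noncollinear_independent[OF _ assms] n by auto
  show ?thesis
    using P'.independent_triple_noncollinear[of "point_map a" "point_map b" "point_map c"]
      point_map_independent[OF abc(1)] abc(2-4) by auto
qed

lemma point_map_strong_embedding: "strong_embedding P P' point_map"
  unfolding strong_embedding_def embedding_def
proof (intro conjI allI impI ballI point_map_inj point_map_independent point_map_noncollinear)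
  show "point_map ` points P \<subseteq> points P'" using point_map_points by blast
  fix l assume l: "l \<in> lines P"
  then obtain p where "p \<in> l" using P.thick by blast
  then obtain F where F: "F \<in> P.flags" "F ! 1 = l" using line_flag l by blast
  show "\<exists>m\<in>lines P'. point_map ` l \<subseteq> m"
    using point_map_line[OF F(1)] flag_line'[OF f_in_flags[OF F(1)]] F(2) by auto
qed

text \<open>The images of the base points spanning \<open>F ! k\<close> already span
  \<open>f F ! k\<close>; the images of all other points of \<open>F ! k\<close> stay inside by
  \<open>point_map_mem\<close>.\<close>

lemma point_map_induces:
  assumes F: "F \<in> P.flags"
  shows "f F = induced P' point_map F"
proof (rule nth_equalityI)
  show "length (f F) = length (induced P' point_map F)"
    using F P.flag_length P'.flag_length[OF f_in_flags] by (simp add: induced_def)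
  fix k assume "k < length (f F)"
  then have k: "k < n" using P'.flag_length[OF f_in_flags[OF F]] by simp
  obtain B where B: "is_base P B" "F \<in> P.apartment B" using flag_in_some_apartment F by blast
  obtain B' \<pi> where st: "straight B B' \<pi>" using straight B by blast
  obtain y where y: "bij_betw y {..n} B" "F = P.flag y" using P.apartment_flag B by blast
  have "y ` {..k} \<subseteq> B" using y(1) k by (auto simp: bij_betw_def)
  then have im: "(\<pi> \<circ> y) ` {..k} = point_map ` (y ` {..k})"
    using point_map_base[OF B(1) st] unfolding image_comp by (intro image_cong) auto
  have Fk: "F ! k = spanned P (y ` {..k})" using y(2) k by simp
  have "f F ! k = spanned P' (point_map ` (y ` {..k}))"
    using st y k im unfolding straight_def by simp
  also have "\<dots> \<subseteq> spanned P' (point_map ` (F ! k))"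
    unfolding Fk by (intro P'.spanned_mono image_mono P.spanned_subset)
  finally have "f F ! k \<subseteq> spanned P' (point_map ` (F ! k))" .
  moreover have "spanned P' (point_map ` (F ! k)) \<subseteq> f F ! k"
    using P'.spanned_minimal[of _ "f F ! k"] point_map_mem[OF F k]
      P'.has_rank_subspace[OF P'.flag_rank[OF f_in_flags[OF F] k]] by blast
  ultimately show "f F ! k = induced P' point_map F ! k"
    using k P.flag_length[OF F] by (simp add: induced_def)
qed

text \<open>For a point \<open>q\<close> of the image line, the flag starting with \<open>q\<close>
  and this line has a preimage \<open>D\<close>. Its line lies in \<open>F ! 1\<close>, since a
  point outside would form a noncollinear triple with two points of \<open>F ! 1\<close>, yet all
  three would be mapped into one line.\<close>

lemma point_map_line_surj:
  assumes surj: "f ` P.flags = P'.flags" and F: "F \<in> P.flags"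
  shows "point_map ` (F ! 1) = f F ! 1"
proof (intro equalityI point_map_line[OF F] subsetI)
  fix q assume q: "q \<in> f F ! 1"
  then obtain D' where D': "D' \<in> P'.flags" "D' ! 0 = {q}" "D' ! 1 = f F ! 1"
    using line_flag' flag_line'[OF f_in_flags[OF F]] by blast
  then obtain D where D: "D \<in> P.flags" "D' = f D" using surj by blast
  obtain p where p: "D ! 0 = {p}" using P.flag_point[OF D(1)] n by auto
  have "q = point_map p" using point_map[OF D(1) p] D' D by simp
  moreover have "p \<in> D ! 1" using P.flag_mono[OF D(1), of 0 1] p n by auto
  moreover have "D ! 1 \<subseteq> F ! 1"
  proof (rule subsetI, rule ccontr)
    fix c assume c: "c \<in> D ! 1" "c \<notin> F ! 1"
    have l: "F ! 1 \<in> lines P" using flag_line F by blast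
    obtain a b where ab: "a \<in> F ! 1" "b \<in> F ! 1" "a \<noteq> b" using P.thick[OF l] by blast
    have P: "a \<in> points P" "b \<in> points P" "c \<in> points P"
      using ab c P.line_subset[OF l] P.line_subset[OF flag_line[OF D(1)]] by blast+
    have "\<not> collinear3 P a b c"
    proof
      assume "collinear3 P a b c"
      then obtain m where "m \<in> lines P" "a \<in> m" "b \<in> m" "c \<in> m" unfolding collinear3_def by blast
      then show False using P.line_through_eq[of _ a b] l ab c by metis
    qed
    then have "\<not> collinear3 P' (point_map a) (point_map b) (point_map c)"
      using point_map_noncollinear P by blast
    moreover have "{point_map a, point_map b, point_map c} \<subseteq> f F ! 1"
      using point_map_line[OF F] point_map_line[OF D(1)] ab c D' D by auto
    ultimately show False using flag_line'[OF f_in_flags[OF F]] unfolding collinear3_def by blast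
  qed
  ultimately show "q \<in> point_map ` (F ! 1)" by blast
qed

lemma point_map_collineation:
  assumes surj: "f ` P.flags = P'.flags"
  shows "collineation P P' point_map"
  unfolding collineation_def
proof
  have "q \<in> point_map ` points P" if q: "q \<in> points P'" for q
  proof -
    have "P'.has_rank {q} (Suc 0)" using P'.has_rank_1 q by blast
    then obtain F' where F': "F' \<in> P'.flags" "F' ! 0 = {q}" using P'.flag_through[of "{q}" 0 q] n by auto
    then obtain F where F: "F \<in> P.flags" "F' = f F" using surj by blast
    obtain p where p: "p \<in> points P" "F ! 0 = {p}" using P.flag_point[OF F(1)] n by auto
    then show ?thesis using point_map[OF F(1) p(2)] F F' by auto
  qed
  then show "bij_betw point_map (points P) (points P')"
    using point_map_inj point_map_points by (auto simp: bij_betw_def)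
  show "(\<lambda>l. point_map ` l) ` lines P = lines P'"
  proof (intro equalityI subsetI)
    fix m assume "m \<in> (\<lambda>l. point_map ` l) ` lines P"
    then obtain l where l: "l \<in> lines P" "m = point_map ` l" by blast
    obtain p where "p \<in> l" using P.thick[OF l(1)] by blast
    then obtain F where "F \<in> P.flags" "F ! 1 = l" using line_flag l by blast
    then show "m \<in> lines P'" using point_map_line_surj[OF surj] l flag_line' f_in_flags by metis
  next
    fix m assume m: "m \<in> lines P'"
    obtain p where "p \<in> m" using P'.thick[OF m] by blast
    then obtain F' where F': "F' \<in> P'.flags" "F' ! 1 = m" using line_flag' m by blast
    then obtain F where F: "F \<in> P.flags" "F' = f F" using surj by blast
    then show "m \<in> (\<lambda>l. point_map ` l) ` lines P"
      using point_map_line_surj[OF surj F(1)] F' flag_line by blast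
  qed
qed

lemma straight_conclusion:
  "(\<exists>s. strong_embedding P P' s \<and> (\<forall>F\<in>P.flags. f F = induced P' s F)) \<and>
   (f ` P.flags = P'.flags \<longrightarrow>
     (\<exists>s. collineation P P' s \<and> (\<forall>F\<in>P.flags. f F = induced P' s F)))"
  using point_map_strong_embedding point_map_induces point_map_collineation by blast

end

section \<open>The order-reversing case, by passing to the dual of \<open>P'\<close>\<close>

lemma dual_apartment_map: "apartment_map P (dual_space n P') n (P'.dual_flag \<circ> f)"
proof -
  interpret D: projective_space_dim "dual_space n P'" n
    by (rule P'.projective_space_dim_dual[OF n])
  show ?thesis
  proof
    show "(P'.dual_flag \<circ> f) ` P.flags \<subseteq> D.flags"
      using f_in_flags P'.dual_flag_in_flags[OF n] by auto
    fix A assume "is_apartment n P A"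
    then obtain B where B: "is_base P' B" "f ` A = P'.apartment B"
      using f_apartment unfolding is_apartment_def by blast
    have "(P'.dual_flag \<circ> f) ` A = D.apartment (P'.dual_base B B)"
      unfolding image_comp[symmetric] B(2) by (rule P'.dual_flag_apartment[OF n B(1)])
    then show "is_apartment n (dual_space n P') ((P'.dual_flag \<circ> f) ` A)"
      using P'.dual_base_is_base[OF n B(1)] unfolding is_apartment_def by blast
  qed (rule n)
qed

text \<open>The new vertex map sends \<open>b\<close> to the hyperplane opposite to
  \<open>\<pi> b\<close> in \<open>B'\<close>. Two reversals cancel: component \<open>k\<close> of
  the dual flag consists of the hyperplanes over the span of the complement of the first
  \<open>k + 1\<close> image points, and is spanned by the hyperplanes opposite to these
  points.\<close>

lemma twisted_dual_straight:
  assumes B: "is_base P B" and tw: "twisted B B' \<pi>"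
  shows "apartment_map.straight P (dual_space n P') n (P'.dual_flag \<circ> f) B (P'.dual_base B' B')
    (\<lambda>b. spanned P' (B' - {\<pi> b}))"
proof -
  interpret Q: apartment_map P "dual_space n P'" n "P'.dual_flag \<circ> f"
    by (rule dual_apartment_map)
  have B': "is_base P' B'" and \<pi>: "bij_betw \<pi> B B'" using tw unfolding twisted_def by auto
  let ?D = "dual_space n P'" and ?h = "\<lambda>b. spanned P' (B' - {b})"
  have h: "bij_betw ?h B' (P'.dual_base B' B')"
    using P'.card_dual_base[OF n B' subset_refl] P'.baseD(2)[OF B']
    unfolding P'.dual_base_def[OF n] bij_betw_def by (simp add: eq_card_imp_inj_on)
  have "(P'.dual_flag \<circ> f) (P.flag y) = flag_of n ?D ((\<lambda>b. ?h (\<pi> b)) \<circ> y)"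
    if y: "bij_betw y {..n} B" for y
  proof (rule nth_equalityI)
    have fy: "f (P.flag y) = P'.flag (\<lambda>i. \<pi> (y (n - i)))" using tw y unfolding twisted_def by blast
    show "length ((P'.dual_flag \<circ> f) (P.flag y)) = length (flag_of n ?D ((\<lambda>b. ?h (\<pi> b)) \<circ> y))"
      using fy by (simp add: P'.dual_flag_def[OF n])
    fix k assume "k < length ((P'.dual_flag \<circ> f) (P.flag y))"
    then have k: "k < n" using fy by (simp add: P'.dual_flag_def[OF n])
    have z: "bij_betw (\<pi> \<circ> y) {..n} B'" using bij_betw_trans[OF y \<pi>] .
    let ?Y = "(\<pi> \<circ> y) ` {..k}"
    have YB: "?Y \<subseteq> B'" using z k by (auto simp: bij_betw_def)
    have "(P'.dual_flag \<circ> f) (P.flag y) ! k = hyperplanes_containing n P' (f (P.flag y) ! (n - Suc k))"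
      using k fy by (simp add: P'.dual_flag_def[OF n] rev_nth)
    also have "f (P.flag y) ! (n - Suc k) = spanned P' ((\<lambda>i. (\<pi> \<circ> y) (n - i)) ` {..n - Suc k})"
      using k fy by simp
    also have "(\<lambda>i. (\<pi> \<circ> y) (n - i)) ` {..n - Suc k} = B' - ?Y"
      by (rule bij_betw_image_final_segment[OF z k])
    also have "hyperplanes_containing n P' (spanned P' (B' - ?Y)) = spanned ?D (P'.dual_base B' ?Y)"
      using P'.spanned_dual_base[OF n B' YB] by simp
    also have "\<dots> = flag_of n ?D ((\<lambda>b. ?h (\<pi> b)) \<circ> y) ! k"
      using k by (simp add: P'.dual_base_def[OF n] image_image)
    finally show "(P'.dual_flag \<circ> f) (P.flag y) ! k = flag_of n ?D ((\<lambda>b. ?h (\<pi> b)) \<circ> y) ! k" .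
  qed
  moreover have "bij_betw (\<lambda>b. ?h (\<pi> b)) B (P'.dual_base B' B')"
    using bij_betw_trans[OF \<pi> h] by (simp add: o_def)
  ultimately show ?thesis unfolding Q.straight_def using P'.dual_base_is_base[OF n B'] by blast
qed

lemma straight_or_dual:
  "((\<exists>s. strong_embedding P P' s \<and> (\<forall>F\<in>P.flags. f F = induced P' s F)) \<or>
    (\<exists>s. strong_embedding P (dual_space n P') s \<and> (\<forall>F\<in>P.flags. f F = dual_induced n P' s F))) \<and>
   (f ` P.flags = P'.flags \<longrightarrow>
     (\<exists>s. collineation P P' s \<and> (\<forall>F\<in>P.flags. f F = induced P' s F)) \<or>
     (\<exists>s. collineation P (dual_space n P') s \<and> (\<forall>F\<in>P.flags. f F = dual_induced n P' s F)))"
proof -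
  obtain B where B: "is_base P B" using P.base_exists by blast
  obtain B' \<pi> where "straight B B' \<pi> \<or> twisted B B' \<pi>" using straight_or_twisted B by blast
  then show ?thesis
  proof
    assume "straight B B' \<pi>"
    then have "\<And>C. is_base P C \<Longrightarrow> \<exists>C' \<rho>. straight C C' \<rho>" using all_straight B by blast
    from straight_conclusion[OF this] show ?thesis by blast
  next
    assume tw: "twisted B B' \<pi>"
    interpret Q: apartment_map P "dual_space n P'" n "P'.dual_flag \<circ> f"
      by (rule dual_apartment_map)
    have "\<And>C. is_base P C \<Longrightarrow> \<exists>C' \<rho>. Q.straight C C' \<rho>"
      using Q.all_straight[OF B twisted_dual_straight[OF B tw]] by blast
    note concl = Q.straight_conclusion[OF this]
    \<comment> \<open>Applying \<open>dual_corr\<close> and reversing the list undoes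
      \<open>dual_flag\<close>, which leaves \<open>f F\<close> itself.\<close>
    have ind: "f F = dual_induced n P' s F"
      if "F \<in> P.flags" "(P'.dual_flag \<circ> f) F = induced (dual_space n P') s F" for F s
      using P'.dual_flag_inverse[OF n f_in_flags[OF that(1)]] that(2) by (simp add: dual_induced_def)
    \<comment> \<open>Surjectivity passes to the composite because \<open>dual_flag\<close> reaches
      every maximal flag of the dual.\<close>
    have "(P'.dual_flag \<circ> f) ` P.flags = Q.P'.flags" if "f ` P.flags = P'.flags"
    proof -
      have "P'.dual_flag ` P'.flags = Q.P'.flags"
        using P'.dual_flag_in_flags[OF n] P'.dual_flag_surj[OF n] by blast
      then show ?thesis unfolding image_comp[symmetric] that .
    qed
    then show ?thesis using concl ind by blast
  qed
qed

end

theorem theorem3p1: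
  fixes P :: "'a geometry" and P' :: "'b geometry" and n :: nat
    and f :: "'a set list \<Rightarrow> 'b set list"
  assumes "projective_space P" and "projective_space P'"
    and "n \<ge> 2" and "has_dim P (points P) n" and "has_dim P' (points P') n"
    and "f ` maximal_flags n P \<subseteq> maximal_flags n P'"
    and "\<And>A. is_apartment n P A \<Longrightarrow> is_apartment n P' (f ` A)"
  shows "inj_on f (maximal_flags n P) \<and>
      ((\<exists>s. strong_embedding P P' s \<and> (\<forall>F\<in>maximal_flags n P. f F = induced P' s F)) \<or>
       (\<exists>s. strong_embedding P (dual_space n P') s \<and>
          (\<forall>F\<in>maximal_flags n P. f F = dual_induced n P' s F))) \<and>
      (f ` maximal_flags n P = maximal_flags n P' \<longrightarrow>
        (\<exists>s. collineation P P' s \<and> (\<forall>F\<in>maximal_flags n P. f F = induced P' s F)) \<or>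
        (\<exists>s. collineation P (dual_space n P') s \<and>
          (\<forall>F\<in>maximal_flags n P. f F = dual_induced n P' s F)))"
proof -
  interpret apartment_map P P' n f
    by (intro apartment_map.intro apartment_map_axioms.intro projective_space_dim.intro
        projective_space_dim_axioms.intro) (rule assms; assumption?)+
  show ?thesis using inj_f straight_or_dual by blast
qed

end
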